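(* Let $n\ge 1$. The vertex algebra $\mathcal{H}(n)^{O(n)}$ is generated as a vertex algebra by $j^0$ and $j^2$, where $j^{2m}=\sum_{i=1}^n:\alpha^i\,\partial^{2m}\alpha^i:$ for $m\ge 0$.
   Context: Everything is over $\mathbb{C}$. $\mathcal{H}(n)$ is the rank $n$ Heisenberg vertex algebra, generated by fields $\alpha^1,\dots,\alpha^n$ with OPE $\alpha^i(z)\alpha^j(w)\sim\delta_{i,j}(z-w)^{-2}$; $:\ :$ denotes the Wick product and $\partial$ the derivation. The complex orthogonal group $O(n)$ acts on $\mathcal{H}(n)$ by vertex algebra automorphisms, through its standard linear action on the span of the orthonormal vectors $\alpha^1,\dots,\alpha^n$; $\mathcal{H}(n)^{O(n)}$ is the subalgebra of invariants. A subset $S$ generates a vertex algebra $\mathcal{A}$ if every element of $\mathcal{A}$ is a linear combination of nonassociative words in elements of $S$ and the products $\circ_k$, $k\in\mathbb{Z}$, where $a\circ_k b=a(k)b$ is the $k$th product (the vacuum $1$ being always included). *)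

theory Defs
  imports "HOL-Analysis.Analysis" "HOL-Library.Groups_Big_Fun"
begin

record 'v va_data =
  scl :: "complex \<Rightarrow> 'v \<Rightarrow> 'v"
  vac :: 'v
  nprod :: "'v \<Rightarrow> int \<Rightarrow> 'v \<Rightarrow> 'v"

text \<open>
  Vertex algebras over the complex numbers, given by the products
  \<open>nprod V a k b = a(k)b = a \<circ>\<^sub>k b\<close>; the underlying vector space is the whole type.
  The sums in the Borcherds identity have finite support by axiom \<open>truncation\<close>,
  so \<^const>\<open>Sum_any\<close> is a genuine finite sum there.
\<close>

locale vertex_algebra = vector_space "scl V" for V :: "'v::ab_group_add va_data" +
  assumes nprod_linear_left: "Vector_Spaces.linear (scl V) (scl V) (\<lambda>a. nprod V a k b)"
    and nprod_linear_right: "Vector_Spaces.linear (scl V) (scl V) (\<lambda>b. nprod V a k b)"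
    and truncation: "\<exists>N. \<forall>k\<ge>N. nprod V a k b = 0"
    and vac_left: "nprod V (vac V) k a = (if k = -1 then a else 0)"
    and vac_right: "nprod V a (-1) (vac V) = a"
    and vac_right_nonneg: "k \<ge> 0 \<Longrightarrow> nprod V a k (vac V) = 0"
    and borcherds:
      "Sum_any (\<lambda>j::nat. scl V (of_int m gchoose j)
          (nprod V (nprod V a (n + int j) b) (m + k - int j) c))
       = Sum_any (\<lambda>j::nat. scl V ((-1) ^ j * (of_int n gchoose j))
          (nprod V a (m + n - int j) (nprod V b (k + int j) c)
           - scl V ((-1) powi n) (nprod V b (n + k - int j) (nprod V a (m + int j) c))))"

definition wick :: "'v::ab_group_add va_data \<Rightarrow> 'v \<Rightarrow> 'v \<Rightarrow> 'v" where
  "wick V a b = nprod V a (-1) b"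

definition va_deriv :: "'v::ab_group_add va_data \<Rightarrow> 'v \<Rightarrow> 'v" where
  "va_deriv V a = nprod V a (-2) (vac V)"

inductive_set va_words :: "'v::ab_group_add va_data \<Rightarrow> 'v set \<Rightarrow> 'v set"
  for V :: "'v va_data" and S :: "'v set" where
  vac: "vac V \<in> va_words V S"
| gen: "s \<in> S \<Longrightarrow> s \<in> va_words V S"
| nprod: "a \<in> va_words V S \<Longrightarrow> b \<in> va_words V S \<Longrightarrow> nprod V a k b \<in> va_words V S"

definition va_generated :: "'v::ab_group_add va_data \<Rightarrow> 'v set \<Rightarrow> 'v set" where
  "va_generated V S = module.span (scl V) (va_words V S)"

definition va_automorphism :: "'v::ab_group_add va_data \<Rightarrow> ('v \<Rightarrow> 'v) \<Rightarrow> bool" where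
  "va_automorphism V \<phi> \<longleftrightarrow>
     Vector_Spaces.linear (scl V) (scl V) \<phi> \<and> bij \<phi> \<and> \<phi> (vac V) = vac V \<and>
     (\<forall>a k b. \<phi> (nprod V a k b) = nprod V (\<phi> a) k (\<phi> b))"

text \<open>
  The Heisenberg vertex algebra of rank \<open>n = CARD('n)\<close> (so \<open>n \<ge> 1\<close>): the nonzero vertex
  algebra generated by \<open>\<alpha>\<^sup>i\<close> with \<open>\<alpha>\<^sup>i(z) \<alpha>\<^sup>j(w) \<sim> \<delta>\<^sub>i\<^sub>j (z-w)\<^sup>-\<^sup>2\<close>. The OPE records the products
  \<open>\<alpha>\<^sup>i \<circ>\<^sub>k \<alpha>\<^sup>j\<close> for \<open>k \<ge> 0\<close>, the coefficient of \<open>(z-w)\<^sup>-\<^sup>k\<^sup>-\<^sup>1\<close> being the \<open>k\<close>th product.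
  These data determine the vertex algebra up to isomorphism: as a module over the
  Heisenberg Lie algebra it is a nonzero quotient of the Fock module, which is irreducible.
\<close>

locale heisenberg = vertex_algebra V
  for V :: "'v::ab_group_add va_data" and \<alpha> :: "'n::finite \<Rightarrow> 'v" +
  assumes vac_nonzero: "vac V \<noteq> 0"
    and ope: "k \<ge> 0 \<Longrightarrow> nprod V (\<alpha> i) k (\<alpha> j) = (if i = j \<and> k = 1 then vac V else 0)"
    and generated: "va_generated V (range \<alpha>) = UNIV"

text \<open>
  The action of the complex orthogonal group (\<open>g\<^sup>T g = 1\<close>, transpose without conjugation):
  \<open>g\<close> acts by the automorphism extending its standard action on the span of the \<open>\<alpha>\<^sup>i\<close>.
\<close>

definition orth_act ::
  "'v::ab_group_add va_data \<Rightarrow> ('n::finite \<Rightarrow> 'v) \<Rightarrow> complex^'n^'n \<Rightarrow> 'v \<Rightarrow> 'v" where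
  "orth_act V \<alpha> g =
     (THE \<phi>. va_automorphism V \<phi> \<and> (\<forall>i. \<phi> (\<alpha> i) = (\<Sum>j\<in>UNIV. scl V (g $ j $ i) (\<alpha> j))))"

definition orth_invariants :: "'v::ab_group_add va_data \<Rightarrow> ('n::finite \<Rightarrow> 'v) \<Rightarrow> 'v set" where
  "orth_invariants V \<alpha> =
     {v. \<forall>g :: complex^'n^'n. orthogonal_matrix g \<longrightarrow> orth_act V \<alpha> g v = v}"

definition quad :: "'v::ab_group_add va_data \<Rightarrow> ('n::finite \<Rightarrow> 'v) \<Rightarrow> nat \<Rightarrow> 'v" where
  "quad V \<alpha> r = (\<Sum>i\<in>UNIV. wick V (\<alpha> i) ((va_deriv V ^^ r) (\<alpha> i)))"

text \<open>The description in \<^const>\<open>orth_act\<close> is met by at most one map:\<close>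

lemma (in heisenberg) automorphism_eqI:
  assumes "va_automorphism V \<phi>" "va_automorphism V \<psi>" "\<And>i. \<phi> (\<alpha> i) = \<psi> (\<alpha> i)"
  shows "\<phi> = \<psi>"
proof
  fix v
  interpret vector_space_pair "scl V" "scl V" ..
  have lin: "Vector_Spaces.linear (scl V) (scl V) \<phi>" "Vector_Spaces.linear (scl V) (scl V) \<psi>"
    using assms(1,2) by (auto simp: va_automorphism_def)
  have "\<phi> w = \<psi> w" if "w \<in> va_words V (range \<alpha>)" for w
    using that assms by induction (auto simp: va_automorphism_def)
  moreover have "v \<in> span (va_words V (range \<alpha>))"
    using generated by (simp add: va_generated_def)
  ultimately show "\<phi> v = \<psi> v"
    using linear_eq_on[OF lin] by blast
qed

end

theory Submission
  imports Defs "HOL-Computational_Algebra.Polynomial" "HOL-Library.Function_Algebras"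
begin

text \<open>
  The Heisenberg vertex algebra is a polynomial ring in variables \<open>y (i, k)\<close>, on which
  \<open>\<alpha>\<^sup>i(-k-1)\<close> acts by multiplication and \<open>\<alpha>\<^sup>i(k+1)\<close> by \<open>(k+1) \<partial>/\<partial>y (i, k)\<close>. Orthogonal matrices act by
  linear substitution, so the invariants are governed by the first fundamental theorem for
  \<open>O(n)\<close>: they are polynomials in \<open>q\<^sub>a\<^sub>b = \<Sum>\<^sub>i y (i, a) y (i, b)\<close>. With the Laplacians \<open>\<Delta>\<^sub>a\<^sub>b\<close>
  adjoint to multiplication by \<open>q\<^sub>a\<^sub>b\<close> for the Fischer form, the operator \<open>\<Sum> q\<^sub>a\<^sub>b \<Delta>\<^sub>a\<^sub>b\<close> on homogeneous
  invariants of positive degree is injective, hence surjective, as soon as invariants killed by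
  all \<open>\<Delta>\<^sub>a\<^sub>b\<close> are constant.

  The last claim goes by induction on the dimension. Among the harmonic invariants take one of
  maximal degree \<open>r > 0\<close> in the vector \<open>x\<^sub>a\<close>. By maximality the polarizations \<open>x\<^sub>a \<cdot> \<partial>/\<partial>x\<^sub>b\<close> kill it,
  so its restriction to \<open>x\<^sub>a = e\<close>, \<open>e\<close> a basis vector, only involves the components orthogonal to \<open>e\<close>
  and is again a harmonic invariant, thus a constant \<open>C\<close>. Then the polynomial equals
  \<open>C |x\<^sub>a|\<^sup>r\<close>, which is not harmonic.

  In the vertex algebra, \<open>j\<^sup>0\<close>, \<open>j\<^sup>2\<close>, the derivation and the first product with \<open>j\<^sup>2\<close> produce
  all \<open>q\<^sub>a\<^sub>b\<close>, and the \<open>(-1)\<close>st product with \<open>q\<^sub>a\<^sub>b\<close> is multiplication by \<open>q\<^sub>a\<^sub>b\<close> up to an invariant of lower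
  degree.
\<close>

section \<open>Polynomial functions\<close>

text \<open>The group is complex, but two steps are real: the Householder vector needs a square root
  of x.x, and the Fischer form is definite only with a conjugate. Invariance is therefore tested
  only against reflections in real unit vectors (\<open>refl_inv\<close>). This is weaker than
  invariance under the complex group, yet polynomials in the \<open>qform a b\<close> already
  exhaust what satisfies it. Identities found at real points extend to complex ones by
  \<open>pol_eq_0_if_real\<close>.

  Polynomials are functions on points, so that substitution, restriction and differentiation are
  those of analysis. The index \<open>d\<close> of \<open>pol\<close> is only an upper bound for the
  degree, and \<open>pol_var\<close> mirrors one creation mode. The set \<open>S\<close> of
  coordinates may be infinite; it is cut to a finite one where sums or spanning sets require it.

  The vertex algebra is given abstractly, so the isomorphism with polynomials has to be constructed;
  the two uniqueness statements for \<open>fock_rel\<close> replace irreducibility of the Fock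
  module. Surjectivity of the operator built from \<open>qform\<close> and \<open>lap\<close> comes
  from a linear relation among the iterates of a single element.\<close>

inductive pol :: "'a set \<Rightarrow> nat \<Rightarrow> (('a \<Rightarrow> complex) \<Rightarrow> complex) \<Rightarrow> bool" for S where
  pol_const [intro, simp]: "pol S d (\<lambda>_. c)"
| pol_var: "s \<in> S \<Longrightarrow> pol S d p \<Longrightarrow> pol S (Suc d) (\<lambda>y. y s * p y)"
| pol_add: "pol S d p \<Longrightarrow> pol S d q \<Longrightarrow> pol S d (\<lambda>y. p y + q y)"

text \<open>Only one coordinate moves, so this is the derivative of a univariate function.
  \<open>deriv\<close> is unspecified where no derivative exists, hence the assumption
  \<open>pol\<close> in the calculation rules.\<close>

definition pd :: "'a \<Rightarrow> (('a \<Rightarrow> complex) \<Rightarrow> complex) \<Rightarrow> ('a \<Rightarrow> complex) \<Rightarrow> complex" where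
  "pd s p y = deriv (\<lambda>t. p (y(s := t))) (y s)"

lemma pol_mono: "pol S d p \<Longrightarrow> S \<subseteq> S' \<Longrightarrow> d \<le> d' \<Longrightarrow> pol S' d' p"
proof (induction arbitrary: d' rule: pol.induct)
  case (pol_var s d p)
  then obtain e where "d' = Suc e" "d \<le> e" by (cases d') auto
  with pol_var show ?case by (auto intro!: pol.pol_var)
qed (auto intro: pol_add)

lemma pol_coord: "s \<in> S \<Longrightarrow> pol S (Suc d) (\<lambda>y. y s)"
  using pol_var[of s S d "\<lambda>_. 1"] by simp

lemma pol_cmult: "pol S d p \<Longrightarrow> pol S d (\<lambda>y. c * p y)"
proof (induction rule: pol.induct)
  case (pol_var s d p)
  from pol.pol_var[OF pol_var(1,3)] show ?case by (simp add: mult_ac)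
qed (auto simp: distrib_left intro: pol_add)

lemma pol_diff: "pol S d p \<Longrightarrow> pol S d q \<Longrightarrow> pol S d (\<lambda>y. p y - q y)"
  using pol_add[of S d p "\<lambda>y. -1 * q y"] pol_cmult[of S d q "-1"] by simp

lemma pol_sum: "(\<And>i. i \<in> A \<Longrightarrow> pol S d (f i)) \<Longrightarrow> pol S d (\<lambda>y. \<Sum>i\<in>A. f i y)"
  by (induction A rule: infinite_finite_induct) (auto intro: pol_add)

lemma pol_mult: "pol S d p \<Longrightarrow> pol S e q \<Longrightarrow> pol S (d + e) (\<lambda>y. p y * q y)"
proof (induction rule: pol.induct)
  case (pol_const d c)
  then show ?case by (auto intro: pol_cmult pol_mono)
next
  case (pol_var s d p)
  from pol.pol_var[OF pol_var(1) pol_var(3)[OF pol_var(4)]] show ?case by (simp add: mult_ac)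
qed (auto simp: distrib_right intro: pol_add)

lemma pol_power: "pol S d p \<Longrightarrow> pol S (k * d) (\<lambda>y. p y ^ k)"
  by (induction k) (auto intro: pol_mult)

lemma pol_subst:
  assumes "pol S d p" "\<And>s. s \<in> S \<Longrightarrow> pol S' 1 (\<lambda>y. \<sigma> y s)"
  shows "pol S' d (\<lambda>y. p (\<sigma> y))"
  using assms
proof (induction rule: pol.induct)
  case (pol_var s d p)
  have "pol S' (1 + d) (\<lambda>y. \<sigma> y s * p (\<sigma> y))"
    by (intro pol_mult pol_var)
  then show ?case by simp
qed (auto intro: pol_add)

lemma pol_cong: "pol S d p \<Longrightarrow> (\<And>s. s \<in> S \<Longrightarrow> y s = z s) \<Longrightarrow> p y = p z"
  by (induction rule: pol.induct) auto

lemma pol_0_const: "pol S d p \<Longrightarrow> d = 0 \<Longrightarrow> p y = p z"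
  by (induction rule: pol.induct) auto

lemma pol_finite: "pol S d p \<Longrightarrow> \<exists>S'. finite S' \<and> S' \<subseteq> S \<and> pol S' d p"
proof (induction rule: pol.induct)
  case (pol_const d c)
  then show ?case by (intro exI[of _ "{}"]) auto
next
  case (pol_var s d p)
  then obtain S' where "finite S'" "S' \<subseteq> S" "pol S' d p" by blast
  with \<open>s \<in> S\<close> show ?case
    by (intro exI[of _ "insert s S'"]) (auto intro!: pol.pol_var intro: pol_mono)
next
  case (pol_add d p q)
  then obtain S1 S2 where "finite S1" "S1 \<subseteq> S" "pol S1 d p" "finite S2" "S2 \<subseteq> S" "pol S2 d q"
    by blast
  then show ?case
    by (intro exI[of _ "S1 \<union> S2"]) (auto intro!: pol.pol_add intro: pol_mono)
qed

text \<open>Differentiability, finiteness of root sets and comparison of degrees are imported from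
  univariate \<open>poly\<close> through restriction to complex lines.\<close>

lemma pol_line:
  "pol S d p \<Longrightarrow> \<exists>P. degree P \<le> d \<and> (\<forall>t. p (\<lambda>s. y s + t * z s) = poly P t)"
proof (induction rule: pol.induct)
  case (pol_const d c)
  then show ?case by (intro exI[of _ "[:c:]"]) auto
next
  case (pol_var s d p)
  then obtain P where P: "degree P \<le> d" "\<And>t. p (\<lambda>s. y s + t * z s) = poly P t" by blast
  have "degree ([:y s, z s:] * P) \<le> degree [:y s, z s:] + degree P" by (rule degree_mult_le)
  also have "\<dots> \<le> Suc d" using P(1) by simp
  finally show ?case
    by (intro exI[of _ "[:y s, z s:] * P"]) (auto simp: P(2) algebra_simps)
next
  case (pol_add d p q)
  then obtain P Q where "degree P \<le> d" "\<And>t. p (\<lambda>s. y s + t * z s) = poly P t"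
    "degree Q \<le> d" "\<And>t. q (\<lambda>s. y s + t * z s) = poly Q t" by blast
  then show ?case by (intro exI[of _ "P + Q"]) (auto intro: degree_add_le)
qed

section \<open>Rules for partial derivatives\<close>

lemma pol_pd_DERIV:
  assumes "pol S d p"
  shows "((\<lambda>t. p (y(s := t))) has_field_derivative pd s p y) (at (y s))"
proof -
  obtain P where P: "\<And>t. p (\<lambda>r. (if r = s then 0 else y r) + t * (if r = s then 1 else 0)) = poly P t"
    using pol_line[OF assms, of "\<lambda>r. if r = s then 0 else y r" "\<lambda>r. if r = s then 1 else 0"] by auto
  have "(\<lambda>r. (if r = s then 0 else y r) + t * (if r = s then 1 else 0)) = y(s := t)" for t
    by auto
  with P have eq: "(\<lambda>t. p (y(s := t))) = poly P" by auto
  show ?thesis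
    unfolding pd_def eq using DERIV_imp_deriv[OF poly_DERIV] poly_DERIV by metis
qed

lemma pdI: "((\<lambda>t. p (y(s := t))) has_field_derivative D) (at (y s)) \<Longrightarrow> pd s p y = D"
  unfolding pd_def by (rule DERIV_imp_deriv)

lemma pd_const [simp]: "pd s (\<lambda>_. c) = (\<lambda>_. 0)"
  by (auto intro!: pdI)

lemma pd_coord: "pd s (\<lambda>y. y r) = (\<lambda>_. if r = s then 1 else 0)"
  by (auto intro!: pdI)

lemma pd_add: "pol S d p \<Longrightarrow> pol S' d' q \<Longrightarrow> pd s (\<lambda>y. p y + q y) = (\<lambda>y. pd s p y + pd s q y)"
  by (rule ext) (intro pdI DERIV_add pol_pd_DERIV)

lemma pd_mult:
  assumes "pol S d p" "pol S' d' q"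
  shows "pd s (\<lambda>y. p y * q y) = (\<lambda>y. pd s p y * q y + p y * pd s q y)"
proof
  fix y
  show "pd s (\<lambda>y. p y * q y) y = pd s p y * q y + p y * pd s q y"
    using DERIV_mult[OF pol_pd_DERIV[OF assms(1)] pol_pd_DERIV[OF assms(2)], of y s y]
    by (intro pdI) (simp add: mult_ac)
qed

lemma pd_cmult: "pol S d p \<Longrightarrow> pd s (\<lambda>y. c * p y) = (\<lambda>y. c * pd s p y)"
  using pd_mult[of UNIV 0 "\<lambda>_. c"] by fastforce

lemma pd_var:
  "pol S d p \<Longrightarrow> pd s (\<lambda>y. y r * p y) = (\<lambda>y. (if r = s then p y else 0) + y r * pd s p y)"
  by (subst pd_mult[OF pol_coord[of r UNIV]]) (auto simp: pd_coord)

lemma pd_sum: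
  "(\<And>i. i \<in> A \<Longrightarrow> pol S d (f i)) \<Longrightarrow> pd s (\<lambda>y. \<Sum>i\<in>A. f i y) = (\<lambda>y. \<Sum>i\<in>A. pd s (f i) y)"
proof (induction A rule: infinite_finite_induct)
  case (insert x F)
  have "pd s (\<lambda>y. f x y + (\<Sum>i\<in>F. f i y)) = (\<lambda>y. pd s (f x) y + pd s (\<lambda>y. \<Sum>i\<in>F. f i y) y)"
    by (rule pd_add[of S d _ S d]) (auto intro: insert.prems pol_sum)
  with insert show ?case by simp
qed auto

lemma pd_notin: "pol S d p \<Longrightarrow> s \<notin> S \<Longrightarrow> pd s p = (\<lambda>_. 0)"
proof (rule ext, rule pdI)
  fix y assume *: "pol S d p" "s \<notin> S"
  have "p (y(s := t)) = p y" for t by (rule pol_cong[OF *(1)]) (use *(2) in auto)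
  then show "((\<lambda>t. p (y(s := t))) has_field_derivative 0) (at (y s))" by simp
qed

text \<open>Subtraction on \<open>nat\<close> truncates, so the bound \<open>d - 1\<close> alone is
  too weak: for a product \<open>y r * p y\<close> the term \<open>y r * pd s p y\<close> must have
  degree at most \<open>d\<close>, which for \<open>d = 0\<close> holds only because
  \<open>pd s p\<close> vanishes. The first conjunct carries this through the induction.\<close>

lemma pol_pd_aux:
  "pol S d p \<Longrightarrow> (d = 0 \<longrightarrow> pd s p = (\<lambda>_. 0)) \<and> pol S (d - 1) (pd s p)"
proof (induction rule: pol.induct)
  case (pol_const d c)
  then show ?case by simp
next
  case (pol_var r d p)
  have "pol S d (\<lambda>y. y r * pd s p y)"
    using pol_var by (cases d) (auto intro!: pol.pol_var)
  with pol_var show ?case by (cases "r = s") (auto simp: pd_var[OF pol_var(2)] intro!: pol_add)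
next
  case (pol_add d p q)
  then show ?case by (auto simp: pd_add[OF pol_add(1,2)] intro!: pol.pol_add)
qed

lemma pol_pd: "pol S d p \<Longrightarrow> pol S (d - 1) (pd s p)"
  by (rule pol_pd_aux[THEN conjunct2])

lemma pol_pd': "pol S d p \<Longrightarrow> pol S d (pd s p)"
  by (rule pol_mono[OF pol_pd]) auto

lemma pd_degree_0: "pol S 0 p \<Longrightarrow> pd s p = (\<lambda>_. 0)"
  using pol_pd_aux[of S 0 p s] by simp

lemma pd_commute: "pol S d p \<Longrightarrow> pd s (pd r p) = pd r (pd s p)"
proof (induction rule: pol.induct)
  case (pol_var q d p)
  note p = pol_var(2) pol_pd'[OF pol_var(2)]
  have *: "pol S (Suc d) (\<lambda>y. y q * pd s p y)" for s
    by (intro pol.pol_var pol_var p)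
  have **: "pol S d (\<lambda>y. if b then p y else 0)" for b using pol_var by (cases b) auto
  have ***: "pd s (\<lambda>y. if b then p y else 0) = (\<lambda>y. if b then pd s p y else 0)" for b s by (cases b) auto
  show ?case
    by (auto simp: pd_var[OF pol_var(2)] pd_add[OF ** *] *** pd_var[OF p(2)] pol_var.IH)
next
  case (pol_add d p q)
  then show ?case
    by (simp add: pd_add[OF pol_add(1,2)] pd_add[OF pol_pd'[OF pol_add(1)] pol_pd'[OF pol_add(2)]])
qed auto

lemma pol_chain:
  assumes "pol S d p" "finite S"
  shows "((\<lambda>t. p (\<lambda>s. y s + t * z s)) has_field_derivative
      (\<Sum>s\<in>S. z s * pd s p (\<lambda>s. y s + t * z s))) (at t)"
  using assms
proof (induction rule: pol.induct)
  case (pol_var r d p)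
  have "((\<lambda>t. (y r + t * z r) * p (\<lambda>s. y s + t * z s)) has_field_derivative
      z r * p (\<lambda>s. y s + t * z s) + (y r + t * z r) * (\<Sum>s\<in>S. z s * pd s p (\<lambda>s. y s + t * z s))) (at t)"
    using pol_var(3)[OF pol_var(4)] by (auto intro!: derivative_eq_intros)
  moreover have "(\<Sum>s\<in>S. z s * (if r = s then u else 0)) = z r * u" for u
    using pol_var(1,4) by (simp add: if_distrib[of "\<lambda>x. _ * x"] sum.delta cong: if_cong)
  ultimately show ?case
    by (simp add: pd_var[OF pol_var(2)] distrib_left sum.distrib sum_distrib_left mult_ac)
next
  case (pol_add d p q)
  have "((\<lambda>t. p (\<lambda>s. y s + t * z s) + q (\<lambda>s. y s + t * z s)) has_field_derivative
      (\<Sum>s\<in>S. z s * pd s p (\<lambda>s. y s + t * z s)) + (\<Sum>s\<in>S. z s * pd s q (\<lambda>s. y s + t * z s))) (at t)"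
    by (intro DERIV_add pol_add)
  then show ?case
    by (simp add: pd_add[OF pol_add(1,2)] distrib_left sum.distrib)
qed auto

lemma poly_eq_0_if_infinite_roots:
  fixes P :: "complex poly"
  assumes "\<And>x::real. poly P (of_real x) = 0"
  shows "P = 0"
proof (rule ccontr)
  assume "P \<noteq> 0"
  then have "finite {x. poly P x = 0}" by (rule poly_roots_finite)
  moreover have "range complex_of_real \<subseteq> {x. poly P x = 0}" using assms by auto
  ultimately have "finite (range complex_of_real)" by (rule rev_finite_subset)
  moreover have "infinite (range complex_of_real)"
    using infinite_UNIV_char_0[where 'a=real] finite_imageD[of complex_of_real UNIV]
    by (auto simp: inj_on_def)
  ultimately show False by simp
qed

text \<open>Coordinates are released from the real line one at a time: with all others fixed, a
  univariate polynomial that vanishes on the reals vanishes. Finitely many releases suffice, since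
  \<open>p\<close> depends on finitely many coordinates.\<close>

lemma pol_eq_0_if_real:
  assumes "pol S d p" "\<And>y. (\<And>s. y s \<in> \<real>) \<Longrightarrow> p y = 0"
  shows "p y = 0"
proof -
  obtain S' where S': "finite S'" "pol S' d p" using pol_finite[OF assms(1)] by blast
  have "p y = 0" if "finite K" "\<And>s. s \<notin> K \<Longrightarrow> y s \<in> \<real>" for K y
    using that
  proof (induction K arbitrary: y rule: finite_induct)
    case empty
    then show ?case using assms(2) by auto
  next
    case (insert r K)
    obtain P where P: "\<And>t. p (\<lambda>s. (y(r := 0)) s + t * (if s = r then 1 else 0)) = poly P t"
      using pol_line[OF assms(1), of "y(r := 0)" "\<lambda>s. if s = r then 1 else 0"] by auto
    have eq: "(\<lambda>s. (y(r := 0)) s + t * (if s = r then 1 else 0)) = y(r := t)" for t by auto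
    have "poly P (of_real x) = 0" for x
      unfolding P[symmetric] eq by (rule insert.IH) (use insert.prems in auto)
    then have "P = 0" by (rule poly_eq_0_if_infinite_roots)
    then show ?case using P[of "y r"] unfolding eq by simp
  qed
  from this[OF S'(1), of "\<lambda>s. if s \<in> S' then y s else 0"]
  have "p (\<lambda>s. if s \<in> S' then y s else 0) = 0" by auto
  also have "p (\<lambda>s. if s \<in> S' then y s else 0) = p y" by (rule pol_cong[OF S'(2)]) auto
  finally show ?thesis .
qed

lemma pol_constI:
  assumes "pol S d p" "\<And>s. pd s p = (\<lambda>_. 0)"
  shows "p y = p z"
proof -
  obtain S' where S': "finite S'" "pol S' d p" using pol_finite[OF assms(1)] by blast
  have "((\<lambda>t. p (\<lambda>s. z s + t * (y s - z s))) has_field_derivative 0) (at t)" for t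
    using pol_chain[OF S'(2,1), of z "\<lambda>s. y s - z s" t] by (simp add: assms(2))
  from DERIV_const_ratio_const2 have "p (\<lambda>s. z s + 1 * (y s - z s)) = p (\<lambda>s. z s + 0 * (y s - z s))"
    using has_field_derivative_zero_constant[of UNIV "\<lambda>t. p (\<lambda>s. z s + t * (y s - z s))"]
      \<open>\<And>t. (_ has_field_derivative _) (at t)\<close>
    by (metis convex_UNIV UNIV_I)
  then show ?thesis by simp
qed


lemma pol_coord_pd:
  assumes "pol S d p" "s \<in> S"
  shows "pol S d (\<lambda>y. y s * pd r p y)"
proof (cases d)
  case 0
  with assms show ?thesis by (simp add: pd_degree_0)
next
  case (Suc e)
  with pol_pd[OF assms(1)] assms(2) show ?thesis by (auto intro: pol_var)
qed

text \<open>Dilation of part of the coordinates: \<open>K = UNIV\<close> measures the total degree,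
  \<open>K = UNIV \<times> {a}\<close> the degree in the vector in slot \<open>a\<close>.\<close>

definition scale_on :: "'a set \<Rightarrow> complex \<Rightarrow> ('a \<Rightarrow> complex) \<Rightarrow> 'a \<Rightarrow> complex" where
  "scale_on K t y = (\<lambda>s. if s \<in> K then t * y s else y s)"

text \<open>A factor \<open>y s\<close> raises the index of a component by one if \<open>s\<close>
  lies in \<open>K\<close> and leaves it otherwise. Only for \<open>K = UNIV\<close> does the index
  also bound the total degree, as the last conjunct records.\<close>

lemma pol_homogeneous_components:
  "pol S d p \<Longrightarrow> \<exists>q. (\<forall>r. pol S d (q r)) \<and> (\<forall>r t y. q r (scale_on K t y) = t ^ r * q r y)
     \<and> (\<forall>r>d. q r = (\<lambda>_. 0)) \<and> p = (\<lambda>y. \<Sum>r\<le>d. q r y) \<and> (K = UNIV \<longrightarrow> (\<forall>r. pol S r (q r)))"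
proof (induction rule: pol.induct)
  case (pol_const d c)
  have "(\<Sum>r\<le>d. if r = 0 then c else 0) = c" by (simp add: sum.delta)
  then show ?case
    by (intro exI[of _ "\<lambda>r _. if r = 0 then c else 0"]) auto
next
  case (pol_var s d p)
  then obtain q where q: "\<And>r. pol S d (q r)" "\<And>r t y. q r (scale_on K t y) = t ^ r * q r y"
    "\<And>r. r > d \<Longrightarrow> q r = (\<lambda>_. 0)" "p = (\<lambda>y. \<Sum>r\<le>d. q r y)" "\<And>r. K = UNIV \<Longrightarrow> pol S r (q r)" by blast
  show ?case
  proof (cases "s \<in> K")
    case True
    define q' where "q' = (\<lambda>r y. case r of 0 \<Rightarrow> 0 | Suc r \<Rightarrow> y s * q r y)"
    have "pol S (Suc d) (q' r)" for r
      using pol.pol_var[OF \<open>s \<in> S\<close> q(1)] by (cases r) (auto simp: q'_def)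
    moreover have "q' r (scale_on K t y) = t ^ r * q' r y" for r t y
    proof -
      have "scale_on K t y s = t * y s" using True by (simp add: scale_on_def)
      then show ?thesis by (cases r) (auto simp: q'_def q(2))
    qed
    moreover have "q' r = (\<lambda>_. 0)" if "r > Suc d" for r
      using that q(3)[of "r - 1"] by (cases r) (auto simp: q'_def)
    moreover have "(\<lambda>y. y s * p y) = (\<lambda>y. \<Sum>r\<le>Suc d. q' r y)"
      by (subst sum.atMost_Suc_shift) (simp add: q'_def q(4) sum_distrib_left)
    moreover have "pol S r (q' r)" if "K = UNIV" for r
      using pol.pol_var[OF \<open>s \<in> S\<close> q(5)[OF that]] by (cases r) (auto simp: q'_def)
    ultimately show ?thesis by blast
  next
    case False
    define q' where "q' = (\<lambda>r y. y s * q r y)"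
    have "pol S (Suc d) (q' r)" for r
      using pol.pol_var[OF \<open>s \<in> S\<close> q(1)] by (auto simp: q'_def)
    moreover have "q' r (scale_on K t y) = t ^ r * q' r y" for r t y
    proof -
      have "scale_on K t y s = y s" using False by (simp add: scale_on_def)
      then show ?thesis by (auto simp: q'_def q(2))
    qed
    moreover have "q' r = (\<lambda>_. 0)" if "r > Suc d" for r
      using that q(3)[of r] by (auto simp: q'_def)
    moreover have "(\<lambda>y. y s * p y) = (\<lambda>y. \<Sum>r\<le>Suc d. q' r y)"
      by (simp add: q'_def q(3)[of "Suc d"]) (simp add: q(4) sum_distrib_left)
    moreover have "K \<noteq> UNIV" using False by blast
    ultimately show ?thesis by blast
  qed
next
  case (pol_add d p p')
  then obtain q q' where q: "\<And>r. pol S d (q r)" "\<And>r t y. q r (scale_on K t y) = t ^ r * q r y"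
    "\<And>r. r > d \<Longrightarrow> q r = (\<lambda>_. 0)" "p = (\<lambda>y. \<Sum>r\<le>d. q r y)" "\<And>r. K = UNIV \<Longrightarrow> pol S r (q r)"
    and q': "\<And>r. pol S d (q' r)" "\<And>r t y. q' r (scale_on K t y) = t ^ r * q' r y"
    "\<And>r. r > d \<Longrightarrow> q' r = (\<lambda>_. 0)" "p' = (\<lambda>y. \<Sum>r\<le>d. q' r y)" "\<And>r. K = UNIV \<Longrightarrow> pol S r (q' r)" by blast
  show ?case
  proof (intro exI[of _ "\<lambda>r y. q r y + q' r y"] conjI allI impI)
    show "pol S d (\<lambda>y. q r y + q' r y)" for r by (rule pol.pol_add[OF q(1) q'(1)])
    show "pol S r (\<lambda>y. q r y + q' r y)" if "K = UNIV" for r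
      by (rule pol.pol_add[OF q(5)[OF that] q'(5)[OF that]])
  qed (simp_all only: q(2-4) q'(2-4) sum.distrib distrib_left add_0)
qed

lemma pol_scale_on:
  assumes "pol S d p"
  obtains P where "degree P \<le> d" "\<And>t. p (scale_on K t y) = poly P t"
proof -
  have "scale_on K t y = (\<lambda>s. (if s \<in> K then 0 else y s) + t * (if s \<in> K then y s else 0))" for t
    by (auto simp: scale_on_def)
  moreover obtain P where "degree P \<le> d"
      "\<And>t. p (\<lambda>s. (if s \<in> K then 0 else y s) + t * (if s \<in> K then y s else 0)) = poly P t"
    using pol_line[OF assms, of "\<lambda>s. if s \<in> K then 0 else y s" "\<lambda>s. if s \<in> K then y s else 0"]
    by auto
  ultimately show ?thesis by (intro that[of P]) simp_all
qed

text \<open>Along the dilation the function is a univariate polynomial of degree at most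
  \<open>d\<close> and at the same time the monomial \<open>p y * t ^ r\<close>.\<close>

lemma homogeneous_degree_bound:
  assumes "pol S d p" "\<And>t. p (scale_on K t y) = t ^ r * p y" "r > d"
  shows "p y = 0"
proof -
  obtain P where P: "degree P \<le> d" "\<And>t. p (scale_on K t y) = poly P t"
    using pol_scale_on[OF assms(1)] by metis
  have "poly P = poly (monom (p y) r)"
    by (rule ext) (simp add: P(2)[symmetric] assms(2) poly_monom mult.commute)
  then have "P = monom (p y) r" by (simp add: poly_eq_poly_eq_iff)
  with P(1) assms(3) show ?thesis by (auto simp: degree_monom_eq split: if_splits) (metis degree_monom_eq not_le)
qed

section \<open>Harmonic invariants\<close>

definition lap :: "nat \<Rightarrow> nat \<Rightarrow> (('i::finite \<times> nat \<Rightarrow> complex) \<Rightarrow> complex) \<Rightarrow> ('i \<times> nat \<Rightarrow> complex) \<Rightarrow> complex" where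
  "lap a b p y = (\<Sum>i\<in>UNIV. pd (i, a) (pd (i, b) p) y)"

text \<open>The polarization x_a . d/dx_b. On the diagonal it is the Euler operator, whose
  eigenvalue is the degree in slot \<open>a\<close>.\<close>

definition eul :: "nat \<Rightarrow> nat \<Rightarrow> (('i::finite \<times> nat \<Rightarrow> complex) \<Rightarrow> complex) \<Rightarrow> ('i \<times> nat \<Rightarrow> complex) \<Rightarrow> complex" where
  "eul a b p y = (\<Sum>i\<in>UNIV. y (i, a) * pd (i, b) p y)"

definition refl_at :: "('i::finite \<Rightarrow> real) \<Rightarrow> ('i \<times> nat \<Rightarrow> complex) \<Rightarrow> 'i \<times> nat \<Rightarrow> complex" where
  "refl_at v y = (\<lambda>(i, a). y (i, a) - 2 * of_real (v i) * (\<Sum>j\<in>UNIV. of_real (v j) * y (j, a)))"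

text \<open>Unit vectors supported on \<open>I\<close> give the reflections of the coordinate
  subspace spanned by \<open>I\<close>; shrinking \<open>I\<close> is the induction on the
  dimension.\<close>

definition refl_inv :: "'i::finite set \<Rightarrow> (('i \<times> nat \<Rightarrow> complex) \<Rightarrow> complex) \<Rightarrow> bool" where
  "refl_inv I p \<longleftrightarrow> (\<forall>v. (\<forall>i. i \<notin> I \<longrightarrow> v i = 0) \<longrightarrow> (\<Sum>i\<in>UNIV. (v i)\<^sup>2) = 1 \<longrightarrow>
     (\<forall>y. p (refl_at v y) = p y))"

text \<open>Homogeneity is left out on purpose: fixing one vector at a basis vector keeps this
  predicate, with the same bound \<open>d\<close>, but destroys homogeneity.\<close>

definition harmonic_inv :: "'i::finite set \<Rightarrow> nat \<Rightarrow> (('i \<times> nat \<Rightarrow> complex) \<Rightarrow> complex) \<Rightarrow> bool" where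
  "harmonic_inv I d p \<longleftrightarrow> pol (I \<times> UNIV) d p \<and> (\<forall>a b. lap a b p = (\<lambda>_. 0)) \<and> refl_inv I p"

lemma lap_eq: "lap a b p = (\<lambda>y. \<Sum>i\<in>UNIV. pd (i, a) (pd (i, b) p) y)"
  by (simp add: lap_def fun_eq_iff)

lemma eul_eq: "eul a b p = (\<lambda>y. \<Sum>i\<in>UNIV. y (i, a) * pd (i, b) p y)"
  by (simp add: eul_def fun_eq_iff)

lemma pol_eul: "pol (I \<times> UNIV) d p \<Longrightarrow> pol (I \<times> UNIV) d (eul a b p)"
  unfolding eul_eq
proof (rule pol_sum)
  fix i assume p: "pol (I \<times> UNIV) d p"
  show "pol (I \<times> UNIV) d (\<lambda>y. y (i, a) * pd (i, b) p y)"
  proof (cases "i \<in> I")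
    case True
    with p show ?thesis by (auto intro: pol_coord_pd)
  next
    case False
    with pd_notin[OF p, of "(i, b)"] show ?thesis by simp
  qed
qed

lemma pol_lap: "pol S d p \<Longrightarrow> pol S (d - 2) (lap a b p)"
  unfolding lap_eq
proof (rule pol_sum)
  fix i assume "pol S d p"
  from pol_pd[OF pol_pd[OF this, of "(i, b)"], of "(i, a)"]
  show "pol S (d - 2) (pd (i, a) (pd (i, b) p))" by (simp add: numeral_2_eq_2)
qed

section \<open>Commutators of Laplacians and polarizations\<close>

lemma lap_add:
  "pol S d p \<Longrightarrow> pol S' d' q \<Longrightarrow> lap a b (\<lambda>y. p y + q y) = (\<lambda>y. lap a b p y + lap a b q y)"
  by (simp add: lap_eq pd_add pd_add[OF pol_pd pol_pd] sum.distrib)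

lemma eul_cmult: "pol S d p \<Longrightarrow> eul a b (\<lambda>y. c * p y) = (\<lambda>y. c * eul a b p y)"
  by (simp add: eul_eq pd_cmult sum_distrib_left mult_ac)

lemma lap_cmult: "pol S d p \<Longrightarrow> lap a b (\<lambda>y. c * p y) = (\<lambda>y. c * lap a b p y)"
  by (simp add: lap_eq pd_cmult pd_cmult[OF pol_pd] sum_distrib_left)

lemma eul_sum:
  "(\<And>i. i \<in> A \<Longrightarrow> pol S d (f i)) \<Longrightarrow> eul a b (\<lambda>y. \<Sum>i\<in>A. f i y) = (\<lambda>y. \<Sum>i\<in>A. eul a b (f i) y)"
  using pd_sum[of A S d f] sum.swap[of "\<lambda>i j. _ i * pd (i, b) (f j) _" A UNIV]
  by (simp add: eul_eq sum_distrib_left) 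

lemma pd_eul:
  fixes p :: "('i::finite \<times> nat \<Rightarrow> complex) \<Rightarrow> complex"
  assumes "pol S d p"
  shows "pd (j, e) (eul a b p) = (\<lambda>y. (if a = e then pd (j, b) p y else 0) + eul a b (pd (j, e) p) y)"
proof -
  have pol: "pol UNIV (Suc d) (\<lambda>y. y (i, a) * pd (i, b) p y)" for i
    by (rule pol_var[OF UNIV_I pol_mono[OF pol_pd'[OF assms]]]) auto
  have "pd (j, e) (eul a b p) = (\<lambda>y. \<Sum>i\<in>UNIV. pd (j, e) (\<lambda>y. y (i, a) * pd (i, b) p y) y)"
    unfolding eul_eq by (rule pd_sum[OF pol])
  also have "\<dots> = (\<lambda>y. (\<Sum>i\<in>UNIV. if i = j then if a = e then pd (j, b) p y else 0 else 0)
      + eul a b (pd (j, e) p) y)"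
    unfolding eul_eq sum.distrib[symmetric]
    by (rule ext, rule sum.cong[OF refl])
      (auto simp: pd_var[OF pol_pd[OF assms]] pd_commute[OF assms, of "(j, e)"])
  finally show ?thesis by (simp add: sum.delta)
qed

text \<open>The commutator of a Laplacian with a polarization is a combination of Laplacians,
  obtained by applying \<open>pd_eul\<close> twice. Hence polarization preserves the space of
  functions killed by all Laplacians.\<close>

lemma lap_eul:
  fixes p :: "('i::finite \<times> nat \<Rightarrow> complex) \<Rightarrow> complex"
  assumes p: "pol (I \<times> UNIV) d p"
  shows "lap c e (eul a b p) = (\<lambda>y. eul a b (lap c e p) y
     + (if a = e then lap c b p y else 0) + (if a = c then lap b e p y else 0))"
proof -
  have q: "pol (I \<times> UNIV) d (pd s p)" for s by (rule pol_pd'[OF p])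
  have if_pol: "pol (I \<times> UNIV) d (\<lambda>y. if B then pd s p y else 0)" for B s by (cases B) (auto intro: q)
  have if_pd: "pd r (\<lambda>y. if B then pd s p y else 0) = (\<lambda>y. if B then pd r (pd s p) y else 0)" for B r s
    by (cases B) auto
  have "pd (j, c) (pd (j, e) (eul a b p)) = (\<lambda>y. (if a = e then pd (j, c) (pd (j, b) p) y else 0)
     + (if a = c then pd (j, b) (pd (j, e) p) y else 0) + eul a b (pd (j, c) (pd (j, e) p)) y)" for j
    by (simp add: pd_eul[OF p] pd_add[OF if_pol pol_eul[OF q]] if_pd pd_eul[OF q] fun_eq_iff)
  moreover have "eul a b (lap c e p) = (\<lambda>y. \<Sum>j\<in>UNIV. eul a b (pd (j, c) (pd (j, e) p)) y)"
    unfolding lap_eq by (rule eul_sum[of _ "I \<times> UNIV" d]) (intro pol_pd' p)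
  ultimately show ?thesis
    by (auto simp: lap_eq sum.distrib fun_eq_iff)
qed

section \<open>Polarizations as derivatives of shears between slots\<close>

lemma pol_nat_bound:
  assumes "pol (S :: ('i \<times> nat) set) d p"
  shows "\<exists>m0. \<forall>m\<ge>m0. pol (S \<inter> UNIV \<times> {..<m}) d p"
proof -
  obtain S' where S': "finite S'" "S' \<subseteq> S" "pol S' d p" using pol_finite[OF assms] by blast
  from S'(1) obtain m0 where "\<forall>k\<in>snd ` S'. k < m0" using finite_nat_set_iff_bounded by blast
  then have "S' \<subseteq> S \<inter> UNIV \<times> {..<m}" if "m \<ge> m0" for m using that S'(2) by force
  with S'(3) show ?thesis by (meson pol_mono order_refl)
qed

definition shift :: "nat \<Rightarrow> (nat \<Rightarrow> complex) \<Rightarrow> ('i \<times> nat \<Rightarrow> complex) \<Rightarrow> 'i \<times> nat \<Rightarrow> complex" where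
  "shift a c y = (\<lambda>(i, b). c b * y (i, a))"

text \<open>Infinitely many slots may move, but derivatives in slots from \<open>m0\<close> on
  vanish, so the chain rule is a finite sum. It is stated for every \<open>m \<ge> m0\<close> so
  that \<open>m\<close> can be enlarged to include a prescribed slot.\<close>

lemma shift_DERIV:
  fixes p :: "('i::finite \<times> nat \<Rightarrow> complex) \<Rightarrow> complex"
  assumes "pol S d p"
  shows "\<exists>m0. \<forall>m\<ge>m0. \<forall>c y t. ((\<lambda>t. p (\<lambda>s. y s + t * shift a c y s)) has_field_derivative
     (\<Sum>b<m. c b * (\<Sum>i\<in>UNIV. y (i, a) * pd (i, b) p (\<lambda>s. y s + t * shift a c y s)))) (at t)"
proof -
  obtain m0 where m0: "\<And>m. m \<ge> m0 \<Longrightarrow> pol (S \<inter> UNIV \<times> {..<m}) d p"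
    using pol_nat_bound[OF assms] by blast
  have "((\<lambda>t. p (\<lambda>s. y s + t * shift a c y s)) has_field_derivative
     (\<Sum>b<m. c b * (\<Sum>i\<in>UNIV. y (i, a) * pd (i, b) p (\<lambda>s. y s + t * shift a c y s)))) (at t)"
    if "m \<ge> m0" for m c y t
  proof -
    have "pol (UNIV \<times> {..<m}) d p" by (rule pol_mono[OF m0[OF that]]) auto
    have D: "((\<lambda>t. p (\<lambda>s. y s + t * shift a c y s)) has_field_derivative
       (\<Sum>s\<in>UNIV \<times> {..<m}. shift a c y s * pd s p (\<lambda>s. y s + t * shift a c y s))) (at t)"
      by (rule pol_chain) (use \<open>pol (UNIV \<times> {..<m}) d p\<close> in auto)
    have "(\<Sum>s\<in>UNIV \<times> {..<m}. shift a c y s * w s) =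
       (\<Sum>b<m. c b * (\<Sum>i\<in>UNIV. y (i, a) * w (i, b)))" for w
    proof -
      have "(\<Sum>s\<in>UNIV \<times> {..<m}. shift a c y s * w s) =
        (\<Sum>i\<in>UNIV. \<Sum>b<m. shift a c y (i, b) * w (i, b))"
        by (simp add: sum.cartesian_product)
      also have "\<dots> = (\<Sum>b<m. \<Sum>i\<in>UNIV. shift a c y (i, b) * w (i, b))"
        by (rule sum.swap)
      finally show ?thesis by (simp add: shift_def sum_distrib_left mult_ac)
    qed
    with D show ?thesis by simp
  qed
  then show ?thesis by (intro exI[of _ m0]) simp
qed

text \<open>The polarization is the velocity of the shear x_b -> x_b + t x_a. Its properties thereby
  reduce to how this shear commutes with reflections and dilations.\<close>

lemma eul_DERIV:
  fixes p :: "('i::finite \<times> nat \<Rightarrow> complex) \<Rightarrow> complex"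
  assumes "pol S d p"
  shows "((\<lambda>t. p (\<lambda>s. y s + t * shift a (\<lambda>c. if c = b then 1 else 0) y s))
    has_field_derivative eul a b p y) (at 0)"
proof -
  obtain m0 where m0: "\<forall>m\<ge>m0. \<forall>c y t. ((\<lambda>t. p (\<lambda>s. y s + t * shift a c y s)) has_field_derivative
     (\<Sum>b<m. c b * (\<Sum>i\<in>UNIV. y (i, a) * pd (i, b) p (\<lambda>s. y s + t * shift a c y s)))) (at t)"
    using shift_DERIV[OF assms, of a] ..
  have "(\<Sum>c<max m0 (Suc b). (if c = b then 1 else 0) * u c) = u b" for u :: "nat \<Rightarrow> complex"
    by (simp add: if_distrib[of "\<lambda>x. x * _"] sum.delta cong: if_cong)
  with m0[rule_format, of "max m0 (Suc b)" y "\<lambda>c. if c = b then 1 else 0" 0] show ?thesis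
    by (simp add: eul_def)
qed

text \<open>Because \<open>c a = 0\<close>, the vector in slot \<open>a\<close> does not move along
  the flow, so the derivative at time \<open>t\<close> is a combination of the polarizations
  \<open>eul a b\<close>, \<open>b \<noteq> a\<close>, at the moved point.\<close>

lemma shift_invariant:
  fixes p :: "('i::finite \<times> nat \<Rightarrow> complex) \<Rightarrow> complex"
  assumes "pol S d p" "\<And>b. b \<noteq> a \<Longrightarrow> eul a b p = (\<lambda>_. 0)" "c a = 0"
  shows "p (\<lambda>s. y s + shift a c y s) = p y"
proof -
  obtain m0 where m0: "\<forall>m\<ge>m0. \<forall>c y t. ((\<lambda>t. p (\<lambda>s. y s + t * shift a c y s)) has_field_derivative
     (\<Sum>b<m. c b * (\<Sum>i\<in>UNIV. y (i, a) * pd (i, b) p (\<lambda>s. y s + t * shift a c y s)))) (at t)"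
    using shift_DERIV[OF assms(1), of a] ..
  have "c b * (\<Sum>i\<in>UNIV. y (i, a) * pd (i, b) p (\<lambda>s. y s + t * shift a c y s)) = 0" for b t
  proof (cases "b = a")
    case False
    from fun_cong[OF assms(2)[OF this], of "\<lambda>s. y s + t * shift a c y s"]
    show ?thesis by (simp add: eul_def shift_def assms(3))
  qed (simp add: assms(3))
  with m0[rule_format, of m0 y c] have D: "((\<lambda>t. p (\<lambda>s. y s + t * shift a c y s)) has_field_derivative 0) (at t)" for t
    by simp
  obtain C where "\<And>t. p (\<lambda>s. y s + t * shift a c y s) = C"
    using has_field_derivative_zero_constant[of UNIV "\<lambda>t. p (\<lambda>s. y s + t * shift a c y s)"] D by auto
  from this[of 0] this[of 1] show ?thesis by simp
qed

lemma refl_at_shift: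
  "refl_at v (\<lambda>s. y s + t * shift a c y s) = (\<lambda>s. refl_at v y s + t * shift a c (refl_at v y) s)"
  by (simp add: refl_at_def shift_def fun_eq_iff distrib_left right_diff_distrib sum.distrib
      sum_distrib_left mult_ac)

lemma refl_inv_eul:
  fixes p :: "('i::finite \<times> nat \<Rightarrow> complex) \<Rightarrow> complex"
  assumes "pol S d p" "refl_inv I p"
  shows "refl_inv I (eul a b p)"
  unfolding refl_inv_def
proof (intro allI impI)
  fix v :: "'i \<Rightarrow> real" and y
  assume v: "\<forall>i. i \<notin> I \<longrightarrow> v i = 0" "(\<Sum>i\<in>UNIV. (v i)\<^sup>2) = 1"
  let ?c = "\<lambda>c. if c = b then 1 else 0 :: complex"
  have *: "p (refl_at v y) = p y" for y using assms(2) v by (auto simp: refl_inv_def)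
  have "((\<lambda>t. p (\<lambda>s. y s + t * shift a ?c y s)) has_field_derivative eul a b p (refl_at v y)) (at 0)"
    using eul_DERIV[OF assms(1), of "refl_at v y" a b]
    by (simp add: refl_at_shift[symmetric] *)
  then show "eul a b p (refl_at v y) = eul a b p y"
    using eul_DERIV[OF assms(1)] DERIV_unique by blast
qed

lemma harmonic_inv_add:
  "harmonic_inv I d p \<Longrightarrow> harmonic_inv I d q \<Longrightarrow> harmonic_inv I d (\<lambda>y. p y + q y)"
  by (auto simp: harmonic_inv_def lap_add refl_inv_def intro: pol_add)

lemma harmonic_inv_cmult: "harmonic_inv I d p \<Longrightarrow> harmonic_inv I d (\<lambda>y. c * p y)"
  by (auto simp: harmonic_inv_def lap_cmult refl_inv_def intro: pol_cmult)

lemma harmonic_inv_eul: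
  fixes p :: "('i::finite \<times> nat \<Rightarrow> complex) \<Rightarrow> complex"
  assumes "harmonic_inv I d p"
  shows "harmonic_inv I d (eul a b p)"
proof -
  have p: "pol (I \<times> UNIV) d p" "\<And>a b. lap a b p = (\<lambda>_. 0)" "refl_inv I p"
    using assms by (auto simp: harmonic_inv_def)
  have "lap c e (eul a b p) = (\<lambda>_. 0)" for c e
    by (auto simp: lap_eul[OF p(1)] p(2) eul_def fun_eq_iff)
  then show ?thesis using p by (auto simp: harmonic_inv_def intro: pol_eul refl_inv_eul)
qed

text \<open>Applying \<open>eul a a\<close> and subtracting \<open>r0\<close> times the sum removes
  the component of index \<open>r0\<close> and multiplies every other one by the nonzero number
  \<open>r - r0\<close>; both operations preserve harmonic invariants. Induction isolates these
  components, and the one of index \<open>r0\<close> is what remains after subtracting them.\<close>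

lemma harmonic_inv_components:
  fixes f :: "nat \<Rightarrow> ('i::finite \<times> nat \<Rightarrow> complex) \<Rightarrow> complex"
  assumes "finite R" "harmonic_inv I d (\<lambda>y. \<Sum>r\<in>R. f r y)"
    "\<And>r. r \<in> R \<Longrightarrow> pol (I \<times> UNIV) d (f r)"
    "\<And>r. r \<in> R \<Longrightarrow> eul a a (f r) = (\<lambda>y. of_nat r * f r y)" "r \<in> R"
  shows "harmonic_inv I d (f r)"
  using assms
proof (induction R arbitrary: f r rule: finite_induct)
  case (insert r0 R)
  let ?g = "\<lambda>y. \<Sum>r\<in>insert r0 R. f r y"
  let ?h = "\<lambda>r y. (of_nat r - of_nat r0) * f r y"
  have IH: "harmonic_inv I d (f r)" if "r \<in> R" for r
  proof -
    have "harmonic_inv I d (\<lambda>y. eul a a ?g y + - of_nat r0 * ?g y)"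
      by (intro harmonic_inv_add harmonic_inv_eul harmonic_inv_cmult insert.prems)
    also have "(\<lambda>y. eul a a ?g y + - of_nat r0 * ?g y) = (\<lambda>y. \<Sum>r\<in>R. ?h r y)"
      using insert.hyps insert.prems(2,3)
      by (subst eul_sum[of _ "I \<times> UNIV" d])
        (auto simp: sum_distrib_left left_diff_distrib sum_subtractf sum_negf fun_eq_iff
            distrib_left)
    finally have *: "harmonic_inv I d (\<lambda>y. \<Sum>r\<in>R. ?h r y)" .
    have "harmonic_inv I d (?h r)"
    proof (rule insert.IH[OF * _ _ that])
      show "pol (I \<times> UNIV) d (?h r)" if "r \<in> R" for r
        using that insert.prems(2) by (auto intro: pol_cmult)
      show "eul a a (?h r) = (\<lambda>y. of_nat r * ?h r y)" if "r \<in> R" for r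
        using that insert.prems(2,3) by (subst eul_cmult[of "I \<times> UNIV" d]) (auto simp: mult_ac)
    qed
    from harmonic_inv_cmult[OF this, of "1 / (of_nat r - of_nat r0)"] that insert.hyps
    show ?thesis by (cases "r = r0") simp_all
  qed
  show ?case
  proof (cases "r \<in> R")
    case False
    with insert.prems have [simp]: "r = r0" by auto
    have "harmonic_inv I d (\<lambda>y. \<Sum>r\<in>R'. f r y)" if "R' \<subseteq> R" "finite R'" for R'
      using that(2,1)
    proof (induction R' rule: finite_induct)
      case empty
      then show ?case using harmonic_inv_cmult[OF insert.prems(1), of 0] by simp
    next
      case (insert x F)
      then show ?case by (simp add: harmonic_inv_add IH)
    qed
    from harmonic_inv_add[OF insert.prems(1) harmonic_inv_cmult[OF this[of R], of "-1"]]
    show ?thesis using insert.hyps by simp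
  qed (rule IH)
qed simp


lemma eul_homogeneous:
  fixes p :: "('i::finite \<times> nat \<Rightarrow> complex) \<Rightarrow> complex"
  assumes "pol S d p" "\<And>t y. p (scale_on (UNIV \<times> {a}) t y) = t ^ r * p y"
  shows "eul a a p = (\<lambda>y. of_nat r * p y)"
proof
  fix y :: "'i \<times> nat \<Rightarrow> complex"
  have eq: "(\<lambda>s. y s + t * shift a (\<lambda>c. if c = a then 1 else 0) y s) = scale_on (UNIV \<times> {a}) (1 + t) y" for t
    by (auto simp: shift_def scale_on_def fun_eq_iff algebra_simps)
  have "((\<lambda>t. (1 + t) ^ r * p y) has_field_derivative of_nat r * p y) (at 0)"
    by (auto intro!: derivative_eq_intros)
  then have "((\<lambda>t. p (\<lambda>s. y s + t * shift a (\<lambda>c. if c = a then 1 else 0) y s))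
      has_field_derivative of_nat r * p y) (at 0)"
    unfolding eq assms(2) .
  from DERIV_unique[OF eul_DERIV[OF assms(1)] this] show "eul a a p y = of_nat r * p y" .
qed

text \<open>Dilating slot \<open>a\<close> by \<open>t\<close> speeds up the shear of slot
  \<open>b\<close> by the factor \<open>t\<close>; this accounts for the additional power.\<close>

lemma homogeneous_eul:
  fixes p :: "('i::finite \<times> nat \<Rightarrow> complex) \<Rightarrow> complex"
  assumes "pol S d p" "\<And>t y. p (scale_on (UNIV \<times> {a}) t y) = t ^ r * p y" "b \<noteq> a"
  shows "eul a b p (scale_on (UNIV \<times> {a}) t y) = t ^ Suc r * eul a b p y"
proof -
  let ?S = "scale_on (UNIV \<times> {a})" and ?c = "\<lambda>c. if c = b then 1 else 0 :: complex"
  have eq: "(\<lambda>s. ?S t y s + u * shift a ?c (?S t y) s) = ?S t (\<lambda>s. y s + (u * t) * shift a ?c y s)" for u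
    using assms(3) by (auto simp: shift_def scale_on_def fun_eq_iff algebra_simps)
  have "((\<lambda>u. p (\<lambda>s. y s + (u * t) * shift a ?c y s)) has_field_derivative eul a b p y * t) (at 0)"
  proof (rule DERIV_chain2[where f = "\<lambda>u. p (\<lambda>s. y s + u * shift a ?c y s)" and g = "\<lambda>u. u * t"])
    show "((\<lambda>u. p (\<lambda>s. y s + u * shift a ?c y s)) has_field_derivative eul a b p y) (at (0 * t))"
      using eul_DERIV[OF assms(1)] by simp
  qed (auto intro!: derivative_eq_intros)
  then have "((\<lambda>u. t ^ r * p (\<lambda>s. y s + (u * t) * shift a ?c y s)) has_field_derivative
      t ^ r * (eul a b p y * t)) (at 0)"
    by (rule DERIV_cmult)
  then have "((\<lambda>u. p (\<lambda>s. ?S t y s + u * shift a ?c (?S t y) s)) has_field_derivative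
      t ^ r * (eul a b p y * t)) (at 0)"
    unfolding eq assms(2) .
  from DERIV_unique[OF eul_DERIV[OF assms(1)] this] show ?thesis by simp
qed

text \<open>On the ray \<open>t * y\<close> the function is a polynomial \<open>P\<close> for which
  t P'(t) is the sum of all \<open>eul a a p\<close>, so \<open>P\<close> is constant.\<close>

lemma const_if_eul_eq_0:
  fixes p :: "('i::finite \<times> nat \<Rightarrow> complex) \<Rightarrow> complex"
  assumes "pol S d p" "\<And>a. eul a a p = (\<lambda>_. 0)"
  shows "p y = p (\<lambda>_. 0)"
proof -
  obtain m where "pol (S \<inter> UNIV \<times> {..<m}) d p" using pol_nat_bound[OF assms(1)] by blast
  then have m: "pol (UNIV \<times> {..<m}) d p" by (rule pol_mono) auto
  obtain P where P: "\<And>t. p (\<lambda>s. 0 + t * y s) = poly P t"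
    using pol_line[OF assms(1), of "\<lambda>_. 0" y] by auto
  have "t * poly (pderiv P) t = 0" for t
  proof -
    let ?w = "\<lambda>s. 0 + t * y s"
    have "((\<lambda>t. p (\<lambda>s. 0 + t * y s)) has_field_derivative
       (\<Sum>s\<in>UNIV \<times> {..<m}. y s * pd s p ?w)) (at t)"
      by (rule pol_chain[OF m]) auto
    then have "(\<Sum>s\<in>UNIV \<times> {..<m}. y s * pd s p ?w) = poly (pderiv P) t"
      unfolding P using DERIV_unique poly_DERIV by blast
    then have "t * poly (pderiv P) t = (\<Sum>s\<in>UNIV \<times> {..<m}. ?w s * pd s p ?w)"
      unfolding \<open>_ = poly (pderiv P) t\<close>[symmetric] by (simp add: sum_distrib_left mult.assoc)
    also have "\<dots> = (\<Sum>i\<in>UNIV. \<Sum>a<m. ?w (i, a) * pd (i, a) p ?w)"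
      by (simp add: sum.cartesian_product)
    also have "\<dots> = (\<Sum>a<m. eul a a p ?w)"
      unfolding eul_def by (rule sum.swap)
    finally show ?thesis by (simp add: assms(2))
  qed
  then have "poly ([:0, 1:] * pderiv P) = poly 0" by (intro ext) simp
  then have "[:0, 1:] * pderiv P = 0" by (simp only: poly_eq_poly_eq_iff)
  then have "pderiv P = 0" by simp
  then obtain c where "P = [:c:]" by (auto simp: pderiv_eq_0_iff elim: degree_eq_zeroE)
  with P[of 1] P[of 0] show ?thesis by simp
qed

lemma pd_power:
  assumes "pol S d p"
  shows "pd s (\<lambda>y. p y ^ k) = (\<lambda>y. of_nat k * p y ^ (k - 1) * pd s p y)"
proof
  fix y
  show "pd s (\<lambda>y. p y ^ k) y = of_nat k * p y ^ (k - 1) * pd s p y"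
    using DERIV_power[OF pol_pd_DERIV[OF assms], of y s k] by (intro pdI) (simp add: mult_ac)
qed

section \<open>Restriction to a fixed basis vector\<close>

definition slice :: "'i \<Rightarrow> nat \<Rightarrow> ('i \<times> nat \<Rightarrow> complex) \<Rightarrow> 'i \<times> nat \<Rightarrow> complex" where
  "slice i0 a0 y = (\<lambda>(i, b). if b = a0 then if i = i0 then 1 else 0 else y (i, b))"

lemma pd_slice: "pd (i, b) (\<lambda>y. f (slice i0 a0 y)) = (\<lambda>y. if b = a0 then 0 else pd (i, b) f (slice i0 a0 y))"
proof
  fix y
  have "slice i0 a0 (y((i, b) := t)) = (if b = a0 then slice i0 a0 y else (slice i0 a0 y)((i, b) := t))" for t
    by (auto simp: slice_def fun_eq_iff)
  then show "pd (i, b) (\<lambda>y. f (slice i0 a0 y)) y = (if b = a0 then 0 else pd (i, b) f (slice i0 a0 y))"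
    by (simp add: pd_def) (simp add: slice_def)
qed

text \<open>The vanishing polarizations allow multiples of the fixed vector to be subtracted from
  the other slots, which removes their \<open>i0\<close> components; so the restriction only
  involves \<open>J\<close>. Laplacians in slots other than \<open>a0\<close> commute with the
  restriction, those touching \<open>a0\<close> give zero, and reflections supported on
  \<open>J\<close> fix the axis \<open>i0\<close>.\<close>

lemma harmonic_inv_slice:
  assumes f: "harmonic_inv (insert i0 J) d f" and eul: "\<And>b. b \<noteq> a0 \<Longrightarrow> eul a0 b f = (\<lambda>_. 0)"
    and "i0 \<notin> J"
  shows "harmonic_inv J d (\<lambda>y. f (slice i0 a0 y))"
proof -
  have f_pol: "pol (insert i0 J \<times> UNIV) d f" and f_lap: "\<And>c e. lap c e f = (\<lambda>_. 0)"
    and f_inv: "refl_inv (insert i0 J) f"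
    using f by (auto simp: harmonic_inv_def)
  let ?sl = "\<lambda>y (i, b). if b = a0 then if i = i0 then 1 else 0 else if i = i0 then 0 else y (i, b)"
  have "f (slice i0 a0 y) = f (?sl y)" for y
  proof -
    define c where "c = (\<lambda>b. if b = a0 then 0 else - y (i0, b))"
    have "?sl y = (\<lambda>s. slice i0 a0 y s + shift a0 c (slice i0 a0 y) s)"
      by (auto simp: slice_def shift_def c_def fun_eq_iff)
    then have "f (?sl y) = f (\<lambda>s. slice i0 a0 y s + shift a0 c (slice i0 a0 y) s)" by simp
    also have "\<dots> = f (slice i0 a0 y)"
      by (rule shift_invariant[OF f_pol eul]) (auto simp: c_def)
    finally show ?thesis by simp
  qed
  moreover have "pol (J \<times> UNIV) d (\<lambda>y. f (?sl y))"
  proof (rule pol_subst[OF f_pol])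
    fix s assume s: "s \<in> insert i0 J \<times> (UNIV :: nat set)"
    obtain i b where [simp]: "s = (i, b)" by (cases s)
    show "pol (J \<times> UNIV) 1 (\<lambda>y. ?sl y s)"
      using s pol_coord[of "(i, b)" "J \<times> UNIV" 0] by (cases "b = a0"; cases "i = i0") auto
  qed
  ultimately have "pol (J \<times> UNIV) d (\<lambda>y. f (slice i0 a0 y))" by simp
  moreover have "lap c e (\<lambda>y. f (slice i0 a0 y)) = (\<lambda>_. 0)" for c e
  proof (cases "c = a0 \<or> e = a0")
    case True
    then show ?thesis by (cases "e = a0") (auto simp: lap_eq pd_slice)
  next
    case False
    then have "lap c e (\<lambda>y. f (slice i0 a0 y)) = (\<lambda>y. lap c e f (slice i0 a0 y))"
      by (simp add: lap_eq pd_slice)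
    then show ?thesis by (simp add: f_lap)
  qed
  moreover have "refl_inv J (\<lambda>y. f (slice i0 a0 y))"
    unfolding refl_inv_def
  proof (intro allI impI)
    fix v :: "_ \<Rightarrow> real" and y
    assume v: "\<forall>i. i \<notin> J \<longrightarrow> v i = 0" "(\<Sum>i\<in>UNIV. (v i)\<^sup>2) = 1"
    have "v i0 = 0" using v \<open>i0 \<notin> J\<close> by auto
    then have "slice i0 a0 (refl_at v y) = refl_at v (slice i0 a0 y)"
      by (auto simp: slice_def refl_at_def fun_eq_iff if_distrib[of "\<lambda>x. _ * x"] sum.delta cong: if_cong)
    then show "f (slice i0 a0 (refl_at v y)) = f (slice i0 a0 y)"
      using f_inv v by (auto simp: refl_inv_def)
  qed
  ultimately show ?thesis by (auto simp: harmonic_inv_def)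
qed

text \<open>A Householder reflection moves the vector in slot \<open>a0\<close> onto the \<open>i0\<close> axis.\<close>

lemma value_on_real_points:
  fixes f :: "('i::finite \<times> nat \<Rightarrow> complex) \<Rightarrow> complex"
  assumes f_inv: "refl_inv (insert i0 J) f" and f_pol: "pol (insert i0 J \<times> UNIV) d f"
    and hom: "\<And>t y. f (scale_on (UNIV \<times> {a0}) t y) = t ^ r * f y"
    and C: "\<And>y. f (slice i0 a0 y) = C" and y: "\<And>s. y s \<in> \<real>"
  shows "f y = C * of_real (sqrt (\<Sum>i\<in>insert i0 J. (Re (y (i, a0)))\<^sup>2)) ^ r"
proof -
  have axis: "f z = C * t ^ r" if "\<And>i. z (i, a0) = (if i = i0 then t else 0)" for z t
  proof -
    have "z = scale_on (UNIV \<times> {a0}) t (slice i0 a0 z)"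
      using that by (auto simp: scale_on_def slice_def fun_eq_iff)
    then have "f z = f (scale_on (UNIV \<times> {a0}) t (slice i0 a0 z))" by simp
    then show ?thesis by (simp add: hom C)
  qed
  let ?I = "insert i0 J"
  \<comment> \<open>Cut to the components in \<open>insert i0 J\<close>, the only ones
    \<open>f\<close> depends on, so that the Householder vector is supported there too.\<close>
  define x where "x = (\<lambda>i. if i \<in> ?I then Re (y (i, a0)) else 0)"
  define t where "t = sqrt (\<Sum>i\<in>UNIV. (x i)\<^sup>2)"
  define z where "z = (\<lambda>(i, b). if i \<in> ?I then y (i, b) else 0)"
  \<comment> \<open>The Householder vector \<open>x - t e\<close>, with \<open>e\<close> the basis
    vector \<open>i0\<close> and \<open>t\<close> the length of \<open>x\<close>.\<close>
  define w where "w = (\<lambda>i. x i - (if i = i0 then t else 0))"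
  define n where "n = (\<Sum>i\<in>UNIV. (w i)\<^sup>2)"
  have t2: "t\<^sup>2 = (\<Sum>i\<in>UNIV. (x i)\<^sup>2)" by (simp add: t_def sum_nonneg)
  have "(\<Sum>i\<in>?I. (Re (y (i, a0)))\<^sup>2) = (\<Sum>i\<in>UNIV. (x i)\<^sup>2)"
    by (rule sum.mono_neutral_cong_left) (auto simp: x_def)
  then have t: "sqrt (\<Sum>i\<in>?I. (Re (y (i, a0)))\<^sup>2) = t" by (simp add: t_def)
  have z: "z (i, a0) = of_real (x i)" for i
    using y[of "(i, a0)"] by (simp add: z_def x_def complex_is_Real_iff complex_eq_iff)
  have wx: "(\<Sum>i\<in>UNIV. w i * x i) = t\<^sup>2 - t * x i0"
    unfolding t2 by (simp add: w_def left_diff_distrib sum_subtractf power2_eq_square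
        if_distrib[of "\<lambda>x. x * _"] sum.delta cong: if_cong)
  have "(w i)\<^sup>2 = w i * x i - (if i = i0 then t * w i else 0)" for i
    by (simp add: w_def power2_eq_square algebra_simps)
  then have n: "n = (\<Sum>i\<in>UNIV. w i * x i) - t * w i0"
    by (simp add: n_def sum_subtractf sum.delta)
  \<comment> \<open>\<open>x\<close> and \<open>t e\<close> have equal length, so |w|^2 = 2 w.x.
    This cancels the factor 2 in the reflection, which therefore subtracts exactly \<open>w\<close>
    from \<open>x\<close>.\<close>
  have "n = 2 * (\<Sum>i\<in>UNIV. w i * x i)"
    unfolding n wx by (simp add: w_def power2_eq_square algebra_simps)
  have "f y = f z" by (rule pol_cong[OF f_pol]) (auto simp: z_def)
  also have "\<dots> = C * of_real t ^ r"
  proof (cases "n = 0")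
    case True
    then have "w i = 0" for i
      by (simp add: n_def sum_nonneg_eq_0_iff)
    then have "x i = (if i = i0 then t else 0)" for i
      by (metis w_def diff_eq_eq add_0)
    then show ?thesis by (intro axis) (simp add: z)
  next
    case False
    have "n \<ge> 0" by (simp add: n_def sum_nonneg)
    with False have "n > 0" by simp
    define v where "v = (\<lambda>i. w i / sqrt n)"
    have "(\<Sum>i\<in>UNIV. (v i)\<^sup>2) = n / n"
      using \<open>n > 0\<close> by (simp add: v_def power_divide sum_divide_distrib[symmetric] n_def[symmetric])
    then have v1: "(\<Sum>i\<in>UNIV. (v i)\<^sup>2) = 1" using \<open>n > 0\<close> by simp
    have v0: "v i = 0" if "i \<notin> ?I" for i using that by (simp add: v_def w_def x_def)
    have vx: "v i * (\<Sum>j\<in>UNIV. v j * x j) = w i / 2" for i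
    proof -
      have "v i * (\<Sum>j\<in>UNIV. v j * x j) = w i * (\<Sum>j\<in>UNIV. w j * x j) / (sqrt n * sqrt n)"
        by (simp add: v_def sum_divide_distrib[symmetric])
      also have "\<dots> = w i * (n / 2) / n" using \<open>n = 2 * _\<close> \<open>n > 0\<close> by simp
      finally show ?thesis using \<open>n > 0\<close> by simp
    qed
    have "f z = f (refl_at v z)" using f_inv v0 v1 by (auto simp: refl_inv_def)
    also have "\<dots> = C * of_real t ^ r"
    proof (rule axis)
      fix i
      have "refl_at v z (i, a0) = of_real (x i - 2 * (v i * (\<Sum>j\<in>UNIV. v j * x j)))"
        by (simp add: refl_at_def z)
      also have "\<dots> = of_real (x i - w i)" unfolding vx by simp
      finally show "refl_at v z (i, a0) = (if i = i0 then of_real t else 0)"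
        by (simp add: w_def)
    qed
    finally show ?thesis .
  qed
  finally show ?thesis unfolding t .
qed


text \<open>The Laplacian of |x|^(2k+2) is 2 (k+1) (2k + card I) |x|^(2k). Evaluation at the basis
  vector \<open>i0\<close>, where |x| = 1, leaves a positive multiple of \<open>C\<close>.\<close>

lemma no_harmonic_power:
  fixes f :: "('i::finite \<times> nat \<Rightarrow> complex) \<Rightarrow> complex"
  assumes lap: "lap a a f = (\<lambda>_. 0)" and f: "f = (\<lambda>y. C * (\<Sum>i\<in>I. (y (i, a))\<^sup>2) ^ Suc k)"
    and "i0 \<in> I"
  shows "C = 0"
proof -
  define Q where "Q = (\<lambda>y :: 'i \<times> nat \<Rightarrow> complex. \<Sum>i\<in>I. (y (i, a))\<^sup>2)"
  have sq: "pol UNIV (2 * 1) (\<lambda>y. (y (i, a))\<^sup>2)" for i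
    by (intro pol_power) (use pol_coord[of "(i, a)" UNIV 0] in simp)
  have Q: "pol UNIV (2 * 1) Q" unfolding Q_def by (rule pol_sum) (rule sq)
  have pol1: "pol UNIV 1 (\<lambda>y. y s)" for s using pol_coord[of s UNIV 0] by simp
  have pdQ: "pd (i, a) Q = (\<lambda>y. if i \<in> I then 2 * y (i, a) else 0)" for i
  proof -
    have "pd (i, a) Q = (\<lambda>y. \<Sum>j\<in>I. if j = i then 2 * y (j, a) else 0)"
      unfolding Q_def pd_sum[of I UNIV _ "\<lambda>j y. (y (j, a))\<^sup>2", OF sq]
      by (rule ext, rule sum.cong[OF refl]) (auto simp: pd_power[OF pol1] pd_coord)
    then show ?thesis by (simp add: sum.delta fun_eq_iff)
  qed
  have pdf: "pd (i, a) f = (\<lambda>y. C * of_nat (Suc k) * (Q y ^ k * (if i \<in> I then 2 * y (i, a) else 0)))" for i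
  proof -
    have fQ: "f = (\<lambda>y. C * Q y ^ Suc k)" by (simp add: f Q_def)
    show ?thesis unfolding fQ
      by (subst pd_cmult[OF pol_power[OF Q]]) (simp add: pd_power[OF Q] pdQ fun_eq_iff del: power_Suc)
  qed
  let ?e = "\<lambda>s. if s = (i0, a) then 1 else 0 :: complex"
  have Qe: "Q ?e = 1" using \<open>i0 \<in> I\<close>
    by (simp add: Q_def if_distrib[of "\<lambda>x. x\<^sup>2"] sum.delta cong: if_cong)
  have "pd (i, a) (pd (i, a) f) ?e =
      C * of_nat (Suc k) * (if i \<in> I then (if i = i0 then 4 * of_nat k else 0) + 2 else 0)" for i
  proof (cases "i \<in> I")
    case True
    have "pd (i, a) (pd (i, a) f) = (\<lambda>y. C * of_nat (Suc k) *
       (of_nat k * Q y ^ (k - 1) * (2 * y (i, a)) * (2 * y (i, a)) + Q y ^ k * 2))"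
      unfolding pdf using True
      by (subst pd_cmult[OF pol_mult[OF pol_power[OF Q]]])
        (auto simp: pd_mult[OF pol_power[OF Q] pol_cmult[OF pol1]] pd_power[OF Q] pdQ
          pd_cmult[OF pol1] pd_coord intro: pol_cmult[OF pol1])
    with True show ?thesis by (simp add: Qe)
  qed (simp add: pdf)
  then have "0 = C * of_nat (Suc k) * (\<Sum>i\<in>UNIV. if i \<in> I then (if i = i0 then 4 * of_nat k else 0) + 2 else 0)"
    using fun_cong[OF lap, of ?e] by (simp add: lap_def sum_distrib_left)
  also have "(\<Sum>i\<in>UNIV. if i \<in> I then (if i = i0 then 4 * of_nat k else 0) + 2 else 0 :: complex)
      = of_nat (4 * k + 2 * card I)"
    using \<open>i0 \<in> I\<close> by (simp add: sum.If_cases sum.distrib)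
  finally show ?thesis
    using \<open>i0 \<in> I\<close> by (simp only: mult_eq_0_iff of_nat_eq_0_iff eq_commute[of 0]) (auto simp: card_eq_0_iff)
qed

lemma harmonic_inv_const_step:
  fixes p :: "('i::finite \<times> nat \<Rightarrow> complex) \<Rightarrow> complex"
  assumes IH: "\<And>h y z. harmonic_inv J d h \<Longrightarrow> h y = h z" and "i0 \<notin> J"
    and p: "harmonic_inv (insert i0 J) d p"
  shows "p y = p (\<lambda>_. 0)"
proof (rule ccontr)
  assume nonconst: "p y \<noteq> p (\<lambda>_. 0)"
  let ?I = "insert i0 J"
  have p_pol: "pol (?I \<times> UNIV) d p" using p by (simp add: harmonic_inv_def)
  obtain a0 where a0: "eul a0 a0 p \<noteq> (\<lambda>_. 0)"
    using const_if_eul_eq_0[OF p_pol] nonconst by blast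
  let ?hom = "\<lambda>r (f :: ('i \<times> nat \<Rightarrow> complex) \<Rightarrow> complex). \<forall>t y. f (scale_on (UNIV \<times> {a0}) t y) = t ^ r * f y"
  \<comment> \<open>All harmonic invariants with bound \<open>d\<close> compete, not only the
    components of \<open>p\<close>, since polarization leaves the latter. Degree zero is excluded
    because the final contradiction needs a positive power.\<close>
  define R where "R = {r. r \<noteq> 0 \<and> (\<exists>f. harmonic_inv ?I d f \<and> ?hom r f \<and> f \<noteq> (\<lambda>_. 0))}"
  have "R \<subseteq> {..d}"
  proof
    fix r assume "r \<in> R"
    then obtain f where f: "harmonic_inv ?I d f" "?hom r f" "f \<noteq> (\<lambda>_. 0)" by (auto simp: R_def)
    then have "pol (?I \<times> UNIV) d f" by (simp add: harmonic_inv_def)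
    from homogeneous_degree_bound[OF this, of "UNIV \<times> {a0}" _ r] f(2,3) show "r \<in> {..d}"
      by (force simp: not_le[symmetric])
  qed
  then have "finite R" by (rule finite_subset) simp
  have "R \<noteq> {}"
  proof -
    obtain q where q: "\<forall>r. pol (?I \<times> UNIV) d (q r)"
      "\<forall>r t y. q r (scale_on (UNIV \<times> {a0}) t y) = t ^ r * q r y"
      "p = (\<lambda>y. \<Sum>r\<le>d. q r y)"
      using pol_homogeneous_components[OF p_pol, of "UNIV \<times> {a0}"] by auto
    have eul_q: "eul a0 a0 (q r) = (\<lambda>y. of_nat r * q r y)" for r
      using q by (intro eul_homogeneous) auto
    have harm: "harmonic_inv ?I d (q r)" if "r \<le> d" for r
      by (rule harmonic_inv_components[of "{..d}" _ _ q a0]) (use p q eul_q that in auto)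
    have "eul a0 a0 p = (\<lambda>y. \<Sum>r\<le>d. of_nat r * q r y)"
      unfolding q(3) by (subst eul_sum[of _ "?I \<times> UNIV" d]) (auto simp: eul_q q(1))
    with a0 obtain r where "r \<le> d" "r \<noteq> 0" "q r \<noteq> (\<lambda>_. 0)"
      by (metis (no_types, lifting) atMost_iff mult_eq_0_iff of_nat_0 sum.neutral)
    then have "r \<in> R" unfolding R_def
      by (intro CollectI conjI exI[of _ "q r"]) (use harm q(2) in auto)
    then show ?thesis by blast
  qed
  define r where "r = Max R"
  have "r \<in> R" unfolding r_def using \<open>finite R\<close> \<open>R \<noteq> {}\<close> by (rule Max_in)
  then obtain f where f: "harmonic_inv ?I d f" "f \<noteq> (\<lambda>_. 0)" and "r \<noteq> 0"
    and hom: "\<And>t y. f (scale_on (UNIV \<times> {a0}) t y) = t ^ r * f y"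
    by (auto simp: R_def)
  have f_pol: "pol (?I \<times> UNIV) d f" and f_lap: "\<And>c e. lap c e f = (\<lambda>_. 0)"
    and f_inv: "refl_inv ?I f"
    using f by (auto simp: harmonic_inv_def)
  have "eul a0 b f = (\<lambda>_. 0)" if "b \<noteq> a0" for b
  proof (rule ccontr)
    assume "eul a0 b f \<noteq> (\<lambda>_. 0)"
    moreover have "?hom (Suc r) (eul a0 b f)"
      using homogeneous_eul[OF f_pol hom that] by auto
    ultimately have "Suc r \<in> R" unfolding R_def
      by (intro CollectI conjI exI[of _ "eul a0 b f"] harmonic_inv_eul[OF f(1)]) auto
    then have "Suc r \<le> r" unfolding r_def using \<open>finite R\<close> by (rule Max_ge[rotated])
    then show False by simp
  qed
  then have "harmonic_inv J d (\<lambda>y. f (slice i0 a0 y))"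
    using harmonic_inv_slice[OF f(1) _ \<open>i0 \<notin> J\<close>] by blast
  then obtain C where C: "\<And>y. f (slice i0 a0 y) = C" using IH by blast
  note val = value_on_real_points[OF f_inv f_pol hom C]
  have "C \<noteq> 0"
  proof
    assume "C = 0"
    have "f y = 0" for y by (rule pol_eq_0_if_real[OF f_pol]) (simp add: val \<open>C = 0\<close>)
    with f(2) show False by auto
  qed
  \<comment> \<open>The value at a real point depends only on the length of the vector in slot
    \<open>a0\<close>, whereas homogeneity gives the sign (-1)^r under its negation. Evenness then
    turns the power of a square root into a polynomial.\<close>
  have "even r"
  proof (rule ccontr)
    assume "odd r"
    let ?e = "slice i0 a0 (\<lambda>_. 0)"
    have "f (\<lambda>s. - ?e s) = f (scale_on (UNIV \<times> {a0}) (-1) ?e)"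
      by (rule arg_cong[of _ _ f]) (auto simp: scale_on_def slice_def fun_eq_iff)
    also have "\<dots> = - C" by (simp add: hom C \<open>odd r\<close>)
    finally have "f (\<lambda>s. - ?e s) = - C" .
    moreover have "f (\<lambda>s. - ?e s) = C"
    proof -
      have "(\<Sum>i\<in>?I. (Re (- ?e (i, a0)))\<^sup>2) = (\<Sum>i\<in>?I. if i = i0 then 1 else 0)"
        by (rule sum.cong) (auto simp: slice_def)
      also have "\<dots> = 1" by (subst sum.delta) auto
      finally show ?thesis by (subst val) (auto simp: slice_def)
    qed
    ultimately show False using \<open>C \<noteq> 0\<close> by simp
  qed
  then obtain k where k: "r = 2 * Suc k" using \<open>r \<noteq> 0\<close> by (metis evenE mult_0_right not0_implies_Suc)
  have "f = (\<lambda>y. C * (\<Sum>i\<in>?I. (y (i, a0))\<^sup>2) ^ Suc k)"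
  proof
    fix y
    let ?g = "\<lambda>y :: 'i \<times> nat \<Rightarrow> complex. C * (\<Sum>i\<in>?I. (y (i, a0))\<^sup>2) ^ Suc k"
    have sq: "pol UNIV (2 * Suc 0) (\<lambda>y :: 'i \<times> nat \<Rightarrow> complex. (y (i, a0))\<^sup>2)" for i
      by (intro pol_power pol_coord) auto
    have g: "pol UNIV (Suc k * (2 * Suc 0)) ?g"
      by (rule pol_cmult[OF pol_power[OF pol_sum[OF sq]]])
    have "f y - ?g y = 0"
    proof (rule pol_eq_0_if_real[of UNIV "d + Suc k * (2 * Suc 0)" "\<lambda>y. f y - ?g y"])
      show "pol UNIV (d + Suc k * (2 * Suc 0)) (\<lambda>y. f y - ?g y)"
        by (rule pol_diff[OF pol_mono[OF f_pol] pol_mono[OF g]]) auto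
      fix y :: "'i \<times> nat \<Rightarrow> complex" assume y: "\<And>s. y s \<in> \<real>"
      have "of_real (sqrt (\<Sum>i\<in>?I. (Re (y (i, a0)))\<^sup>2)) ^ r
          = (of_real (\<Sum>i\<in>?I. (Re (y (i, a0)))\<^sup>2) :: complex) ^ Suc k"
        unfolding k power_mult of_real_power[symmetric] by (subst real_sqrt_pow2) (auto intro: sum_nonneg)
      also have "(of_real (\<Sum>i\<in>?I. (Re (y (i, a0)))\<^sup>2) :: complex) = (\<Sum>i\<in>?I. (y (i, a0))\<^sup>2)"
        using y by (auto simp: complex_is_Real_iff complex_eq_iff power2_eq_square intro!: sum.cong)
      finally show "f y - ?g y = 0" by (simp only: val[OF y] diff_self)
    qed
    then show "f y = ?g y" by simp
  qed
  from no_harmonic_power[OF f_lap this] \<open>C \<noteq> 0\<close> show False by blast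
qed

theorem harmonic_inv_const:
  fixes p :: "('i::finite \<times> nat \<Rightarrow> complex) \<Rightarrow> complex"
  assumes "harmonic_inv I d p"
  shows "p y = p z"
proof -
  have "finite I" by simp
  then have "\<forall>p y z. harmonic_inv I d p \<longrightarrow> p y = p z"
  proof (induction I rule: finite_induct)
    case empty
    then show ?case by (auto simp: harmonic_inv_def intro: pol_cong)
  next
    case (insert i0 J)
    then show ?case using harmonic_inv_const_step[of J d i0] by metis
  qed
  with assms show ?thesis by blast
qed

section \<open>The first fundamental theorem\<close>

text \<open>The factor \<open>t = 0\<close> is included: it makes functions of degree zero constant
  and forces the value 0 at the origin in positive degree.\<close>

definition homog :: "nat \<Rightarrow> (('a \<Rightarrow> complex) \<Rightarrow> complex) \<Rightarrow> bool" where
  "homog d f \<longleftrightarrow> (\<forall>t y. f (\<lambda>s. t * y s) = t ^ d * f y)"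

lemma homog_pd:
  assumes "pol S e f" "homog (Suc d) f"
  shows "homog d (pd s f)"
proof -
  have nz: "pd s f (\<lambda>r. t * y r) = t ^ d * pd s f y" if "t \<noteq> 0" for t y
  proof (rule pdI)
    have eq: "f ((\<lambda>r. t * y r)(s := u)) = t ^ Suc d * f (y(s := u / t))" for u
    proof -
      have "(\<lambda>r. t * y r)(s := u) = (\<lambda>r. t * (y(s := u / t)) r)"
        using that by auto
      then show ?thesis using assms(2) by (simp only: homog_def)
    qed
    have "((\<lambda>u. f (y(s := u / t))) has_field_derivative pd s f y * (1 / t)) (at (t * y s))"
    proof (rule DERIV_chain2[where g = "\<lambda>u. u / t" and f = "\<lambda>u. f (y(s := u))"])
      show "((\<lambda>u. f (y(s := u))) has_field_derivative pd s f y) (at (t * y s / t))"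
        using pol_pd_DERIV[OF assms(1)] that by simp
    qed (use that in \<open>auto intro!: derivative_eq_intros\<close>)
    then have "((\<lambda>u. t ^ Suc d * f (y(s := u / t))) has_field_derivative
        t ^ Suc d * (pd s f y * (1 / t))) (at (t * y s))"
      by (rule DERIV_cmult)
    then show "((\<lambda>u. f ((\<lambda>r. t * y r)(s := u))) has_field_derivative t ^ d * pd s f y) (at (t * y s))"
      using that unfolding eq by simp
  qed
  have "pd s f (\<lambda>r. t * y r) = t ^ d * pd s f y" for t y
  proof -
    \<comment> \<open>The chain rule above divides by \<open>t\<close>. The remaining case
      \<open>t = 0\<close> follows because both sides are polynomials in \<open>t\<close>, compared
      after multiplication by \<open>t\<close>.\<close>
    obtain P where P: "\<And>t. pd s f (\<lambda>r. 0 + t * y r) = poly P t"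
      using pol_line[OF pol_pd[OF assms(1)], of s "\<lambda>_. 0" y] by auto
    have "poly ([:0, 1:] * (P - monom (pd s f y) d)) t = 0" for t
      using P[of t] nz[of t y] by (cases "t = 0") (auto simp: poly_monom mult.commute)
    then have "poly ([:0, 1:] * (P - monom (pd s f y) d)) = poly 0" by (intro ext) simp
    then have "P = monom (pd s f y) d" by (simp only: poly_eq_poly_eq_iff) simp
    then show ?thesis using P[of t] by (simp add: poly_monom mult.commute)
  qed
  then show ?thesis by (simp add: homog_def)
qed

lemma homog_0_const: "homog 0 f \<Longrightarrow> f y = f (\<lambda>_. 0)"
  using homog_def[THEN iffD1, rule_format, of 0 f 0 y] by simp

lemma homog_at_0: "homog (Suc d) f \<Longrightarrow> f (\<lambda>_. 0) = 0"
  using homog_def[THEN iffD1, rule_format, of "Suc d" f 0 "\<lambda>_. 0"] by simp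

lemma homog_0_pd: "homog 0 f \<Longrightarrow> pd s f = (\<lambda>_. 0)"
proof -
  assume "homog 0 f"
  then have f: "f = (\<lambda>_. f (\<lambda>_. 0))" by (intro ext) (rule homog_0_const)
  show ?thesis by (subst f) simp
qed

lemma homog_sum: "(\<And>i. i \<in> A \<Longrightarrow> homog d (f i)) \<Longrightarrow> homog d (\<lambda>y. \<Sum>i\<in>A. f i y)"
  by (simp add: homog_def sum_distrib_left)

lemma homog_mult: "homog d f \<Longrightarrow> homog e g \<Longrightarrow> homog (d + e) (\<lambda>y. f y * g y)"
  by (simp add: homog_def power_add mult_ac)

lemma homog_add: "homog d f \<Longrightarrow> homog d g \<Longrightarrow> homog d (\<lambda>y. f y + g y)"
  by (simp add: homog_def distrib_left)

lemma homog_cmult: "homog d f \<Longrightarrow> homog d (\<lambda>y. c * f y)"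
  by (simp add: homog_def mult_ac)

lemma homog_zero: "homog d (\<lambda>_. 0)"
  by (simp add: homog_def)

lemma homog_lap:
  assumes "pol S e f" "homog d f"
  shows "homog (d - 2) (lap a b f)" "d < 2 \<Longrightarrow> lap a b f = (\<lambda>_. 0)"
proof -
  show *: "lap a b f = (\<lambda>_. 0)" if "d < 2"
  proof (cases d)
    case 0
    with assms(2) show ?thesis by (simp add: lap_eq homog_0_pd)
  next
    case (Suc n)
    with that have "homog 0 (pd s f)" for s using assms by (intro homog_pd) auto
    then show ?thesis by (simp add: lap_eq homog_0_pd)
  qed
  show "homog (d - 2) (lap a b f)"
  proof (cases "d < 2")
    case False
    then obtain n where n: "d = Suc (Suc n)" by (metis add_2_eq_Suc le_Suc_ex not_less)
    with assms show ?thesis unfolding lap_eq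
      by (auto intro!: homog_sum homog_pd[OF pol_pd[OF assms(1)]] homog_pd[OF assms(1)])
  qed (simp add: * homog_zero)
qed

section \<open>The Fischer form\<close>

fun fischer :: "'a set \<Rightarrow> nat \<Rightarrow> (('a \<Rightarrow> complex) \<Rightarrow> complex) \<Rightarrow> (('a \<Rightarrow> complex) \<Rightarrow> complex) \<Rightarrow> complex" where
  "fischer S 0 f g = f (\<lambda>_. 0) * cnj (g (\<lambda>_. 0))"
| "fischer S (Suc d) f g = (\<Sum>s\<in>S. fischer S d (pd s f) (pd s g))"

lemma fischer_add_left:
  "pol S1 d1 f \<Longrightarrow> pol S2 d2 g \<Longrightarrow> fischer S d (\<lambda>y. f y + g y) h = fischer S d f h + fischer S d g h"
proof (induction d arbitrary: f g h d1 d2)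
  case (Suc d)
  then show ?case by (simp add: pd_add sum.distrib Suc.IH[OF pol_pd pol_pd])
qed (simp add: distrib_right)

lemma fischer_add_right:
  "pol S1 d1 f \<Longrightarrow> pol S2 d2 g \<Longrightarrow> fischer S d h (\<lambda>y. f y + g y) = fischer S d h f + fischer S d h g"
proof (induction d arbitrary: f g h d1 d2)
  case (Suc d)
  then show ?case by (simp add: pd_add sum.distrib Suc.IH[OF pol_pd pol_pd])
qed (simp add: distrib_left)

lemma fischer_zero_left [simp]: "fischer S d (\<lambda>_. 0) h = 0"
  by (induction d arbitrary: h) auto

lemma fischer_zero_right [simp]: "fischer S d h (\<lambda>_. 0) = 0"
  by (induction d arbitrary: h) auto

lemma fischer_sum_left:
  "(\<And>i. i \<in> A \<Longrightarrow> pol S' e (f i)) \<Longrightarrow> fischer S d (\<lambda>y. \<Sum>i\<in>A. f i y) h = (\<Sum>i\<in>A. fischer S d (f i) h)"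
proof (induction A rule: infinite_finite_induct)
  case (insert x F)
  have "fischer S d (\<lambda>y. f x y + (\<Sum>i\<in>F. f i y)) h = fischer S d (f x) h + fischer S d (\<lambda>y. \<Sum>i\<in>F. f i y) h"
    by (rule fischer_add_left[of S' e _ S' e]) (auto intro: insert.prems pol_sum)
  with insert show ?case by simp
qed auto

lemma fischer_sum_right:
  "(\<And>i. i \<in> A \<Longrightarrow> pol S' e (f i)) \<Longrightarrow> fischer S d h (\<lambda>y. \<Sum>i\<in>A. f i y) = (\<Sum>i\<in>A. fischer S d h (f i))"
proof (induction A rule: infinite_finite_induct)
  case (insert x F)
  have "fischer S d h (\<lambda>y. f x y + (\<Sum>i\<in>F. f i y)) = fischer S d h (f x) + fischer S d h (\<lambda>y. \<Sum>i\<in>F. f i y)"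
    by (rule fischer_add_right[of S' e _ S' e]) (auto intro: insert.prems pol_sum)
  with insert show ?case by simp
qed auto

text \<open>\<open>fischer S d\<close> sums over all words of \<open>d\<close> derivatives, so on
  homogeneous polynomials of degree \<open>d\<close> it is \<open>d!\<close> times the usual Fischer
  product. The factor \<open>Suc d\<close> reflects this normalization: any of the
  \<open>d + 1\<close> letters of a word may be the one that consumes \<open>y s\<close>.\<close>

lemma fischer_adjoint:
  assumes "finite S" "s \<in> S"
  shows "pol S1 e f \<Longrightarrow> pol S2 e' g \<Longrightarrow>
    fischer S (Suc d) (\<lambda>y. y s * f y) g = of_nat (Suc d) * fischer S d f (pd s g)"
proof (induction d arbitrary: f g e e')
  case 0
  have "fischer S (Suc 0) (\<lambda>y. y s * f y) g =
      (\<Sum>t\<in>S. if t = s then f (\<lambda>_. 0) * cnj (pd t g (\<lambda>_. 0)) else 0)"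
    by (auto simp: pd_var[OF 0(1)] intro!: sum.cong)
  then show ?case using assms by (simp add: sum.delta)
next
  case (Suc d)
  have f: "pol UNIV e f" by (rule pol_mono[OF Suc.prems(1)]) auto
  have if_pol: "pol UNIV e (\<lambda>y. if B then f y else 0)" for B by (cases B) (auto intro: f)
  have "fischer S (Suc (Suc d)) (\<lambda>y. y s * f y) g =
      (\<Sum>t\<in>S. fischer S (Suc d) (\<lambda>y. (if s = t then f y else 0) + y s * pd t f y) (pd t g))"
    by (simp only: fischer.simps(2)[of S "Suc d"] pd_var[OF f])
  also have "\<dots> = (\<Sum>t\<in>S. fischer S (Suc d) (\<lambda>y. if s = t then f y else 0) (pd t g)
      + fischer S (Suc d) (\<lambda>y. y s * pd t f y) (pd t g))"
    by (intro sum.cong refl fischer_add_left[OF if_pol pol_var[OF UNIV_I pol_pd'[OF f]]])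
  also have "\<dots> = (\<Sum>t\<in>S. if t = s then fischer S (Suc d) f (pd t g) else 0)
      + (\<Sum>t\<in>S. of_nat (Suc d) * fischer S d (pd t f) (pd s (pd t g)))"
    unfolding sum.distrib using Suc.IH[OF pol_pd[OF Suc.prems(1)] pol_pd[OF Suc.prems(2)]]
    by (intro arg_cong2[of _ _ _ _ "(+)"] sum.cong refl)
      (auto simp del: fischer.simps(2))
  also have "\<dots> = of_nat (Suc (Suc d)) * fischer S (Suc d) f (pd s g)"
    using assms by (simp add: sum.delta sum_distrib_left[symmetric] pd_commute[OF Suc.prems(2), of s]
        sum.distrib algebra_simps)
  finally show ?case .
qed

lemma fischer_nonneg: "Re (fischer S d f f) \<ge> 0 \<and> Im (fischer S d f f) = 0"
  by (induction d arbitrary: f) (auto simp: sum_nonneg)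

lemma sum_fischer_eq_0:
  assumes "finite A" "(\<Sum>i\<in>A. fischer S d (f i) (f i)) = 0" "i \<in> A"
  shows "fischer S d (f i) (f i) = 0"
proof -
  have "(\<Sum>i\<in>A. Re (fischer S d (f i) (f i))) = Re (\<Sum>i\<in>A. fischer S d (f i) (f i))"
    by simp
  with assms have "Re (fischer S d (f i) (f i)) = 0"
    by (simp add: sum_nonneg_eq_0_iff fischer_nonneg)
  with fischer_nonneg[of S d "f i"] show ?thesis by (simp add: complex_eq_iff)
qed

text \<open>The summands are nonnegative, so the form vanishes on each partial derivative, which is
  zero by induction. Thus \<open>f\<close> is constant, and in positive degree homogeneity gives the
  value 0 at the origin.\<close>

lemma fischer_definite:
  "pol S e f \<Longrightarrow> finite S \<Longrightarrow> homog d f \<Longrightarrow> fischer S d f f = 0 \<Longrightarrow> f y = 0"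
proof (induction d arbitrary: f e y)
  case 0
  then show ?case using homog_0_const[of f y] by simp
next
  case (Suc d)
  have "pd s f = (\<lambda>_. 0)" for s
  proof (cases "s \<in> S")
    case True
    have "fischer S d (pd s f) (pd s f) = 0"
      by (rule sum_fischer_eq_0[OF Suc.prems(2) _ True]) (use Suc.prems(4) in simp)
    then show ?thesis
      using Suc.IH[OF pol_pd[OF Suc.prems(1)] Suc.prems(2) homog_pd[OF Suc.prems(1,3)]] by blast
  qed (rule pd_notin[OF Suc.prems(1)])
  then have "f y = f (\<lambda>_. 0)" by (rule pol_constI[OF Suc.prems(1)])
  with homog_at_0[OF Suc.prems(3)] show ?case by simp
qed

section \<open>Linear substitutions acting on all slots at once\<close>

definition lin :: "('i \<Rightarrow> 'i \<Rightarrow> complex) \<Rightarrow> ('i::finite \<times> nat \<Rightarrow> complex) \<Rightarrow> 'i \<times> nat \<Rightarrow> complex" where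
  "lin M y = (\<lambda>(i, a). \<Sum>j\<in>UNIV. M i j * y (j, a))"

lemma pol_lin: "pol UNIV d p \<Longrightarrow> pol UNIV d (\<lambda>y. p (lin M y))"
proof (erule pol_subst)
  fix s :: "'a \<times> nat"
  have "pol UNIV 1 (\<lambda>y. M i j * y (j, a))" for i j a
    using pol_cmult[OF pol_coord[of "(j, a)" UNIV 0]] by simp
  from pol_sum[of UNIV UNIV 1 "\<lambda>j y. M (fst s) j * y (j, snd s)", OF this]
  show "pol UNIV 1 (\<lambda>y. lin M y s)"
    by (simp add: lin_def case_prod_unfold)
qed

lemma pd_lin:
  fixes p :: "('i::finite \<times> nat \<Rightarrow> complex) \<Rightarrow> complex"
  assumes "pol S d p"
  shows "pd (j, a) (\<lambda>y. p (lin M y)) = (\<lambda>y. \<Sum>i\<in>UNIV. M i j * pd (i, a) p (lin M y))"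
proof (rule ext, rule pdI)
  fix y
  obtain m0 where m0: "\<forall>m\<ge>m0. pol (S \<inter> UNIV \<times> {..<m}) d p"
    using pol_nat_bound[OF assms] ..
  define m where "m = max m0 (Suc a)"
  have "a < m" by (simp add: m_def)
  have m: "pol (UNIV \<times> {..<m}) d p"
    by (rule pol_mono[OF m0[rule_format, of m]]) (auto simp: m_def)
  let ?e = "\<lambda>(i, b). if b = a then M i j else 0"
  have "lin M (y((j, a) := t)) (i, b) = lin M y (i, b) + (t - y (j, a)) * ?e (i, b)" for t i b
  proof (cases "b = a")
    case True
    then have "(\<Sum>k\<in>UNIV. M i k * (y((j, a) := t)) (k, b)) =
      (\<Sum>k\<in>UNIV. M i k * y (k, b) + (if k = j then (t - y (j, a)) * M i j else 0))"
      by (intro sum.cong) (auto simp: algebra_simps)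
    then show ?thesis using True by (simp add: lin_def sum.distrib)
  qed (simp add: lin_def)
  then have eq: "lin M (y((j, a) := t)) = (\<lambda>s. lin M y s + (t - y (j, a)) * ?e s)" for t
    by (simp add: fun_eq_iff)
  have "((\<lambda>t. p (\<lambda>s. lin M y s + t * ?e s)) has_field_derivative
      (\<Sum>s\<in>UNIV \<times> {..<m}. ?e s * pd s p (\<lambda>s. lin M y s + 0 * ?e s))) (at 0)"
    by (rule pol_chain[OF m]) auto
  moreover have "(\<Sum>s\<in>UNIV \<times> {..<m}. ?e s * w s) = (\<Sum>i\<in>UNIV. M i j * w (i, a))" for w
  proof -
    have "(\<Sum>s\<in>UNIV \<times> {..<m}. ?e s * w s) = (\<Sum>i\<in>UNIV. \<Sum>b<m. ?e (i, b) * w (i, b))"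
      unfolding sum.cartesian_product by (rule sum.cong) auto
    also have "\<dots> = (\<Sum>i\<in>UNIV. \<Sum>b<m. if b = a then M i j * w (i, a) else 0)"
      by (intro sum.cong) auto
    finally show ?thesis using \<open>a < m\<close> by simp
  qed
  ultimately have D: "((\<lambda>t. p (\<lambda>s. lin M y s + t * ?e s)) has_field_derivative
      (\<Sum>i\<in>UNIV. M i j * pd (i, a) p (lin M y))) (at (y (j, a) - y (j, a)))"
    by simp
  have "((\<lambda>t. p (\<lambda>s. lin M y s + (t - y (j, a)) * ?e s)) has_field_derivative
      (\<Sum>i\<in>UNIV. M i j * pd (i, a) p (lin M y)) * 1) (at (y (j, a)))"
    by (rule DERIV_chain2[where f = "\<lambda>t. p (\<lambda>s. lin M y s + t * ?e s)" and g = "\<lambda>t. t - y (j, a)"])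
      (rule D, auto intro!: derivative_eq_intros)
  then show "((\<lambda>t. p (lin M (y((j, a) := t)))) has_field_derivative
      (\<Sum>i\<in>UNIV. M i j * pd (i, a) p (lin M y))) (at (y (j, a)))"
    unfolding eq by simp
qed

text \<open>Each derivative contributes one factor \<open>M\<close>, and orthonormality of the rows
  collapses the two to the diagonal. For the quadratics it is the columns that matter
  (\<open>qform_lin\<close>).\<close>

lemma lap_lin:
  fixes p :: "('i::finite \<times> nat \<Rightarrow> complex) \<Rightarrow> complex"
  assumes p: "pol UNIV d p" and M: "\<And>i k. (\<Sum>j\<in>UNIV. M i j * M k j) = (if i = k then 1 else 0)"
  shows "lap a b (\<lambda>y. p (lin M y)) = (\<lambda>y. lap a b p (lin M y))"
proof
  fix y
  have "pd (j, a) (pd (j, b) (\<lambda>y. p (lin M y))) y =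
      (\<Sum>i\<in>UNIV. \<Sum>k\<in>UNIV. (M k j * M i j) * pd (k, a) (pd (i, b) p) (lin M y))" for j
  proof -
    have "pol UNIV d (\<lambda>y. M i j * pd (i, b) p (lin M y))" for i
      by (intro pol_cmult pol_lin pol_pd' p)
    then show ?thesis
      unfolding pd_lin[OF p] pd_sum[of UNIV UNIV d "\<lambda>i y. M i j * pd (i, b) p (lin M y)", simplified]
      by (simp add: pd_sum[of UNIV UNIV d "\<lambda>i y. M i j * pd (i, b) p (lin M y)"]
        pd_cmult[OF pol_lin[OF pol_pd'[OF p]]] pd_lin[OF pol_pd'[OF p]] sum_distrib_left mult_ac)
  qed
  then have "lap a b (\<lambda>y. p (lin M y)) y =
      (\<Sum>j\<in>UNIV. \<Sum>i\<in>UNIV. \<Sum>k\<in>UNIV. (M k j * M i j) * pd (k, a) (pd (i, b) p) (lin M y))"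
    by (simp add: lap_def)
  also have "\<dots> = (\<Sum>i\<in>UNIV. \<Sum>j\<in>UNIV. \<Sum>k\<in>UNIV. (M k j * M i j) * pd (k, a) (pd (i, b) p) (lin M y))"
    by (rule sum.swap)
  also have "\<dots> = (\<Sum>i\<in>UNIV. \<Sum>k\<in>UNIV. \<Sum>j\<in>UNIV. (M k j * M i j) * pd (k, a) (pd (i, b) p) (lin M y))"
    by (intro sum.cong refl sum.swap)
  also have "\<dots> = (\<Sum>i\<in>UNIV. \<Sum>k\<in>UNIV. if k = i then pd (k, a) (pd (i, b) p) (lin M y) else 0)"
    by (intro sum.cong refl) (simp add: sum_distrib_right[symmetric] M)
  finally show "lap a b (\<lambda>y. p (lin M y)) y = lap a b p (lin M y)"
    by (simp add: lap_def)
qed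


lemma refl_at_eq_lin:
  "refl_at v = lin (\<lambda>i j. (if i = j then 1 else 0) - 2 * of_real (v i) * of_real (v j))"
  by (auto simp: refl_at_def lin_def fun_eq_iff left_diff_distrib sum_subtractf sum_distrib_left mult.assoc
      if_distrib[of "\<lambda>x. x * _"] sum.delta cong: if_cong)

lemma refl_orthogonal:
  fixes v :: "'i::finite \<Rightarrow> real"
  assumes "(\<Sum>i\<in>UNIV. (v i)\<^sup>2) = 1"
  defines "M \<equiv> \<lambda>i j. (if i = j then 1 else 0) - 2 * complex_of_real (v i) * of_real (v j)"
  shows "(\<Sum>j\<in>UNIV. M i j * M k j) = (if i = k then 1 else 0)"
proof -
  have "(\<Sum>j\<in>UNIV. M i j * M k j) =
    (\<Sum>j\<in>UNIV. (if j = i then if i = k then 1 else 0 else 0)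
      - (if j = i then 2 * of_real (v k) * of_real (v i) else 0)
      - (if j = k then 2 * of_real (v k) * of_real (v i) else 0)
      + 4 * of_real (v i) * of_real (v k) * of_real ((v j)\<^sup>2))"
    by (intro sum.cong) (auto simp: M_def power2_eq_square algebra_simps)
  also have "\<dots> = (if i = k then 1 else 0) - 4 * of_real (v k) * of_real (v i)
      + 4 * of_real (v i) * of_real (v k) * of_real (\<Sum>j\<in>UNIV. (v j)\<^sup>2)"
    by (simp add: sum.distrib sum_subtractf sum_distrib_left)
  finally show ?thesis by (simp add: assms(1))
qed

lemma refl_inv_lap:
  assumes "pol UNIV d p" "refl_inv UNIV p"
  shows "refl_inv UNIV (lap a b p)"
  unfolding refl_inv_def
proof (intro allI impI)
  fix v :: "'a \<Rightarrow> real" and y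
  assume v: "(\<Sum>i\<in>UNIV. (v i)\<^sup>2) = 1"
  have "(\<lambda>y. p (refl_at v y)) = p" using assms(2) v by (auto simp: refl_inv_def)
  with lap_lin[OF assms(1) refl_orthogonal[OF v], of a b] show "lap a b p (refl_at v y) = lap a b p y"
    by (simp add: refl_at_eq_lin fun_eq_iff)
qed

definition qform :: "nat \<Rightarrow> nat \<Rightarrow> ('i::finite \<times> nat \<Rightarrow> complex) \<Rightarrow> complex" where
  "qform a b y = (\<Sum>i\<in>UNIV. y (i, a) * y (i, b))"

lemma qform_lin:
  assumes "\<And>j k. (\<Sum>i\<in>UNIV. M i j * M i k) = (if j = k then 1 else 0)"
  shows "qform a b (lin M y) = qform a b y"
proof -
  have "qform a b (lin M y) = (\<Sum>i\<in>UNIV. \<Sum>j\<in>UNIV. \<Sum>k\<in>UNIV. (M i j * M i k) * (y (j, a) * y (k, b)))"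
    by (simp add: qform_def lin_def sum_product mult_ac)
  also have "\<dots> = (\<Sum>j\<in>UNIV. \<Sum>i\<in>UNIV. \<Sum>k\<in>UNIV. (M i j * M i k) * (y (j, a) * y (k, b)))"
    by (rule sum.swap)
  also have "\<dots> = (\<Sum>j\<in>UNIV. \<Sum>k\<in>UNIV. \<Sum>i\<in>UNIV. (M i j * M i k) * (y (j, a) * y (k, b)))"
    by (intro sum.cong refl sum.swap)
  also have "\<dots> = (\<Sum>j\<in>UNIV. \<Sum>k\<in>UNIV. if k = j then y (j, a) * y (k, b) else 0)"
    by (intro sum.cong refl) (simp add: sum_distrib_right[symmetric] assms)
  finally show ?thesis by (simp add: qform_def)
qed

lemma qform_refl_at:
  assumes "(\<Sum>i\<in>UNIV. (v i)\<^sup>2) = 1"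
  shows "qform a b (refl_at v y) = qform a b y"
  unfolding refl_at_eq_lin
proof (rule qform_lin)
  fix j k
  have "(\<Sum>i\<in>UNIV. ((if i = j then 1 else 0) - 2 * complex_of_real (v i) * of_real (v j)) *
      ((if i = k then 1 else 0) - 2 * of_real (v i) * of_real (v k))) =
    (\<Sum>i\<in>UNIV. ((if j = i then 1 else 0) - 2 * complex_of_real (v j) * of_real (v i)) *
      ((if k = i then 1 else 0) - 2 * of_real (v k) * of_real (v i)))"
    by (intro sum.cong) auto
  also have "\<dots> = (if j = k then 1 else 0)" by (rule refl_orthogonal[OF assms])
  finally show "(\<Sum>i\<in>UNIV. ((if i = j then 1 else 0) - 2 * complex_of_real (v i) * of_real (v j)) *
      ((if i = k then 1 else 0) - 2 * of_real (v i) * of_real (v k))) = (if j = k then 1 else 0)" .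
qed

lemma homog_qform: "homog 2 (qform a b)"
  by (simp add: homog_def qform_def sum_distrib_left power2_eq_square mult_ac)

lemma pol_qform_mult:
  assumes "pol (UNIV \<times> {..<m}) d p" "a < m" "b < m"
  shows "pol (UNIV \<times> {..<m}) (Suc (Suc d)) (\<lambda>y. qform a b y * p y)"
proof -
  have "pol (UNIV \<times> {..<m}) (Suc (Suc d)) (\<lambda>y. y (i, a) * (y (i, b) * p y))" for i
    using assms by (intro pol_var) auto
  from pol_sum[where A = UNIV, OF this] show ?thesis
    by (simp add: qform_def sum_distrib_right mult.assoc)
qed

section \<open>Homogeneous invariants in finitely many slots\<close>

definition inv_poly :: "nat \<Rightarrow> nat \<Rightarrow> (('i::finite \<times> nat \<Rightarrow> complex) \<Rightarrow> complex) \<Rightarrow> bool" where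
  "inv_poly m d f \<longleftrightarrow> pol (UNIV \<times> {..<m}) d f \<and> homog d f \<and> refl_inv UNIV f"

definition qlap :: "nat \<Rightarrow> (('i::finite \<times> nat \<Rightarrow> complex) \<Rightarrow> complex) \<Rightarrow> ('i \<times> nat \<Rightarrow> complex) \<Rightarrow> complex" where
  "qlap m f y = (\<Sum>a<m. \<Sum>b<m. qform a b y * lap a b f y)"

lemma qlap_eq: "qlap m f = (\<lambda>y. \<Sum>a<m. \<Sum>b<m. qform a b y * lap a b f y)"
  by (simp add: qlap_def fun_eq_iff)

lemma inv_poly_add: "inv_poly m d f \<Longrightarrow> inv_poly m d g \<Longrightarrow> inv_poly m d (\<lambda>y. f y + g y)"
  by (auto simp: inv_poly_def refl_inv_def intro: pol_add homog_add)

lemma inv_poly_cmult: "inv_poly m d f \<Longrightarrow> inv_poly m d (\<lambda>y. c * f y)"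
  by (auto simp: inv_poly_def refl_inv_def intro: pol_cmult homog_cmult)

lemma inv_poly_zero: "inv_poly m d (\<lambda>_. 0)"
  by (auto simp: inv_poly_def refl_inv_def homog_def)

lemma inv_poly_sum:
  "(\<And>i. i \<in> A \<Longrightarrow> inv_poly m d (f i)) \<Longrightarrow> inv_poly m d (\<lambda>y. \<Sum>i\<in>A. f i y)"
  by (induction A rule: infinite_finite_induct) (auto intro: inv_poly_add inv_poly_zero)

lemma inv_poly_lap:
  assumes "inv_poly m d f"
  shows "inv_poly m (d - 2) (lap a b f)"
proof -
  have f: "pol (UNIV \<times> {..<m}) d f" "homog d f" "refl_inv UNIV f"
    using assms by (auto simp: inv_poly_def)
  have "pol UNIV d f" by (rule pol_mono[OF f(1)]) auto
  from refl_inv_lap[OF this f(3)] pol_lap[OF f(1)] homog_lap(1)[OF f(1,2)]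
  show ?thesis by (simp add: inv_poly_def)
qed

lemma inv_poly_qform_mult:
  assumes "inv_poly m d f" "a < m" "b < m"
  shows "inv_poly m (Suc (Suc d)) (\<lambda>y. qform a b y * f y)"
proof -
  have f: "pol (UNIV \<times> {..<m}) d f" "homog d f" "refl_inv UNIV f"
    using assms(1) by (auto simp: inv_poly_def)
  have "refl_inv UNIV (\<lambda>y. qform a b y * f y)"
    using f(3) by (simp add: refl_inv_def qform_refl_at)
  with pol_qform_mult[OF f(1) assms(2,3)] homog_mult[OF homog_qform f(2), of a b] show ?thesis
    by (simp add: inv_poly_def)
qed

lemma inv_poly_qlap:
  assumes "inv_poly m d f"
  shows "inv_poly m d (qlap m f)"
proof (cases "d < 2")
  case True
  with assms homog_lap(2)[of _ _ f d] have "lap a b f = (\<lambda>_. 0)" for a b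
    by (auto simp: inv_poly_def)
  then show ?thesis by (simp add: qlap_eq inv_poly_zero)
next
  case False
  then have d: "Suc (Suc (d - 2)) = d" by simp
  show ?thesis unfolding qlap_eq
    using inv_poly_qform_mult[OF inv_poly_lap[OF assms]] unfolding d
    by (intro inv_poly_sum) auto
qed

lemma qlap_add:
  assumes "inv_poly m d f" "inv_poly m d g"
  shows "qlap m (\<lambda>y. f y + g y) = (\<lambda>y. qlap m f y + qlap m g y)"
proof -
  have "pol (UNIV \<times> {..<m}) d f" "pol (UNIV \<times> {..<m}) d g" using assms by (auto simp: inv_poly_def)
  from lap_add[OF this] show ?thesis
    by (simp add: qlap_eq distrib_left sum.distrib)
qed

lemma qlap_cmult:
  assumes "inv_poly m d f"
  shows "qlap m (\<lambda>y. c * f y) = (\<lambda>y. c * qlap m f y)"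
proof -
  have "pol (UNIV \<times> {..<m}) d f" using assms by (auto simp: inv_poly_def)
  from lap_cmult[OF this] show ?thesis
    by (simp add: qlap_eq sum_distrib_left mult_ac)
qed

lemma qlap_zero: "qlap m (\<lambda>_. 0) = (\<lambda>_. 0)"
  by (simp add: qlap_eq lap_eq)

lemma qlap_sum:
  assumes "\<And>i. i \<in> A \<Longrightarrow> inv_poly m d (f i)"
  shows "qlap m (\<lambda>y. \<Sum>i\<in>A. f i y) = (\<lambda>y. \<Sum>i\<in>A. qlap m (f i) y)"
  using assms
proof (induction A rule: infinite_finite_induct)
  case (insert x F)
  have "qlap m (\<lambda>y. f x y + (\<Sum>i\<in>F. f i y)) = (\<lambda>y. qlap m (f x) y + qlap m (\<lambda>y. \<Sum>i\<in>F. f i y) y)"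
    by (rule qlap_add[of m d]) (auto intro: insert.prems inv_poly_sum)
  with insert show ?case by simp
qed (auto simp: qlap_zero)

text \<open>Moved to the other side of the form, the two factors in each term of
  \<open>qform a b\<close> become the two derivatives in \<open>lap a b\<close>. The result is a sum
  of squared norms.\<close>

lemma fischer_qlap:
  fixes f :: "('i::finite \<times> nat \<Rightarrow> complex) \<Rightarrow> complex"
  assumes f: "inv_poly m (Suc (Suc d)) f"
  defines "S \<equiv> (UNIV :: 'i set) \<times> {..<m}"
  shows "fischer S (Suc (Suc d)) (qlap m f) f =
    of_nat (Suc (Suc d)) * of_nat (Suc d) * (\<Sum>a<m. \<Sum>b<m. fischer S d (lap a b f) (lap a b f))"
proof -
  have S: "finite S" "(i, a) \<in> S \<longleftrightarrow> a < m" for i a by (auto simp: S_def)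
  have f_pol: "pol S (Suc (Suc d)) f" using f by (simp add: inv_poly_def S_def)
  have lap_pol: "pol S d (lap a b f)" for a b using pol_lap[OF f_pol] by simp
  have lap_right: "(\<Sum>i\<in>UNIV. fischer S d g (pd (i, a) (pd (i, b) f))) = fischer S d g (lap a b f)" for a b g
    unfolding lap_eq by (rule fischer_sum_right[symmetric, OF pol_pd[OF pol_pd[OF f_pol]]])
  let ?u = "\<lambda>a b i y. y (i, a) * (y (i, b) * lap a b f y)"
  have u_pol: "pol UNIV (Suc (Suc d)) (?u a b i)" for a b i
    using pol_mono[OF lap_pol] by (intro pol_var) auto
  have "qlap m f = (\<lambda>y. \<Sum>a<m. \<Sum>b<m. \<Sum>i\<in>UNIV. ?u a b i y)"
    by (simp add: qlap_eq qform_def sum_distrib_right mult.assoc)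
  then have "fischer S (Suc (Suc d)) (qlap m f) f =
      (\<Sum>a<m. \<Sum>b<m. \<Sum>i\<in>UNIV. fischer S (Suc (Suc d)) (?u a b i) f)"
    by (simp only: fischer_sum_left[OF u_pol] fischer_sum_left[OF pol_sum[OF u_pol]]
        fischer_sum_left[OF pol_sum[OF pol_sum[OF u_pol]]])
  also have "\<dots> = (\<Sum>a<m. \<Sum>b<m. of_nat (Suc (Suc d)) * of_nat (Suc d) *
      (\<Sum>i\<in>UNIV. fischer S d (lap a b f) (pd (i, a) (pd (i, b) f))))"
  proof (intro sum.cong refl)
    fix a b assume ab: "a \<in> {..<m}" "b \<in> {..<m}"
    have "fischer S (Suc (Suc d)) (?u a b i) f = of_nat (Suc (Suc d)) * of_nat (Suc d) *
        fischer S d (lap a b f) (pd (i, a) (pd (i, b) f))" for i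
    proof -
      have "fischer S (Suc (Suc d)) (?u a b i) f =
          of_nat (Suc (Suc d)) * fischer S (Suc d) (\<lambda>y. y (i, b) * lap a b f y) (pd (i, a) f)"
        by (rule fischer_adjoint[OF S(1) _ pol_var[OF _ lap_pol] f_pol]) (use ab S in auto)
      also have "fischer S (Suc d) (\<lambda>y. y (i, b) * lap a b f y) (pd (i, a) f) =
          of_nat (Suc d) * fischer S d (lap a b f) (pd (i, b) (pd (i, a) f))"
        by (rule fischer_adjoint[OF S(1) _ lap_pol pol_pd[OF f_pol]]) (use ab S in auto)
      finally show ?thesis by (simp only: pd_commute[OF f_pol, of "(i, b)"] mult.assoc)
    qed
    then show "(\<Sum>i\<in>UNIV. fischer S (Suc (Suc d)) (?u a b i) f) = of_nat (Suc (Suc d)) * of_nat (Suc d) *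
        (\<Sum>i\<in>UNIV. fischer S d (lap a b f) (pd (i, a) (pd (i, b) f)))"
      by (simp only: sum_distrib_left)
  qed
  also have "\<dots> = (\<Sum>a<m. \<Sum>b<m. of_nat (Suc (Suc d)) * of_nat (Suc d) *
      fischer S d (lap a b f) (lap a b f))"
    unfolding lap_right ..
  finally show ?thesis by (simp only: sum_distrib_left)
qed

text \<open>Positivity shows that \<open>lap a b\<close> kills \<open>f\<close> for
  \<open>a, b < m\<close>; Laplacians in other slots vanish because the variables are absent.
  Harmonic invariants are constant, and a constant of positive degree is zero.\<close>

lemma qlap_injective:
  fixes f :: "('i::finite \<times> nat \<Rightarrow> complex) \<Rightarrow> complex"
  assumes f: "inv_poly m d f" and "d \<ge> 1" and T: "qlap m f = (\<lambda>_. 0)"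
  shows "f = (\<lambda>_. 0)"
proof -
  let ?S = "(UNIV :: 'i set) \<times> {..<m}"
  have f_pol: "pol ?S d f" and f_hom: "homog d f" and f_inv: "refl_inv UNIV f"
    using f by (auto simp: inv_poly_def)
  have "lap a b f = (\<lambda>_. 0)" for a b
  proof (cases "d < 2")
    case True
    then show ?thesis using homog_lap(2)[OF f_pol f_hom] by simp
  next
    case False
    then obtain e where e: "d = Suc (Suc e)" by (metis add_2_eq_Suc le_Suc_ex not_less)
    show ?thesis
    proof (cases "a < m \<and> b < m")
      case True
      have "(\<Sum>a<m. \<Sum>b<m. fischer ?S e (lap a b f) (lap a b f)) = 0"
        using fischer_qlap[OF f[unfolded e]] unfolding T fischer_zero_left
        by (simp only: mult_eq_0_iff eq_commute[of 0] of_nat_eq_0_iff) simp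
      then have "(\<Sum>(a, b)\<in>{..<m} \<times> {..<m}. fischer ?S e (lap a b f) (lap a b f)) = 0"
        by (simp add: sum.cartesian_product)
      then have "(\<Sum>s\<in>{..<m} \<times> {..<m}. fischer ?S e (lap (fst s) (snd s) f) (lap (fst s) (snd s) f)) = 0"
        by (simp add: case_prod_unfold)
      from sum_fischer_eq_0[OF _ this, of "(a, b)"] True
      have "fischer ?S e (lap a b f) (lap a b f) = 0" by simp
      moreover have "pol ?S e (lap a b f)" "homog e (lap a b f)"
        using pol_lap[OF f_pol, of a b] homog_lap(1)[OF f_pol f_hom, of a b] e by simp_all
      ultimately show ?thesis by (intro ext) (rule fischer_definite[of ?S e _ e], auto)
    next
      case False
      then show ?thesis
      proof (cases "b < m")
        case True
        with False have "pd (i, a) (pd (i, b) f) = (\<lambda>_. 0)" for i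
          by (intro pd_notin[OF pol_pd[OF f_pol]]) auto
        then show ?thesis by (simp add: lap_eq)
      next
        case False
        then have "pd (i, b) f = (\<lambda>_. 0)" for i by (intro pd_notin[OF f_pol]) auto
        then show ?thesis by (simp add: lap_eq)
      qed
    qed
  qed
  moreover have "pol (UNIV \<times> UNIV) d f" by (rule pol_mono[OF f_pol]) auto
  ultimately have "harmonic_inv UNIV d f" using f_inv by (simp add: harmonic_inv_def)
  then have const: "f y = f (\<lambda>_. 0)" for y by (rule harmonic_inv_const)
  obtain e where "d = Suc e" using \<open>d \<ge> 1\<close> by (cases d) auto
  with f_hom have "f (\<lambda>_. 0) = 0" by (auto intro: homog_at_0)
  with const show ?thesis by auto
qed

section \<open>Finite dimension and surjectivity\<close>

interpretation fun_vs: vector_space "\<lambda>(c :: complex) (f :: 'a \<Rightarrow> complex) y. c * f y"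
  by unfold_locales (auto simp: fun_eq_iff algebra_simps)

text \<open>A spanning set in degree \<open>d\<close> together with its products by the finitely
  many coordinates spans degree \<open>d + 1\<close>.\<close>

lemma pol_finite_span:
  assumes "finite S"
  shows "\<exists>B. finite B \<and> (\<forall>p. pol S d p \<longrightarrow> p \<in> fun_vs.span B)"
proof (induction d)
  case 0
  have "p \<in> fun_vs.span {\<lambda>_. 1}" if "pol S 0 p" for p
  proof -
    have "p = (\<lambda>y. p (\<lambda>_. 0) * 1)" using pol_0_const[OF that] by auto
    also have "\<dots> \<in> fun_vs.span {\<lambda>_. 1}" by (rule fun_vs.span_scale) (simp add: fun_vs.span_base)
    finally show ?thesis .
  qed
  then show ?case by (intro exI[of _ "{\<lambda>_. 1}"]) simp
next
  case (Suc d)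
  then obtain B where B: "finite B" "\<And>p. pol S d p \<Longrightarrow> p \<in> fun_vs.span B" by blast
  let ?B = "B \<union> (\<Union>s\<in>S. (\<lambda>b y. y s * b y) ` B)"
  have mult: "(\<lambda>y. y s * b y) \<in> fun_vs.span ?B" if "b \<in> fun_vs.span B" "s \<in> S" for s b
    using that(1)
  proof (induction rule: fun_vs.span_induct)
    case base
    show ?case
    proof (rule fun_vs.subspaceI)
      show "0 \<in> {a. (\<lambda>y. y s * a y) \<in> fun_vs.span ?B}"
        using fun_vs.span_zero[of ?B] by (simp add: zero_fun_def)
      fix a a' c
      assume a: "a \<in> {a. (\<lambda>y. y s * a y) \<in> fun_vs.span ?B}"
      have "(\<lambda>y. c * (y s * a y)) \<in> fun_vs.span ?B"
        using a by (intro fun_vs.span_scale) simp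
      then show "(\<lambda>y. c * a y) \<in> {a. (\<lambda>y. y s * a y) \<in> fun_vs.span ?B}" by (simp add: mult_ac)
      assume a': "a' \<in> {a. (\<lambda>y. y s * a y) \<in> fun_vs.span ?B}"
      have "(\<lambda>y. y s * a y) + (\<lambda>y. y s * a' y) \<in> fun_vs.span ?B"
        using a a' by (intro fun_vs.span_add) simp_all
      then show "a + a' \<in> {a. (\<lambda>y. y s * a y) \<in> fun_vs.span ?B}" by (simp add: plus_fun_def distrib_left)
    qed
  next
    case (step b)
    then show ?case using \<open>s \<in> S\<close> by (intro fun_vs.span_base) blast
  qed
  have mono: "fun_vs.span B \<subseteq> fun_vs.span ?B" by (intro fun_vs.span_mono) auto
  have "p \<in> fun_vs.span ?B" if "pol S e p" "e \<le> Suc d" for p e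
    using that
  proof (induction rule: pol.induct)
    case (pol_const e c)
    then show ?case using B(2)[OF pol.pol_const] mono by blast
  next
    case (pol_var s e p)
    then have "pol S d p" by (auto intro: pol_mono)
    then show ?case by (intro mult B(2) pol_var.hyps)
  next
    case (pol_add e p q)
    then show ?case using fun_vs.span_add[of p ?B q] by (simp add: plus_fun_def)
  qed
  moreover have "finite ?B" using B(1) assms by auto
  ultimately show ?case by blast
qed

lemma pol_sequence_dependent:
  assumes "finite S" "\<And>k::nat. pol S d (g k)"
  shows "\<exists>K c. (\<exists>k\<le>K. c k \<noteq> 0) \<and> (\<forall>y. (\<Sum>k\<le>K. c k * g k y) = 0)"
proof -
  obtain B where B: "finite B" "\<And>p. pol S d p \<Longrightarrow> p \<in> fun_vs.span B"
    using pol_finite_span[OF assms(1)] by blast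
  let ?N = "card B"
  show ?thesis
  proof (cases "inj_on g {..?N}")
    case True
    have "fun_vs.dependent (g ` {..?N})"
    proof (rule ccontr)
      assume "\<not> ?thesis"
      moreover have "g ` {..?N} \<subseteq> fun_vs.span B" using B(2) assms(2) by auto
      ultimately have "card (g ` {..?N}) \<le> card B"
        using fun_vs.independent_span_bound[OF B(1)] by blast
      with True show False by (simp add: card_image)
    qed
    then obtain u where u: "\<exists>v\<in>g ` {..?N}. u v \<noteq> 0"
      "(\<Sum>v\<in>g ` {..?N}. (\<lambda>y. u v * v y)) = 0"
      by (subst (asm) fun_vs.dependent_finite) auto
    have "(\<Sum>k\<le>?N. u (g k) * g k y) = 0" for y
    proof -
      have "(\<Sum>k\<le>?N. (\<lambda>y. u (g k) * g k y)) = 0"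
        using u(2) True by (simp add: sum.reindex)
      moreover have "(\<Sum>k\<in>A. h k) y = (\<Sum>k\<in>A. h k y)" for A and h :: "nat \<Rightarrow> _ \<Rightarrow> complex"
        by (induction A rule: infinite_finite_induct) auto
      ultimately show ?thesis by (metis (no_types, lifting) sum.cong zero_fun_apply)
    qed
    with u(1) show ?thesis by (intro exI[of _ ?N] exI[of _ "\<lambda>k. u (g k)"]) auto
  next
    \<comment> \<open>Dependence concerns sets, so a repetition among the \<open>g k\<close> is a
      case of its own: it gives the relation with coefficients 1 and -1.\<close>
    case False
    then obtain i j where ij: "i \<le> ?N" "j \<le> ?N" "i \<noteq> j" "g i = g j" by (auto simp: inj_on_def)
    let ?c = "\<lambda>k. (if k = i then 1 else 0) - (if k = j then 1 else 0) :: complex"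
    have "(\<Sum>k\<le>?N. ?c k * g k y) = 0" for y
    proof -
      have "(\<Sum>k\<le>?N. ?c k * g k y) =
          (\<Sum>k\<le>?N. (if k = i then g i y else 0) - (if k = j then g i y else 0))"
        using ij by (intro sum.cong) auto
      then show ?thesis using ij by (simp add: sum_subtractf)
    qed
    moreover have "\<exists>k\<le>?N. ?c k \<noteq> 0" using ij by (intro exI[of _ i]) simp
    ultimately have "(\<exists>k\<le>?N. ?c k \<noteq> 0) \<and> (\<forall>y. (\<Sum>k\<le>?N. ?c k * g k y) = 0)" by simp
    then show ?thesis by (rule exI[where x = ?N, OF exI[where x = ?c]])
  qed
qed

text \<open>Write T for \<open>qlap m\<close>. If \<open>c 0\<close> is nonzero, solving the
  relation for \<open>f\<close> exhibits it as a value of T. Otherwise the relation is T applied to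
  a shorter one, injectivity cancels T, and some coefficient of the shorter relation is still
  nonzero.\<close>

lemma qlap_image_if_dependent:
  assumes "d \<ge> 1"
  shows "inv_poly m d f \<Longrightarrow> (\<forall>y. (\<Sum>k\<le>K. c k * (qlap m ^^ k) f y) = 0) \<Longrightarrow> \<exists>k\<le>K. c k \<noteq> 0 \<Longrightarrow>
    \<exists>f'. inv_poly m d f' \<and> f = qlap m f'"
proof (induction K arbitrary: c)
  case 0
  then have "f = (\<lambda>_. 0)" by auto
  then show ?case using inv_poly_zero qlap_zero by metis
next
  case (Suc K)
  have pow: "inv_poly m d ((qlap m ^^ k) f)" for k
    by (induction k) (auto intro: inv_poly_qlap Suc.prems(1))
  define h where "h = (\<lambda>y. \<Sum>k\<le>K. c (Suc k) * (qlap m ^^ k) f y)"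
  have h: "inv_poly m d h" unfolding h_def by (intro inv_poly_sum inv_poly_cmult pow)
  have Th: "qlap m h = (\<lambda>y. \<Sum>k\<le>K. c (Suc k) * (qlap m ^^ Suc k) f y)"
    unfolding h_def by (subst qlap_sum[of _ m d]) (auto intro: inv_poly_cmult pow simp: qlap_cmult[OF pow])
  have eq: "c 0 * f y + qlap m h y = 0" for y
    using Suc.prems(2) unfolding Th by (subst (asm) sum.atMost_Suc_shift) simp
  show ?case
  proof (cases "c 0 = 0")
    case True
    with eq have "qlap m h = (\<lambda>_. 0)" by auto
    then have "h = (\<lambda>_. 0)" by (rule qlap_injective[OF h assms])
    moreover have "\<exists>k\<le>K. c (Suc k) \<noteq> 0"
      using Suc.prems(3) True by (metis Suc_le_mono not0_implies_Suc)
    ultimately show ?thesis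
      using Suc.IH[OF Suc.prems(1), of "\<lambda>k. c (Suc k)"] by (simp add: h_def fun_eq_iff)
  next
    case False
    have "f y = - 1 / c 0 * qlap m h y" for y
      using eq[of y] False by (simp add: field_simps eq_neg_iff_add_eq_0)
    then have "f = qlap m (\<lambda>y. - 1 / c 0 * h y)" unfolding qlap_cmult[OF h] by auto
    with inv_poly_cmult[OF h] show ?thesis by blast
  qed
qed

text \<open>The coefficients \<open>u a b\<close> are \<open>lap a b f'\<close> for a preimage
  \<open>f'\<close> of \<open>f\<close>, hence invariant themselves. As \<open>d - 2\<close>
  truncates, degree one is separated off: its only invariant is zero.\<close>

theorem inv_poly_decompose:
  assumes "inv_poly m d f" "d \<ge> 1"
  obtains u where "\<And>a b. inv_poly m (d - 2) (u a b)" "f = (\<lambda>y. \<Sum>a<m. \<Sum>b<m. qform a b y * u a b y)"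
    "d < 2 \<Longrightarrow> f = (\<lambda>_. 0)"
proof -
  have pow: "inv_poly m d ((qlap m ^^ k) f)" for k
    by (induction k) (auto intro: inv_poly_qlap assms(1))
  then have "pol (UNIV \<times> {..<m}) d ((qlap m ^^ k) f)" for k by (simp add: inv_poly_def)
  from pol_sequence_dependent[of _ d "\<lambda>k. (qlap m ^^ k) f", OF _ this] obtain K c
    where "\<exists>k\<le>K. c k \<noteq> 0" "\<forall>y. (\<Sum>k\<le>K. c k * (qlap m ^^ k) f y) = 0"
    by (auto simp del: funpow.simps)
  with qlap_image_if_dependent[OF assms(2,1)] obtain f' where f': "inv_poly m d f'" "f = qlap m f'"
    by blast
  have "pol (UNIV \<times> {..<m}) d f'" "homog d f'" using f' by (auto simp: inv_poly_def)
  from homog_lap(2)[OF this] have "f = (\<lambda>_. 0)" if "d < 2"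
    using that by (simp add: f'(2) qlap_eq)
  with that[of "\<lambda>a b. lap a b f'"] inv_poly_lap[OF f'(1)] f'(2) show ?thesis
    by (auto simp: qlap_eq)
qed

section \<open>The Fock space\<close>

context vertex_algebra
begin

lemma nprod_left_simps:
  "nprod V (a + a') k b = nprod V a k b + nprod V a' k b"
  "nprod V (a - a') k b = nprod V a k b - nprod V a' k b"
  "nprod V (scl V c a) k b = scl V c (nprod V a k b)"
  "nprod V 0 k b = 0"
  "nprod V (\<Sum>i\<in>A. f i) k b = (\<Sum>i\<in>A. nprod V (f i) k b)"
proof -
  interpret L: Vector_Spaces.linear "scl V" "scl V" "\<lambda>a. nprod V a k b" by (rule nprod_linear_left)
  show "nprod V (a + a') k b = nprod V a k b + nprod V a' k b" by (rule L.add)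
  show "nprod V (a - a') k b = nprod V a k b - nprod V a' k b" by (rule L.diff)
  show "nprod V (scl V c a) k b = scl V c (nprod V a k b)" by (rule L.scale)
  show "nprod V 0 k b = 0" by (rule L.zero)
  show "nprod V (\<Sum>i\<in>A. f i) k b = (\<Sum>i\<in>A. nprod V (f i) k b)" by (rule L.sum)
qed

lemma nprod_right_simps:
  "nprod V b k (a + a') = nprod V b k a + nprod V b k a'"
  "nprod V b k (a - a') = nprod V b k a - nprod V b k a'"
  "nprod V b k (scl V c a) = scl V c (nprod V b k a)"
  "nprod V b k 0 = 0"
  "nprod V b k (\<Sum>i\<in>A. f i) = (\<Sum>i\<in>A. nprod V b k (f i))"
proof -
  interpret L: Vector_Spaces.linear "scl V" "scl V" "\<lambda>a. nprod V b k a" by (rule nprod_linear_right)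
  show "nprod V b k (a + a') = nprod V b k a + nprod V b k a'" by (rule L.add)
  show "nprod V b k (a - a') = nprod V b k a - nprod V b k a'" by (rule L.diff)
  show "nprod V b k (scl V c a) = scl V c (nprod V b k a)" by (rule L.scale)
  show "nprod V b k 0 = 0" by (rule L.zero)
  show "nprod V b k (\<Sum>i\<in>A. f i) = (\<Sum>i\<in>A. nprod V b k (f i))" by (rule L.sum)
qed

lemmas nprod_simps = nprod_left_simps nprod_right_simps

section \<open>Special cases of the Borcherds identity\<close>

definition assoc_term :: "'v \<Rightarrow> int \<Rightarrow> 'v \<Rightarrow> int \<Rightarrow> 'v \<Rightarrow> nat \<Rightarrow> 'v" where
  "assoc_term a n b k c j = scl V ((-1) ^ j * (of_int n gchoose j))
     (nprod V a (n - int j) (nprod V b (k + int j) c)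
      - scl V ((-1) powi n) (nprod V b (n + k - int j) (nprod V a (int j) c)))"

text \<open>The Borcherds identity with \<open>m = 0\<close>, where \<open>0 gchoose j\<close>
  leaves a single term on the left. With \<open>n = 0\<close> the same effect on the right gives
  \<open>nprod_commutator\<close>.\<close>

lemma nprod_assoc: "nprod V (nprod V a n b) k c = Sum_any (assoc_term a n b k c)"
proof -
  have "Sum_any (\<lambda>j::nat. scl V (of_int 0 gchoose j)
          (nprod V (nprod V a (n + int j) b) (0 + k - int j) c)) = nprod V (nprod V a n b) k c"
  proof (subst Sum_any.expand_superset[of "{0}"])
    show "{j. scl V (of_int 0 gchoose j) (nprod V (nprod V a (n + int j) b) (0 + k - int j) c) \<noteq> 0} \<subseteq> {0}"
    proof
      fix j assume "j \<in> {j. scl V (of_int 0 gchoose j) (nprod V (nprod V a (n + int j) b) (0 + k - int j) c) \<noteq> 0}"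
      then show "j \<in> {0}" by (cases j) auto
    qed
  qed auto
  with borcherds[of 0 a n b k c] show ?thesis by (simp add: assoc_term_def[abs_def])
qed

lemma assoc_term_bound: "\<exists>N. \<forall>j\<ge>N. assoc_term a n b k c j = 0"
proof -
  obtain N1 N2 where N: "\<And>i. i \<ge> N1 \<Longrightarrow> nprod V b i c = 0" "\<And>i. i \<ge> N2 \<Longrightarrow> nprod V a i c = 0"
    using truncation by metis
  show ?thesis
    by (rule exI[of _ "nat (\<bar>N1\<bar> + \<bar>N2\<bar> + \<bar>k\<bar>)"]) (auto simp: assoc_term_def N nprod_simps)
qed

lemma nprod_assoc_sum:
  assumes "\<And>j. j \<ge> N \<Longrightarrow> assoc_term a n b k c j = 0"
  shows "nprod V (nprod V a n b) k c = (\<Sum>j<N. assoc_term a n b k c j)"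
proof -
  have "{j. assoc_term a n b k c j \<noteq> 0} \<subseteq> {..<N}" using assms by (auto simp: not_le[symmetric])
  then show ?thesis unfolding nprod_assoc by (subst Sum_any.expand_superset) auto
qed

lemma nprod_commutator:
  "nprod V a m (nprod V b k c) - nprod V b k (nprod V a m c) =
    Sum_any (\<lambda>j::nat. scl V (of_int m gchoose j) (nprod V (nprod V a (int j) b) (m + k - int j) c))"
proof -
  let ?f = "\<lambda>j::nat. scl V ((-1) ^ j * (of_int 0 gchoose j))
          (nprod V a (m + 0 - int j) (nprod V b (k + int j) c)
           - scl V ((-1) powi 0) (nprod V b (0 + k - int j) (nprod V a (m + int j) c)))"
  have "Sum_any ?f = ?f 0"
  proof (subst Sum_any.expand_superset[of "{0}"])
    show "{j. ?f j \<noteq> 0} \<subseteq> {0}"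
    proof
      fix j assume "j \<in> {j. ?f j \<noteq> 0}"
      then show "j \<in> {0}" by (cases j) auto
    qed
  qed auto
  with borcherds[of m a 0 b k c] show ?thesis by simp
qed

lemma subspace_Sum_any: "subspace U \<Longrightarrow> (\<And>j. f j \<in> U) \<Longrightarrow> Sum_any f \<in> U"
  unfolding Sum_any.expand_set by (rule subspace_sum)

lemma minus_one_power_gchoose_minus_two: "(-1) ^ j * (of_int (-2) gchoose j) = (of_nat (Suc j) :: complex)"
proof -
  have "(2 + of_nat j - 1 :: complex) = of_nat (Suc j)" by simp
  then have "(of_int (-2) gchoose j) = (-1) ^ j * (of_nat (Suc j choose j) :: complex)"
    using gbinomial_minus[of "2 :: complex" j] by (simp only: binomial_gbinomial) simp
  then show ?thesis by (simp add: power_mult_distrib[symmetric])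
qed

text \<open>In the formula for iterated products with the vacuum in the middle, only its product of
  index -1 survives. For \<open>k < 0\<close> this selects \<open>j = -1 - k\<close> in the first
  part, for \<open>k > 0\<close> it selects \<open>j = k - 1\<close> in the second, and for
  \<open>k = 0\<close> nothing is left.\<close>

lemma nprod_va_deriv: "nprod V (va_deriv V a) k c = scl V (- of_int k) (nprod V a (k - 1) c)"
proof -
  have trm: "assoc_term a (-2) (vac V) k c j = scl V (of_nat (Suc j))
     ((if k + int j = -1 then nprod V a (-2 - int j) c else 0)
       - (if -2 + k - int j = -1 then nprod V a (int j) c else 0))" for j
    unfolding assoc_term_def minus_one_power_gchoose_minus_two by (simp add: vac_left nprod_simps)
  show ?thesis
  proof (cases "k < 0")
    case True
    define j0 where "j0 = nat (-1 - k)"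
    have j0: "int j0 = -1 - k" using True by (simp add: j0_def)
    have "Sum_any (assoc_term a (-2) (vac V) k c) = (\<Sum>j\<in>{j0}. assoc_term a (-2) (vac V) k c j)"
      by (rule Sum_any.expand_superset) (use True j0 in \<open>auto simp: trm split: if_splits\<close>)
    also have "\<dots> = scl V (of_nat (Suc j0)) (nprod V a (-2 - int j0) c)"
      using True j0 by (auto simp: trm simp del: of_nat_Suc)
    also have "of_nat (Suc j0) = (of_int (- k) :: complex)"
    proof -
      have "int (Suc j0) = - k" using j0 by simp
      then show ?thesis by (metis of_int_of_nat_eq)
    qed
    also have "-2 - int j0 = k - 1" using j0 by simp
    finally show ?thesis by (simp only: va_deriv_def nprod_assoc of_int_minus)
  next
    case False
    show ?thesis
    proof (cases "k = 0")
      case True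
      have "Sum_any (assoc_term a (-2) (vac V) k c) = (\<Sum>j\<in>{}. assoc_term a (-2) (vac V) k c j)"
        by (rule Sum_any.expand_superset) (use True in \<open>auto simp: trm[unfolded True]\<close>)
      then show ?thesis using True by (simp add: va_deriv_def nprod_assoc)
    next
      case nz: False
      define j0 where "j0 = nat (k - 1)"
      have j0: "int j0 = k - 1" using False nz by (simp add: j0_def)
      have "Sum_any (assoc_term a (-2) (vac V) k c) = (\<Sum>j\<in>{j0}. assoc_term a (-2) (vac V) k c j)"
        by (rule Sum_any.expand_superset) (use False nz j0 in \<open>auto simp: trm split: if_splits\<close>)
      also have "\<dots> = scl V (- of_nat (Suc j0)) (nprod V a (int j0) c)"
        using False nz j0 by (auto simp: trm simp del: of_nat_Suc)
      also have "of_nat (Suc j0) = (of_int k :: complex)"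
      proof -
        have "int (Suc j0) = k" using j0 by simp
        then show ?thesis by (metis of_int_of_nat_eq)
      qed
      finally show ?thesis by (simp only: va_deriv_def nprod_assoc j0)
    qed
  qed
qed

text \<open>Up to the sign (-1)^b this is the falling factorial k (k-1) ... (k-b+1). At
  \<open>k = -1\<close> it is \<open>b!\<close>, and it vanishes for
  \<open>0 \<le> k < b\<close>.\<close>

fun deriv_coeff :: "nat \<Rightarrow> int \<Rightarrow> int" where
  "deriv_coeff 0 k = 1"
| "deriv_coeff (Suc b) k = - k * deriv_coeff b (k - 1)"

lemma nprod_va_deriv_pow:
  "nprod V ((va_deriv V ^^ b) a) k c = scl V (of_int (deriv_coeff b k)) (nprod V a (k - int b) c)"
  by (induction b arbitrary: k) (auto simp: nprod_va_deriv algebra_simps)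

lemma deriv_coeff_eq_0: "0 \<le> k \<Longrightarrow> k < int b \<Longrightarrow> deriv_coeff b k = 0"
proof (induction b arbitrary: k)
  case (Suc b)
  then show ?case by (cases "k = 0") auto
qed simp

lemma deriv_coeff_pos: "k < 0 \<Longrightarrow> deriv_coeff b k > 0"
  by (induction b arbitrary: k) (auto simp: mult_neg_pos)

lemma va_deriv_vac: "va_deriv V (vac V) = 0"
  by (simp add: va_deriv_def vac_left)

lemma va_deriv_nprod:
  "va_deriv V (nprod V a n b) = nprod V a n (va_deriv V b) - scl V (of_int n) (nprod V a (n - 1) b)"
proof -
  have "assoc_term a n b (-2) (vac V) j = 0" if "j \<ge> 2" for j
    using that by (simp add: assoc_term_def vac_right_nonneg nprod_simps)
  from nprod_assoc_sum[OF this]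
  have "va_deriv V (nprod V a n b) = (\<Sum>j<2. assoc_term a n b (-2) (vac V) j)"
    by (simp add: va_deriv_def)
  also have "\<dots> = assoc_term a n b (-2) (vac V) 0 + assoc_term a n b (-2) (vac V) 1"
    by (simp add: numeral_2_eq_2)
  also have "\<dots> = nprod V a n (va_deriv V b) - scl V (of_int n) (nprod V a (n - 1) b)"
    by (simp add: assoc_term_def va_deriv_def vac_right_nonneg vac_right nprod_simps)
  finally show ?thesis .
qed

lemma va_deriv_sum: "va_deriv V (\<Sum>i\<in>A. f i) = (\<Sum>i\<in>A. va_deriv V (f i))"
  by (simp add: va_deriv_def nprod_simps)

section \<open>Generated subalgebras\<close>

lemma subspace_va_generated: "subspace (va_generated V S)"
  by (simp add: va_generated_def subspace_span)

lemma va_generated_base: "s \<in> S \<Longrightarrow> s \<in> va_generated V S"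
  by (simp add: va_generated_def span_base va_words.gen)

lemma va_generated_vac: "vac V \<in> va_generated V S"
  by (simp add: va_generated_def span_base va_words.vac)

lemma va_generated_nprod:
  assumes "a \<in> va_generated V S" "b \<in> va_generated V S"
  shows "nprod V a k b \<in> va_generated V S"
proof -
  have word: "nprod V a k b \<in> span (va_words V S)"
    if "a \<in> va_words V S" "b \<in> span (va_words V S)" for a b
    using that(2)
  proof (induction rule: span_induct)
    case base
    show ?case
      by (rule subspaceI) (auto simp: nprod_simps intro: span_zero span_add span_scale)
  next
    case (step b)
    with that(1) show ?case by (intro span_base va_words.nprod)
  qed
  show ?thesis
    using assms(1) unfolding va_generated_def
  proof (induction rule: span_induct)
    case base
    show ?case
      by (rule subspaceI) (auto simp: nprod_simps intro: span_zero span_add span_scale)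
  next
    case (step a)
    with assms(2) show ?case by (intro word) (simp_all add: va_generated_def)
  qed
qed

lemma va_generated_deriv: "a \<in> va_generated V S \<Longrightarrow> va_deriv V a \<in> va_generated V S"
  by (simp add: va_deriv_def va_generated_nprod va_generated_vac)

lemma va_generated_subset:
  assumes "subspace U" "vac V \<in> U" "S \<subseteq> U" "\<And>a k b. a \<in> U \<Longrightarrow> b \<in> U \<Longrightarrow> nprod V a k b \<in> U"
  shows "va_generated V S \<subseteq> U"
proof -
  have "w \<in> U" if "w \<in> va_words V S" for w
    using that by induction (use assms in auto)
  then show ?thesis unfolding va_generated_def by (intro span_minimal assms(1)) auto
qed

end

text \<open>Neither direction of the correspondence is known to be single valued at first: a
  polynomial has many presentations, and vectors of an abstract \<open>V\<close> have no normal
  form. Building both sides by the same steps avoids a choice. \<open>S\<close> and \<open>d\<close>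
  are recorded because uniqueness is proved by induction on \<open>d\<close>, with finitely many
  modes in the number operator.\<close>

inductive fock_rel :: "'v::ab_group_add va_data \<Rightarrow> ('n::finite \<Rightarrow> 'v) \<Rightarrow> ('n \<times> nat) set \<Rightarrow> nat \<Rightarrow> 'v
    \<Rightarrow> (('n \<times> nat \<Rightarrow> complex) \<Rightarrow> complex) \<Rightarrow> bool" for V \<alpha> S where
  fock_rel_vac: "fock_rel V \<alpha> S d (scl V c (vac V)) (\<lambda>_. c)"
| fock_rel_mode: "(i, k) \<in> S \<Longrightarrow> fock_rel V \<alpha> S d v p \<Longrightarrow>
    fock_rel V \<alpha> S (Suc d) (nprod V (\<alpha> i) (- int k - 1) v) (\<lambda>y. y (i, k) * p y)"
| fock_rel_add: "fock_rel V \<alpha> S d v p \<Longrightarrow> fock_rel V \<alpha> S d w q \<Longrightarrow> fock_rel V \<alpha> S d (v + w) (\<lambda>y. p y + q y)"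

lemma fock_rel_pol: "fock_rel V \<alpha> S d v p \<Longrightarrow> pol S d p"
  by (induction rule: fock_rel.induct) (auto intro: pol.intros)

lemma fock_rel_mono: "fock_rel V \<alpha> S d v p \<Longrightarrow> S \<subseteq> S' \<Longrightarrow> d \<le> d' \<Longrightarrow> fock_rel V \<alpha> S' d' v p"
proof (induction arbitrary: d' rule: fock_rel.induct)
  case (fock_rel_mode i k d v p)
  then obtain e where "d' = Suc e" "d \<le> e" by (cases d') auto
  with fock_rel_mode show ?case by (auto intro!: fock_rel.fock_rel_mode)
qed (auto intro: fock_rel.intros)

lemma fock_rel_finite: "fock_rel V \<alpha> S d v p \<Longrightarrow> \<exists>S'. finite S' \<and> S' \<subseteq> S \<and> fock_rel V \<alpha> S' d v p"
proof (induction rule: fock_rel.induct)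
  case (fock_rel_vac d c)
  show ?case by (intro exI[of _ "{}"]) (auto intro: fock_rel.fock_rel_vac)
next
  case (fock_rel_mode i k d v p)
  then obtain S' where "finite S'" "S' \<subseteq> S" "fock_rel V \<alpha> S' d v p" by blast
  with \<open>(i, k) \<in> S\<close> show ?case
    by (intro exI[of _ "insert (i, k) S'"]) (auto intro!: fock_rel.fock_rel_mode intro: fock_rel_mono)
next
  case (fock_rel_add d v p w q)
  then obtain S1 S2 where "finite S1" "S1 \<subseteq> S" "fock_rel V \<alpha> S1 d v p"
    "finite S2" "S2 \<subseteq> S" "fock_rel V \<alpha> S2 d w q"
    by blast
  then show ?case
    by (intro exI[of _ "S1 \<union> S2"]) (auto intro!: fock_rel.fock_rel_add intro: fock_rel_mono)
qed

lemma fock_rel_degree_0: "fock_rel V \<alpha> S d v p \<Longrightarrow> d = 0 \<Longrightarrow> vector_space (scl V) \<Longrightarrow> v = scl V (p (\<lambda>_. 0)) (vac V)"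
  by (induction rule: fock_rel.induct) (auto simp: vector_space.vector_space_assms(2))

context heisenberg
begin

abbreviation mode :: "'n \<Rightarrow> int \<Rightarrow> 'v \<Rightarrow> 'v" where
  "mode i k v \<equiv> nprod V (\<alpha> i) k v"

abbreviation rel :: "('n \<times> nat) set \<Rightarrow> nat \<Rightarrow> 'v \<Rightarrow> (('n \<times> nat \<Rightarrow> complex) \<Rightarrow> complex) \<Rightarrow> bool" where
  "rel \<equiv> fock_rel V \<alpha>"

text \<open>Among the products of generators with nonnegative index only index 1 is nonzero, so the
  commutator formula reduces to the term with binomial coefficient \<open>p\<close>.\<close>

lemma mode_commute:
  "mode i p (mode j q v) = mode j q (mode i p v) + scl V (if i = j \<and> p + q = 0 then of_int p else 0) v"
proof -
  let ?f = "\<lambda>l::nat. scl V (of_int p gchoose l) (nprod V (nprod V (\<alpha> i) (int l) (\<alpha> j)) (p + q - int l) v)"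
  have "{l. ?f l \<noteq> 0} \<subseteq> {1}" by (auto simp: ope nprod_simps)
  then have "Sum_any ?f = (\<Sum>l\<in>{1}. ?f l)" by (rule Sum_any.expand_superset[rotated]) simp
  also have "\<dots> = scl V (if i = j \<and> p + q = 0 then of_int p else 0) v"
    by (auto simp: ope vac_left nprod_simps)
  finally show ?thesis using nprod_commutator[of "\<alpha> i" p "\<alpha> j" q v] by (simp add: algebra_simps)
qed

lemma mode_vac: "k \<ge> 0 \<Longrightarrow> mode i k (vac V) = 0"
  by (rule vac_right_nonneg)

text \<open>The elements all of whose modes preserve \<open>U\<close> include the generators and, by
  the formula for iterated products, are closed under products. Hence they are all of
  \<open>V\<close>, and each \<open>v\<close> is recovered by applying its mode of index -1 to the
  vacuum.\<close>

lemma mode_invariant_subspace: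
  assumes "subspace U" "vac V \<in> U" "\<And>i k v. v \<in> U \<Longrightarrow> mode i k v \<in> U"
  shows "v \<in> U"
proof -
  let ?S = "{a. \<forall>k. \<forall>c\<in>U. nprod V a k c \<in> U}"
  have "va_generated V (range \<alpha>) \<subseteq> ?S"
  proof (rule va_generated_subset)
    show "subspace ?S"
      by (rule subspaceI) (use assms(1) in \<open>auto simp: nprod_simps intro: subspace_0 subspace_add subspace_scale\<close>)
    show "vac V \<in> ?S" using assms(1) by (auto simp: vac_left intro: subspace_0)
    show "range \<alpha> \<subseteq> ?S" using assms(3) by auto
    fix a n b assume "a \<in> ?S" "b \<in> ?S"
    then have "assoc_term a n b k c j \<in> U" if "c \<in> U" for k c j
      using that assms(1) by (auto simp: assoc_term_def intro!: subspace_scale subspace_diff)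
    then show "nprod V a n b \<in> ?S"
      using assms(1) by (auto simp: nprod_assoc intro!: subspace_Sum_any)
  qed
  then have "v \<in> ?S" using generated by auto
  with assms(2) have "nprod V v (-1) (vac V) \<in> U" by auto
  then show ?thesis by (simp add: vac_right)
qed

text \<open>The zero modes commute with all modes of generators and kill the vacuum.\<close>

lemma mode_zero: "mode i 0 v = 0"
proof -
  have "v \<in> {v. mode i 0 v = 0}"
  proof (rule mode_invariant_subspace)
    show "subspace {v. mode i 0 v = 0}" by (rule subspaceI) (auto simp: nprod_simps)
  qed (auto simp: mode_vac mode_commute[of i 0] nprod_simps)
  then show ?thesis by simp
qed

lemma rel_scale: "rel S d v p \<Longrightarrow> rel S d (scl V c v) (\<lambda>y. c * p y)"
proof (induction rule: fock_rel.induct)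
  case (fock_rel_vac d c')
  then show ?case using fock_rel.fock_rel_vac[of V \<alpha> S d "c * c'"] by simp
next
  case (fock_rel_mode i k d v p)
  from fock_rel.fock_rel_mode[OF this(1,3)] show ?case by (simp add: nprod_simps mult_ac)
next
  case (fock_rel_add d v p w q)
  from fock_rel.fock_rel_add[OF this(3,4)] show ?case by (simp add: scale_right_distrib distrib_left)
qed

lemma rel_zero_zero: "rel S d 0 (\<lambda>_. 0)"
  using fock_rel_vac[of V \<alpha> S d 0] by simp

lemma rel_exists: "pol S d p \<Longrightarrow> \<exists>v. rel S d v p"
proof (induction rule: pol.induct)
  case (pol_var s d p)
  then show ?case by (cases s) (auto intro: fock_rel.fock_rel_mode)
qed (auto intro: fock_rel.intros)

text \<open>Moving the annihilator past a creation mode produces the product rule;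
  \<open>k + 1\<close> is the commutator of the matching modes. The clause for \<open>d = 0\<close>
  again compensates for truncated subtraction.\<close>

lemma rel_annihilate:
  "rel S d v p \<Longrightarrow> (d = 0 \<longrightarrow> mode i (int k + 1) v = 0) \<and>
     rel S (d - 1) (mode i (int k + 1) v) (\<lambda>y. (of_nat k + 1) * pd (i, k) p y)"
proof (induction rule: fock_rel.induct)
  case (fock_rel_vac d c)
  then show ?case by (simp add: nprod_simps mode_vac rel_zero_zero)
next
  case (fock_rel_mode j l d v p)
  note p = fock_rel_pol[OF fock_rel_mode(2)]
  let ?c = "if i = j \<and> k = l then of_nat k + 1 else 0 :: complex"
  have eq1: "mode i (int k + 1) (mode j (- int l - 1) v) =
      mode j (- int l - 1) (mode i (int k + 1) v) + scl V ?c v"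
    by (subst mode_commute) auto
  have eq2: "(\<lambda>y. (of_nat k + 1) * pd (i, k) (\<lambda>y. y (j, l) * p y) y) =
      (\<lambda>y. y (j, l) * ((of_nat k + 1) * pd (i, k) p y) + ?c * p y)"
    unfolding pd_var[OF p] by (auto simp: fun_eq_iff algebra_simps)
  have "rel S d (mode j (- int l - 1) (mode i (int k + 1) v)) (\<lambda>y. y (j, l) * ((of_nat k + 1) * pd (i, k) p y))"
  proof (cases d)
    case 0
    then have "pd (i, k) p = (\<lambda>_. 0)" using p by (simp add: pd_degree_0)
    with 0 fock_rel_mode show ?thesis by (simp add: nprod_simps rel_zero_zero)
  next
    case (Suc e)
    with fock_rel_mode show ?thesis using fock_rel.fock_rel_mode[of j l S V \<alpha> e] by simp
  qed
  then show ?case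
    unfolding eq1 eq2 using rel_scale[OF fock_rel_mode(2), of ?c] by (auto intro: fock_rel.fock_rel_add)
next
  case (fock_rel_add d v p w q)
  note p = fock_rel_pol[OF fock_rel_add(1)] fock_rel_pol[OF fock_rel_add(2)]
  show ?case
    using fock_rel_add fock_rel.fock_rel_add[of V \<alpha> S "d - 1"]
    by (simp add: pd_add[OF p] nprod_simps distrib_left)
qed

text \<open>The counterpart of the Euler operator: applying a creation mode with index in a finite
  \<open>S\<close> raises its eigenvalue by one.\<close>

definition number_op :: "('n \<times> nat) set \<Rightarrow> 'v \<Rightarrow> 'v" where
  "number_op S v = (\<Sum>s\<in>S. scl V (1 / (of_nat (snd s) + 1))
     (mode (fst s) (- int (snd s) - 1) (mode (fst s) (int (snd s) + 1) v)))"

lemma number_op_simps: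
  "number_op S (v + w) = number_op S v + number_op S w"
  "number_op S (scl V c v) = scl V c (number_op S v)"
  "number_op S 0 = 0"
  "number_op S (vac V) = 0"
  by (simp_all add: number_op_def nprod_simps scale_right_distrib sum.distrib scale_sum_right
      scale_left_commute mode_vac)

lemma number_op_mode:
  assumes "finite S" "(i, k) \<in> S"
  shows "number_op S (mode i (- int k - 1) v) =
    mode i (- int k - 1) (number_op S v) + mode i (- int k - 1) v"
proof -
  let ?w = "mode i (- int k - 1)"
  have eq: "mode j (- int l - 1) (mode j (int l + 1) (?w v)) =
    ?w (mode j (- int l - 1) (mode j (int l + 1) v)) +
    (if (j, l) = (i, k) then scl V (of_nat k + 1) (?w v) else 0)" for j l
  proof -
    have "mode j (int l + 1) (?w v) = ?w (mode j (int l + 1) v) +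
        scl V (if (j, l) = (i, k) then of_nat k + 1 else 0) v"
      by (subst mode_commute) auto
    moreover have "mode j (- int l - 1) (?w u) = ?w (mode j (- int l - 1) u)" for u
      by (subst mode_commute) auto
    ultimately show ?thesis by (auto simp: nprod_simps)
  qed
  have "number_op S (?w v) = (\<Sum>s\<in>S. ?w (scl V (1 / (of_nat (snd s) + 1))
     (mode (fst s) (- int (snd s) - 1) (mode (fst s) (int (snd s) + 1) v)))
     + (if s = (i, k) then ?w v else 0))"
    unfolding number_op_def
  proof (rule sum.cong[OF refl])
    fix s :: "'n \<times> nat"
    obtain j l where s: "s = (j, l)" by (cases s)
    have "1 / (of_nat k + 1) * (of_nat k + 1) = (1 :: complex)"
      using of_nat_neq_0[of k, where 'a = complex] by (simp add: add.commute)
    then show "scl V (1 / (of_nat (snd s) + 1)) (mode (fst s) (- int (snd s) - 1) (mode (fst s) (int (snd s) + 1) (?w v)))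
      = ?w (scl V (1 / (of_nat (snd s) + 1)) (mode (fst s) (- int (snd s) - 1) (mode (fst s) (int (snd s) + 1) v)))
       + (if s = (i, k) then ?w v else 0)"
      by (simp add: s eq nprod_simps scale_right_distrib)
  qed
  then show ?thesis using assms by (simp add: sum.distrib number_op_def nprod_simps)
qed

text \<open>A creation mode adds one to the number operator and one to the degree bound, so the
  difference of the two passes through the mode. What remains has a bound lower by one, which drives
  the induction in \<open>rel_zero_right\<close>.\<close>

lemma rel_number_op:
  assumes "finite S"
  shows "rel S d v p \<Longrightarrow> (d = 0 \<longrightarrow> number_op S v = 0) \<and>
    rel S (d - 1) (number_op S v - scl V (of_nat d) v) (\<lambda>y. (\<Sum>s\<in>S. y s * pd s p y) - of_nat d * p y)"
proof (induction rule: fock_rel.induct)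
  case (fock_rel_vac d c)
  have "rel S (d - 1) (scl V (- of_nat d * c) (vac V)) (\<lambda>_. - of_nat d * c)" by (rule fock_rel.fock_rel_vac)
  then show ?case by (simp add: number_op_simps)
next
  case (fock_rel_mode i k d v p)
  note p = fock_rel_pol[OF fock_rel_mode(2)]
  let ?E = "\<lambda>y. \<Sum>s\<in>S. y s * pd s p y"
  have E: "(\<Sum>s\<in>S. y s * pd s (\<lambda>y. y (i, k) * p y) y) = y (i, k) * p y + y (i, k) * ?E y" for y
  proof -
    have "(\<Sum>s\<in>S. y s * pd s (\<lambda>y. y (i, k) * p y) y) =
        (\<Sum>s\<in>S. (if s = (i, k) then y (i, k) * p y else 0) + y (i, k) * (y s * pd s p y))"
      unfolding pd_var[OF p] by (intro sum.cong) (auto simp: algebra_simps)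
    then show ?thesis using assms fock_rel_mode(1) by (simp add: sum.distrib sum_distrib_left)
  qed
  have v: "number_op S (mode i (- int k - 1) v) - scl V (of_nat (Suc d)) (mode i (- int k - 1) v) =
     mode i (- int k - 1) (number_op S v - scl V (of_nat d) v)"
    by (simp add: number_op_mode[OF assms fock_rel_mode(1)] nprod_simps scale_left_distrib)
  have f: "(\<lambda>y. (\<Sum>s\<in>S. y s * pd s (\<lambda>y. y (i, k) * p y) y) - of_nat (Suc d) * (y (i, k) * p y)) =
     (\<lambda>y. y (i, k) * (?E y - of_nat d * p y))"
    unfolding E by (simp add: algebra_simps)
  have "rel S d (mode i (- int k - 1) (number_op S v - scl V (of_nat d) v)) (\<lambda>y. y (i, k) * (?E y - of_nat d * p y))"
  proof (cases d)
    case 0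
    then have "pd s p = (\<lambda>_. 0)" for s using p by (simp add: pd_degree_0)
    with 0 fock_rel_mode show ?thesis by (simp add: nprod_simps rel_zero_zero)
  next
    case (Suc e)
    have "rel S (Suc e) (mode i (- int k - 1) (number_op S v - scl V (of_nat d) v))
        (\<lambda>y. y (i, k) * (?E y - of_nat d * p y))"
      by (rule fock_rel.fock_rel_mode[OF fock_rel_mode(1)]) (use fock_rel_mode(3) Suc in simp)
    with Suc show ?thesis by simp
  qed
  then show ?case unfolding v f by simp
next
  case (fock_rel_add d v p w q)
  note p = fock_rel_pol[OF fock_rel_add(1)] fock_rel_pol[OF fock_rel_add(2)]
  have eq: "(\<lambda>y. (\<Sum>s\<in>S. y s * pd s (\<lambda>y. p y + q y) y) - of_nat d * (p y + q y)) =
    (\<lambda>y. ((\<Sum>s\<in>S. y s * pd s p y) - of_nat d * p y) + ((\<Sum>s\<in>S. y s * pd s q y) - of_nat d * q y))"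
    by (simp add: pd_add[OF p] distrib_left sum.distrib algebra_simps)
  have eq': "number_op S (v + w) - scl V (of_nat d) (v + w) =
     (number_op S v - scl V (of_nat d) v) + (number_op S w - scl V (of_nat d) w)"
    by (simp add: number_op_simps scale_right_distrib)
  show ?case
    unfolding eq eq' using fock_rel_add by (auto simp: number_op_simps intro: fock_rel.fock_rel_add)
qed

text \<open>By induction all annihilators kill \<open>v\<close>, hence so does the number operator, which acts on \<open>v\<close> as
  multiplication by the degree modulo lower degree.\<close>

lemma rel_zero_right: "rel S d v (\<lambda>_. 0) \<Longrightarrow> v = 0"
proof -
  assume "rel S d v (\<lambda>_. 0)"
  from fock_rel_finite[OF this] obtain S' where "finite S'" "rel S' d v (\<lambda>_. 0)" by auto
  then show ?thesis
  proof (induction d arbitrary: v)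
    case 0
    from fock_rel_degree_0[OF 0(2) refl vector_space_axioms] show ?case by simp
  next
    case (Suc d)
    have "mode i (int k + 1) v = 0" for i k
      using rel_annihilate[OF Suc.prems(2), of i k] by (intro Suc.IH[OF Suc.prems(1)]) simp
    then have "number_op S' v = 0" by (simp add: number_op_def nprod_simps)
    with rel_number_op[OF Suc.prems] have "rel S' d (- scl V (of_nat (Suc d)) v) (\<lambda>_. 0)" by simp
    then have "- scl V (of_nat (Suc d)) v = 0" by (rule Suc.IH[OF Suc.prems(1)])
    then show ?case by (simp del: of_nat_Suc)
  qed
qed

text \<open>Annihilators send 0 to 0, so all derivatives of \<open>p\<close> vanish by induction and
  \<open>p\<close> is constant. Subtracting the constant, \<open>rel_zero_right\<close> makes the
  corresponding multiple of the vacuum zero, and \<open>vac_nonzero\<close> concludes.\<close>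

lemma rel_zero_left: "rel S d 0 p \<Longrightarrow> p = (\<lambda>_. 0)"
proof (induction d arbitrary: p)
  case 0
  from fock_rel_degree_0[OF 0 refl vector_space_axioms] have "p (\<lambda>_. 0) = 0"
    using vac_nonzero by simp
  with pol_0_const[OF fock_rel_pol[OF 0]] show ?case by (metis (no_types))
next
  case (Suc d)
  have "pd s p = (\<lambda>_. 0)" for s
  proof -
    obtain i k where s: "s = (i, k)" by (cases s)
    have "(\<lambda>y. (of_nat k + 1) * pd (i, k) p y) = (\<lambda>_. 0)"
      using rel_annihilate[OF Suc.prems, of i k] by (intro Suc.IH) (simp add: nprod_simps)
    moreover have "(of_nat k + 1 :: complex) \<noteq> 0"
      using of_nat_neq_0[of k, where 'a = complex] by (simp add: add.commute)
    ultimately show ?thesis by (simp add: s fun_eq_iff)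
  qed
  then have "p y = p (\<lambda>_. 0)" for y by (rule pol_constI[OF fock_rel_pol[OF Suc.prems]])
  then have const: "p = (\<lambda>_. p (\<lambda>_. 0))" by auto
  have "rel S (Suc d) (scl V (- p (\<lambda>_. 0)) (vac V)) (\<lambda>_. - p (\<lambda>_. 0))" by (rule fock_rel_vac)
  from fock_rel_add[OF Suc.prems this] have "rel S (Suc d) (scl V (- p (\<lambda>_. 0)) (vac V)) (\<lambda>_. 0)"
    by (subst (asm) const) simp
  then have "scl V (- p (\<lambda>_. 0)) (vac V) = 0" by (rule rel_zero_right)
  with vac_nonzero const show ?case by simp
qed


section \<open>The isomorphism with polynomial functions\<close>

lemma rel_unique_right:
  assumes "rel UNIV d v p" "rel UNIV e v q"
  shows "p = q"
proof -
  have "rel UNIV (d + e) v p" "rel UNIV (d + e) (scl V (-1) v) (\<lambda>y. -1 * q y)"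
    using fock_rel_mono[OF assms(1), of UNIV "d + e"]
      rel_scale[OF fock_rel_mono[OF assms(2), of UNIV "d + e"], of "-1"] by simp_all
  from fock_rel_add[OF this] have "rel UNIV (d + e) 0 (\<lambda>y. p y - q y)" by simp
  from fun_cong[OF rel_zero_left[OF this]] show ?thesis by (intro ext) simp
qed

lemma rel_unique_left:
  assumes "rel UNIV d v p" "rel UNIV e w p"
  shows "v = w"
proof -
  have "rel UNIV (d + e) v p" "rel UNIV (d + e) (scl V (-1) w) (\<lambda>y. -1 * p y)"
    using fock_rel_mono[OF assms(1), of UNIV "d + e"]
      rel_scale[OF fock_rel_mono[OF assms(2), of UNIV "d + e"], of "-1"] by simp_all
  from fock_rel_add[OF this] have "rel UNIV (d + e) (v - w) (\<lambda>_. 0)" by simp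
  from rel_zero_right[OF this] show ?thesis by simp
qed

lemma mode_int_cases:
  obtains k where "n = - int k - 1" | "n = 0" | k where "n = int k + 1"
proof -
  consider "n < 0" | "n = 0" | "n > 0" by linarith
  then show ?thesis
  proof cases
    case 1
    then show ?thesis using that(1)[of "nat (- n - 1)"] by simp
  next
    case 3
    then show ?thesis using that(3)[of "nat (n - 1)"] by simp
  qed (rule that(2))
qed

lemma rel_mode:
  assumes "rel UNIV d v p"
  shows "\<exists>d' p'. rel UNIV d' (mode i n v) p'"
proof (cases n rule: mode_int_cases)
  case (1 k)
  then show ?thesis using fock_rel_mode[of i k UNIV V \<alpha> d v p] assms by auto
next
  case 2
  then show ?thesis using rel_zero_zero by (auto simp: mode_zero)
next
  case (3 k)
  then show ?thesis using rel_annihilate[OF assms] by auto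
qed

lemma rel_total: "\<exists>d p. rel UNIV d v p"
proof -
  have "v \<in> {v. \<exists>d p. rel UNIV d v p}"
  proof (rule mode_invariant_subspace)
    show "subspace {v. \<exists>d p. rel UNIV d v p}"
    proof (rule subspaceI)
      show "0 \<in> {v. \<exists>d p. rel UNIV d v p}" using rel_zero_zero by blast
    next
      fix v w assume "v \<in> {v. \<exists>d p. rel UNIV d v p}" "w \<in> {v. \<exists>d p. rel UNIV d v p}"
      then obtain d p e q where "rel UNIV d v p" "rel UNIV e w q" by auto
      then have "rel UNIV (d + e) v p" "rel UNIV (d + e) w q" by (auto intro: fock_rel_mono)
      from fock_rel_add[OF this] show "v + w \<in> {v. \<exists>d p. rel UNIV d v p}" by blast
    next
      fix c v assume "v \<in> {v. \<exists>d p. rel UNIV d v p}"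
      then show "scl V c v \<in> {v. \<exists>d p. rel UNIV d v p}" using rel_scale by blast
    qed
    show "vac V \<in> {v. \<exists>d p. rel UNIV d v p}" using fock_rel_vac[of V \<alpha> UNIV 0 1] by auto
  qed (use rel_mode in auto)
  then show ?thesis by simp
qed

definition fock :: "'v \<Rightarrow> ('n \<times> nat \<Rightarrow> complex) \<Rightarrow> complex" where
  "fock v = (THE p. \<exists>d. rel UNIV d v p)"

lemma rel_fock: "\<exists>d. rel UNIV d v (fock v)"
  unfolding fock_def
proof (rule theI'[of "\<lambda>p. \<exists>d. rel UNIV d v p"])
  show "\<exists>!p. \<exists>d. rel UNIV d v p" using rel_total[of v] rel_unique_right by (metis (no_types))
qed

lemma fock_eqI: "rel UNIV d v p \<Longrightarrow> fock v = p"
  using rel_fock rel_unique_right by (metis (no_types))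

lemma fock_pol: "\<exists>d. pol UNIV d (fock v)"
  using rel_fock[of v] fock_rel_pol by (metis (no_types))

lemma fock_inject: "fock v = fock w \<Longrightarrow> v = w"
  using rel_fock[of v] rel_fock[of w] rel_unique_left by (metis (no_types))

lemma fock_surj: "pol S d p \<Longrightarrow> \<exists>v. fock v = p"
  using rel_exists[of UNIV d p] pol_mono[of S d p UNIV d] fock_eqI by (metis (no_types) order_refl subset_UNIV)

lemma fock_add: "fock (v + w) = (\<lambda>y. fock v y + fock w y)"
proof -
  obtain d e where "rel UNIV d v (fock v)" "rel UNIV e w (fock w)" using rel_fock by metis
  then have "rel UNIV (d + e) v (fock v)" "rel UNIV (d + e) w (fock w)" by (auto intro: fock_rel_mono)
  then show ?thesis by (rule fock_eqI[OF fock_rel_add])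
qed

lemma fock_scale: "fock (scl V c v) = (\<lambda>y. c * fock v y)"
proof -
  obtain d where "rel UNIV d v (fock v)" using rel_fock by metis
  then show ?thesis by (rule fock_eqI[OF rel_scale])
qed

lemma fock_zero: "fock 0 = (\<lambda>_. 0)"
  by (rule fock_eqI[OF rel_zero_zero])

lemma fock_vacuum: "fock (vac V) = (\<lambda>_. 1)"
  using fock_eqI[OF fock_rel_vac[of V \<alpha> UNIV 0 1]] by simp

lemma fock_diff: "fock (v - w) = (\<lambda>y. fock v y - fock w y)"
  using fock_add[of v "scl V (-1) w"] unfolding fock_scale by simp

lemma fock_sum: "fock (\<Sum>i\<in>A. f i) = (\<lambda>y. \<Sum>i\<in>A. fock (f i) y)"
  by (induction A rule: infinite_finite_induct) (auto simp: fock_zero fock_add)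

lemma fock_creation: "fock (mode i (- int k - 1) v) = (\<lambda>y. y (i, k) * fock v y)"
proof -
  obtain d where "rel UNIV d v (fock v)" using rel_fock by metis
  then show ?thesis by (intro fock_eqI[OF fock_rel_mode]) auto
qed

lemma fock_annihilation: "fock (mode i (int k + 1) v) = (\<lambda>y. (of_nat k + 1) * pd (i, k) (fock v) y)"
proof -
  obtain d where "rel UNIV d v (fock v)" using rel_fock by metis
  then show ?thesis using rel_annihilate[of UNIV d v "fock v" i k] by (intro fock_eqI) auto
qed

lemmas fock_simps = fock_add fock_scale fock_zero fock_vacuum fock_diff fock_sum fock_creation
  fock_annihilation mode_zero

lemma fock_generator: "fock (\<alpha> i) = (\<lambda>y. y (i, 0))"
  using fock_creation[of i 0 "vac V"] by (simp add: vac_right fock_vacuum)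

section \<open>Automorphisms from orthogonal matrices\<close>

definition lin_act :: "('n \<Rightarrow> 'n \<Rightarrow> complex) \<Rightarrow> 'v \<Rightarrow> 'v" where
  "lin_act M v = (THE w. fock w = (\<lambda>y. fock v (lin M y)))"

lemma fock_lin_act: "fock (lin_act M v) = (\<lambda>y. fock v (lin M y))"
  unfolding lin_act_def
proof (rule theI')
  obtain d where "pol UNIV d (fock v)" using fock_pol by metis
  from fock_surj[OF pol_lin[OF this]] show "\<exists>!w. fock w = (\<lambda>y. fock v (lin M y))"
    using fock_inject by metis
qed

lemma lin_act_simps:
  "lin_act M (v + w) = lin_act M v + lin_act M w"
  "lin_act M (scl V c v) = scl V c (lin_act M v)"
  "lin_act M (v - w) = lin_act M v - lin_act M w"
  "lin_act M 0 = 0"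
  "lin_act M (vac V) = vac V"
  "lin_act M (\<Sum>i\<in>A. f i) = (\<Sum>i\<in>A. lin_act M (f i))"
  by (rule fock_inject, simp add: fock_lin_act fock_simps)+

text \<open>This fixes the convention: the rows of \<open>M\<close> give the images of the
  generators, whereas \<open>orth_act\<close> uses the columns of \<open>g\<close>. So
  \<open>g\<close> acts as \<open>lin_act\<close> of its transpose.\<close>

lemma lin_act_generator: "lin_act M (\<alpha> i) = (\<Sum>j\<in>UNIV. scl V (M i j) (\<alpha> j))"
  by (rule fock_inject) (simp add: fock_lin_act fock_simps fock_generator lin_def)

definition orthogonal :: "('n \<Rightarrow> 'n \<Rightarrow> complex) \<Rightarrow> bool" where
  "orthogonal M \<longleftrightarrow> (\<forall>i k. (\<Sum>j\<in>UNIV. M i j * M k j) = (if i = k then 1 else 0)) \<and>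
     (\<forall>i k. (\<Sum>j\<in>UNIV. M j i * M j k) = (if i = k then 1 else 0))"

lemma lin_lin_transpose:
  assumes "orthogonal M"
  shows "lin M (lin (\<lambda>i j. M j i) y) = y"
proof
  fix s :: "'n \<times> nat"
  obtain i a where s: "s = (i, a)" by (cases s)
  have "lin M (lin (\<lambda>i j. M j i) y) (i, a) = (\<Sum>j\<in>UNIV. \<Sum>k\<in>UNIV. M i j * M k j * y (k, a))"
    by (simp add: lin_def sum_distrib_left mult.assoc)
  also have "\<dots> = (\<Sum>k\<in>UNIV. \<Sum>j\<in>UNIV. M i j * M k j * y (k, a))" by (rule sum.swap)
  also have "\<dots> = (\<Sum>k\<in>UNIV. if k = i then y (k, a) else 0)"
    using assms by (intro sum.cong refl) (simp add: sum_distrib_right[symmetric] orthogonal_def)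
  finally show "lin M (lin (\<lambda>i j. M j i) y) s = y s" by (simp add: s)
qed

lemma orthogonal_transpose: "orthogonal M \<Longrightarrow> orthogonal (\<lambda>i j. M j i)"
  by (auto simp: orthogonal_def)

lemma lin_act_inverse:
  assumes "orthogonal M"
  shows "lin_act M (lin_act (\<lambda>i j. M j i) v) = v"
  by (rule fock_inject) (simp add: fock_lin_act lin_lin_transpose[OF orthogonal_transpose[OF assms]])

lemma bij_lin_act: "orthogonal M \<Longrightarrow> bij (lin_act M)"
  by (rule bij_betw_byWitness[where f' = "lin_act (\<lambda>i j. M j i)"])
    (auto simp: lin_act_inverse lin_act_inverse[OF orthogonal_transpose])

text \<open>Creation modes are compatible with every substitution. For annihilation modes the chain
  rule brings in a second factor \<open>M\<close>, and orthonormality of the rows contracts the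
  two.\<close>

lemma lin_act_mode:
  assumes M: "orthogonal M"
  shows "lin_act M (mode i n v) = nprod V (lin_act M (\<alpha> i)) n (lin_act M v)"
proof -
  have "lin_act M (mode i n v) = (\<Sum>j\<in>UNIV. scl V (M i j) (mode j n (lin_act M v)))"
  proof (cases n rule: mode_int_cases)
    case (1 k)
    show ?thesis unfolding 1
      by (rule fock_inject) (simp add: fock_lin_act fock_simps lin_def sum_distrib_right mult.assoc)
  next
    case 2
    then show ?thesis by (simp add: mode_zero lin_act_simps)
  next
    case (3 k)
    obtain d where d: "pol UNIV d (fock v)" using fock_pol by metis
    have "(\<Sum>j\<in>UNIV. M i j * (\<Sum>l\<in>UNIV. M l j * w l)) = w i" for w
    proof -
      have "(\<Sum>j\<in>UNIV. M i j * (\<Sum>l\<in>UNIV. M l j * w l)) = (\<Sum>j\<in>UNIV. \<Sum>l\<in>UNIV. M i j * M l j * w l)"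
        by (simp add: sum_distrib_left mult.assoc)
      also have "\<dots> = (\<Sum>l\<in>UNIV. \<Sum>j\<in>UNIV. M i j * M l j * w l)" by (rule sum.swap)
      also have "\<dots> = (\<Sum>l\<in>UNIV. if l = i then w l else 0)"
        using M by (intro sum.cong refl) (simp add: sum_distrib_right[symmetric] orthogonal_def)
      finally show ?thesis by simp
    qed
    note * = this[of "\<lambda>l. (of_nat k + 1) * pd (l, k) (fock v) (lin M y)" for y]
    show ?thesis unfolding 3
    proof (rule fock_inject, rule ext)
      fix y
      have "fock (\<Sum>j\<in>UNIV. scl V (M i j) (mode j (int k + 1) (lin_act M v))) y =
        (\<Sum>j\<in>UNIV. M i j * (\<Sum>l\<in>UNIV. M l j * ((of_nat k + 1) * pd (l, k) (fock v) (lin M y))))"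
        by (simp add: fock_simps fock_lin_act pd_lin[OF d] sum_distrib_left mult_ac)
      also have "\<dots> = fock (lin_act M (mode i (int k + 1) v)) y"
        unfolding * by (simp add: fock_simps fock_lin_act)
      finally show "fock (lin_act M (mode i (int k + 1) v)) y =
          fock (\<Sum>j\<in>UNIV. scl V (M i j) (mode j (int k + 1) (lin_act M v))) y" ..
    qed
  qed
  then show ?thesis by (simp add: lin_act_generator nprod_simps)
qed

text \<open>The left factors for which the claim holds with every index and every right factor
  include the generators and are closed under products, by the formula for iterated
  products.\<close>

lemma lin_act_nprod:
  assumes M: "orthogonal M"
  shows "lin_act M (nprod V a k b) = nprod V (lin_act M a) k (lin_act M b)"
proof -
  \<comment> \<open>\<open>Sum_any\<close> ranges over the nonzero terms, so
    \<open>lin_act M\<close> can be moved across it once it preserves nonvanishing.\<close>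
  have inj: "lin_act M v = 0 \<longleftrightarrow> v = 0" for v
    using bij_is_inj[OF bij_lin_act[OF M]] lin_act_simps(4)[of M] by (metis injD)
  let ?S = "{a. \<forall>k b. lin_act M (nprod V a k b) = nprod V (lin_act M a) k (lin_act M b)}"
  have "va_generated V (range \<alpha>) \<subseteq> ?S"
  proof (rule va_generated_subset)
    show "subspace ?S" by (rule subspaceI) (auto simp: nprod_simps lin_act_simps)
    show "vac V \<in> ?S" by (auto simp: vac_left lin_act_simps)
    show "range \<alpha> \<subseteq> ?S" using lin_act_mode[OF M] by auto
    fix a n b assume ab: "a \<in> ?S" "b \<in> ?S"
    have eq: "assoc_term (lin_act M a) n (lin_act M b) k (lin_act M c) j = lin_act M (assoc_term a n b k c j)" for k c j
      using ab by (simp add: assoc_term_def lin_act_simps)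
    then have "Sum_any (assoc_term (lin_act M a) n (lin_act M b) k (lin_act M c)) =
        lin_act M (Sum_any (assoc_term a n b k c))" for k c
      by (simp add: Sum_any.expand_set inj lin_act_simps)
    then show "nprod V a n b \<in> ?S" using ab by (simp add: nprod_assoc)
  qed
  then show ?thesis using generated by auto
qed

lemma lin_act_automorphism: "orthogonal M \<Longrightarrow> va_automorphism V (lin_act M)"
  unfolding va_automorphism_def
proof (intro conjI allI)
  show "Vector_Spaces.linear (scl V) (scl V) (lin_act M)"
    by unfold_locales (simp_all add: lin_act_simps)
qed (simp_all add: bij_lin_act lin_act_simps lin_act_nprod)

lemma orthogonal_of_matrix:
  assumes "orthogonal_matrix (g :: complex ^ 'n ^ 'n)"
  shows "orthogonal (\<lambda>i j. g $ j $ i)"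
proof -
  have "transpose g ** g = mat 1" "g ** transpose g = mat 1"
    using assms by (auto simp: orthogonal_matrix_def)
  then show ?thesis
    by (auto simp: orthogonal_def matrix_matrix_mult_def transpose_def mat_def vec_eq_iff)
qed

lemma orth_act_eq_lin_act:
  assumes "orthogonal_matrix g"
  shows "orth_act V \<alpha> g = lin_act (\<lambda>i j. g $ j $ i)"
  unfolding orth_act_def
proof (rule the_equality)
  let ?\<phi> = "lin_act (\<lambda>i j. g $ j $ i)"
  show *: "va_automorphism V ?\<phi> \<and> (\<forall>i. ?\<phi> (\<alpha> i) = (\<Sum>j\<in>UNIV. scl V (g $ j $ i) (\<alpha> j)))"
    using lin_act_automorphism[OF orthogonal_of_matrix[OF assms]] by (simp add: lin_act_generator)
  fix \<phi> assume "va_automorphism V \<phi> \<and> (\<forall>i. \<phi> (\<alpha> i) = (\<Sum>j\<in>UNIV. scl V (g $ j $ i) (\<alpha> j)))"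
  with * show "\<phi> = ?\<phi>" by (intro automorphism_eqI) auto
qed

end

section \<open>Generation by two quadratics\<close>

text \<open>Comparing coefficients in \<open>t\<close> shows that \<open>p\<close> is its own
  component of degree \<open>d\<close>, which improves a crude bound \<open>e\<close> to the true
  degree.\<close>

lemma pol_homog_degree:
  assumes "pol S e p" "homog d p"
  shows "pol S d p"
proof (cases "d \<le> e")
  case True
  obtain q where q: "\<forall>r t y. q r (scale_on UNIV t y) = t ^ r * q r y"
    "p = (\<lambda>y. \<Sum>r\<le>e. q r y)" "\<forall>r. pol S r (q r)"
    using pol_homogeneous_components[OF assms(1), of UNIV] by auto
  have "p y = q d y" for y
  proof -
    have "(\<Sum>r\<le>e. q r y * t ^ r) = (\<Sum>r\<le>e. (if r = d then p y else 0) * t ^ r)" for t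
    proof -
      have "(\<Sum>r\<le>e. q r y * t ^ r) = (\<Sum>r\<le>e. q r (scale_on UNIV t y))"
        using q(1) by (simp add: mult.commute)
      also have "\<dots> = p (\<lambda>s. t * y s)" by (subst q(2)) (simp add: scale_on_def)
      also have "\<dots> = t ^ d * p y" using assms(2) by (simp add: homog_def)
      also have "\<dots> = (\<Sum>r\<le>e. if r = d then t ^ d * p y else 0)" using True by simp
      also have "\<dots> = (\<Sum>r\<le>e. (if r = d then p y else 0) * t ^ r)" by (intro sum.cong) auto
      finally show ?thesis .
    qed
    then have "\<forall>r\<le>e. q r y = (if r = d then p y else 0)"
      by (intro polyfun_eq_coeffs[THEN iffD1] allI)
    with True show ?thesis by simp
  qed
  then have "p = q d" by auto
  with q(3) show ?thesis by simp
qed (auto intro: pol_mono[OF assms(1)])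

text \<open>Reflections commute with dilations, so invariance can be read off coefficient by
  coefficient in \<open>t\<close>.\<close>

lemma refl_inv_components:
  assumes "refl_inv I p" "p = (\<lambda>y. \<Sum>r\<le>e. q r y)"
    "\<And>r t y. q r (scale_on UNIV t y) = t ^ r * q r y" "r \<le> e"
  shows "refl_inv I (q r)"
  unfolding refl_inv_def
proof (intro allI impI)
  fix v :: "'a \<Rightarrow> real" and y
  assume v: "\<forall>i. i \<notin> I \<longrightarrow> v i = 0" "(\<Sum>i\<in>UNIV. (v i)\<^sup>2) = 1"
  have inv: "p (refl_at v y) = p y" for y using assms(1) v by (auto simp: refl_inv_def)
  have sum: "(\<Sum>r\<le>e. q r y * t ^ r) = p (scale_on UNIV t y)" for t y
    by (subst assms(2)) (simp add: assms(3) mult.commute)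
  have "scale_on UNIV t (refl_at v y) = refl_at v (scale_on UNIV t y)" for t
    by (auto simp: scale_on_def refl_at_def fun_eq_iff algebra_simps sum_distrib_left)
  then have "(\<Sum>r\<le>e. q r (refl_at v y) * t ^ r) = (\<Sum>r\<le>e. q r y * t ^ r)" for t
    unfolding sum by (simp add: inv)
  then have "\<forall>r\<le>e. q r (refl_at v y) = q r y"
    by (intro polyfun_eq_coeffs[THEN iffD1] allI)
  with \<open>r \<le> e\<close> show "q r (refl_at v y) = q r y" by simp
qed

context heisenberg
begin

section \<open>Quadratic vectors and the first product with j^2\<close>

definition quadratic :: "nat \<Rightarrow> nat \<Rightarrow> 'v" where
  "quadratic a b = (\<Sum>i\<in>UNIV. mode i (- int a - 1) (mode i (- int b - 1) (vac V)))"

lemma fock_quadratic: "fock (quadratic a b) = qform a b"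
  by (simp add: quadratic_def fock_simps qform_def fun_eq_iff)

lemma va_deriv_pow_generator:
  "(va_deriv V ^^ b) (\<alpha> i) = scl V (of_int (deriv_coeff b (-1))) (mode i (- int b - 1) (vac V))"
proof -
  have "- 1 - int b = - int b - 1" by simp
  then show ?thesis using nprod_va_deriv_pow[of b "\<alpha> i" "-1" "vac V"] by (simp only: vac_right)
qed

text \<open>The scalar is \<open>r!\<close>, since \<open>quadratic\<close> is normalized by modes
  and \<open>quad\<close> by derivatives.\<close>

lemma quad_eq_quadratic: "quad V \<alpha> r = scl V (of_int (deriv_coeff r (-1))) (quadratic 0 r)"
  by (simp add: quad_def wick_def va_deriv_pow_generator quadratic_def nprod_simps scale_sum_right)

lemma nprod_creation:
  "nprod V (mode i (- int b - 1) (vac V)) k c =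
    scl V (of_int (deriv_coeff b k) / of_int (deriv_coeff b (-1))) (mode i (k - int b) c)"
proof -
  have "(of_int (deriv_coeff b (-1)) :: complex) \<noteq> 0"
    using deriv_coeff_pos[of "-1" b] by simp
  then have "mode i (- int b - 1) (vac V) =
      scl V (1 / of_int (deriv_coeff b (-1))) ((va_deriv V ^^ b) (\<alpha> i))"
    by (simp add: va_deriv_pow_generator)
  then show ?thesis by (simp add: nprod_simps nprod_va_deriv_pow)
qed

lemma va_deriv_quadratic:
  "va_deriv V (quadratic a b) =
     scl V (of_nat (Suc a)) (quadratic (Suc a) b) + scl V (of_nat (Suc b)) (quadratic a (Suc b))"
proof -
  have D: "va_deriv V (mode i (- int k - 1) w) = mode i (- int k - 1) (va_deriv V w)
     + scl V (of_nat (Suc k)) (mode i (- int (Suc k) - 1) w)" for i k w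
  proof -
    have "- int k - 1 - 1 = - int (Suc k) - 1" "(of_int (- int k - 1) :: complex) = - of_nat (Suc k)"
      by simp_all
    then show ?thesis unfolding va_deriv_nprod by (simp only: scale_minus_left diff_minus_eq_add)
  qed
  show ?thesis
    unfolding quadratic_def
    by (simp only: va_deriv_sum D va_deriv_vac nprod_simps add_0 scale_sum_right sum.distrib)
      (simp only: add.commute)
qed

lemma mode_eq_0:
  assumes "pol (UNIV \<times> {..<m}) d (fock c)" "n > int m"
  shows "mode i n c = 0"
proof -
  define k where "k = nat (n - 1)"
  have n: "n = int k + 1" and "k \<ge> m" using assms(2) by (auto simp: k_def)
  then have "pd (i, k) (fock c) = (\<lambda>_. 0)" by (intro pd_notin[OF assms(1)]) auto
  then show ?thesis unfolding n by (intro fock_inject) (simp add: fock_simps)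
qed

lemma minus_one_power_gchoose_minus_one: "(-1) ^ j * (of_int (-1) gchoose j) = (1 :: complex)"
  using gbinomial_minus[of "1 :: complex" j] binomial_gbinomial[of j j, where 'a = complex]
  by (simp add: power_mult_distrib[symmetric])

text \<open>In this product the indices of the two modes add up to -2. The double creation with both
  indices -1 gets coefficient zero and zero modes vanish, so polarizations from slot
  \<open>l\<close> to slot \<open>l + 2\<close> remain. The coefficient is (l+3)(l+2) + (l+1)(l+2) =
  2 (l+2)^2 from the two halves of the iterated product, times \<open>l + 1\<close> from the
  annihilator.\<close>

lemma quad_2_action:
  assumes c: "pol (UNIV \<times> {..<m}) d (fock c)"
  shows "fock (nprod V (quad V \<alpha> 2) 1 c) =
    (\<lambda>y. \<Sum>l<m. 2 * (of_nat l + 1) * (of_nat l + 2)\<^sup>2 * eul (l + 2) l (fock c) y)"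
proof -
  let ?X = "\<lambda>i l. mode i (- int (l + 2) - 1) (mode i (int l + 1) c)"
  have X: "?X i m = 0" for i using mode_eq_0[OF c] by (simp add: nprod_simps)
  let ?A = "\<lambda>i j. scl V (of_nat ((j + 1) * j)) (mode i (- 1 - int j) (mode i (int j - 1) c))"
  let ?B = "\<lambda>i j. scl V (of_nat (j * (j + 1))) (mode i (- int j - 2) (mode i (int j) c))"
  have trm: "assoc_term (\<alpha> i) (-1) ((va_deriv V ^^ 2) (\<alpha> i)) 1 c j = ?A i j + ?B i j" for i j
  proof -
    have c1: "deriv_coeff 2 (1 + int j) = int ((j + 1) * j)" and c2: "deriv_coeff 2 (- int j) = int (j * (j + 1))"
      by (simp_all add: numeral_2_eq_2 algebra_simps)
    have i: "1 + int j - int 2 = int j - 1" "- int j - int 2 = - int j - 2" "- 1 + 1 - int j = - int j" by simp_all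
    have p: "(-1 :: complex) powi (-1) = -1" by simp
    show ?thesis
      unfolding assoc_term_def minus_one_power_gchoose_minus_one i nprod_va_deriv_pow c1 c2 p
      by (simp only: nprod_simps of_int_of_nat_eq scale_one scale_minus_left diff_minus_eq_add)
  qed
  have "nprod V (mode i (-1) ((va_deriv V ^^ 2) (\<alpha> i))) 1 c =
      (\<Sum>l<m. scl V (2 * (of_nat l + 2)\<^sup>2) (?X i l))" for i
  proof -
    \<comment> \<open>Two more terms than slots: the first half contributes from
      \<open>j = 2\<close> on, the second from \<open>j = 1\<close> on, and the surplus term
      \<open>l = m\<close> of the latter vanishes by \<open>X\<close>.\<close>
    have "assoc_term (\<alpha> i) (-1) ((va_deriv V ^^ 2) (\<alpha> i)) 1 c j = 0" if "j \<ge> Suc (Suc m)" for j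
      unfolding trm using that by (simp add: mode_eq_0[OF c] nprod_simps)
    from nprod_assoc_sum[OF this]
    have "nprod V (mode i (-1) ((va_deriv V ^^ 2) (\<alpha> i))) 1 c =
        (\<Sum>j<Suc (Suc m). ?A i j) + (\<Sum>j<Suc (Suc m). ?B i j)"
      by (simp only: trm sum.distrib)
    also have "(\<Sum>j<Suc (Suc m). ?A i j) = (\<Sum>l<m. scl V (of_nat ((l + 3) * (l + 2))) (?X i l))"
    proof -
      have "?A i (Suc (Suc l)) = scl V (of_nat ((l + 3) * (l + 2))) (?X i l)" for l
      proof -
        have "- 1 - int (Suc (Suc l)) = - int (l + 2) - 1" "int (Suc (Suc l)) - 1 = int l + 1"
          "(Suc (Suc l) + 1) * Suc (Suc l) = (l + 3) * (l + 2)"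
          by (simp_all add: algebra_simps)
        then show ?thesis by (simp only:)
      qed
      then show ?thesis
        by (subst sum.lessThan_Suc_shift, subst sum.lessThan_Suc_shift) (simp add: mode_zero nprod_simps)
    qed
    also have "(\<Sum>j<Suc (Suc m). ?B i j) = (\<Sum>l<m. scl V (of_nat ((l + 1) * (l + 2))) (?X i l))"
    proof -
      have "?B i (Suc l) = scl V (of_nat ((l + 1) * (l + 2))) (?X i l)" for l
      proof -
        have "- int (Suc l) - 2 = - int (l + 2) - 1" "int (Suc l) = int l + 1"
          "Suc l * (Suc l + 1) = (l + 1) * (l + 2)" by simp_all
        then show ?thesis by (simp only:)
      qed
      note B = this
      have "(\<Sum>j<Suc (Suc m). ?B i j) = ?B i 0 + (\<Sum>j<Suc m. ?B i (Suc j))"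
        by (rule sum.lessThan_Suc_shift)
      also have "\<dots> = (\<Sum>l<m. scl V (of_nat ((l + 1) * (l + 2))) (?X i l))"
        by (simp only: B sum.lessThan_Suc X) simp
      finally show ?thesis .
    qed
    also have "(\<Sum>l<m. scl V (of_nat ((l + 3) * (l + 2))) (?X i l)) + (\<Sum>l<m. scl V (of_nat ((l + 1) * (l + 2))) (?X i l))
        = (\<Sum>l<m. scl V (2 * (of_nat l + 2)\<^sup>2) (?X i l))"
    proof -
      have "(of_nat ((l + 3) * (l + 2)) + of_nat ((l + 1) * (l + 2)) :: complex) = 2 * (of_nat l + 2)\<^sup>2" for l :: nat
        by (simp add: power2_eq_square algebra_simps)
      then show ?thesis by (simp only: sum.distrib[symmetric] scale_left_distrib[symmetric])
    qed
    finally show ?thesis .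
  qed
  then have "nprod V (quad V \<alpha> 2) 1 c = (\<Sum>i\<in>UNIV. \<Sum>l<m. scl V (2 * (of_nat l + 2)\<^sup>2) (?X i l))"
    by (simp add: quad_def wick_def nprod_simps)
  also have "\<dots> = (\<Sum>l<m. \<Sum>i\<in>UNIV. scl V (2 * (of_nat l + 2)\<^sup>2) (?X i l))"
    by (rule sum.swap)
  finally have "nprod V (quad V \<alpha> 2) 1 c = (\<Sum>l<m. \<Sum>i\<in>UNIV. scl V (2 * (of_nat l + 2)\<^sup>2) (?X i l))" .
  then show ?thesis
    by (simp only: fock_sum fock_scale fock_creation fock_annihilation eul_def sum_distrib_left mult_ac)
qed

lemma pol_qform: "a < m \<Longrightarrow> b < m \<Longrightarrow> pol (UNIV \<times> {..<m}) 2 (qform a b)"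
  using pol_qform_mult[of m 0 "\<lambda>_. 1" a b] by (simp add: numeral_2_eq_2)

lemma pd_qform:
  "pd (i, b) (qform c e) = (\<lambda>y. (if b = c then y (i, e) else 0) + (if b = e then y (i, c) else 0))"
proof -
  have pol1: "pol UNIV 1 (\<lambda>y. y s)" for s using pol_coord[of s UNIV 0] by simp
  have q: "qform c e = (\<lambda>y. \<Sum>j\<in>UNIV. y (j, c) * y (j, e))" by (simp add: qform_def fun_eq_iff)
  have "pd (i, b) (qform c e) = (\<lambda>y. \<Sum>j\<in>UNIV. pd (i, b) (\<lambda>y. y (j, c) * y (j, e)) y)"
    unfolding q by (rule pd_sum) (rule pol_mult[OF pol1 pol1])
  also have "\<dots> = (\<lambda>y. \<Sum>j\<in>UNIV. if j = i then (if b = c then y (i, e) else 0) + (if b = e then y (i, c) else 0) else 0)"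
    by (rule ext, rule sum.cong[OF refl]) (auto simp: pd_mult[OF pol1 pol1] pd_coord)
  finally show ?thesis by simp
qed

lemma eul_qform:
  "eul a b (qform c e) = (\<lambda>y. (if b = c then qform a e y else 0) + (if b = e then qform c a y else 0))"
  by (simp add: eul_eq pd_qform fun_eq_iff distrib_left sum.distrib qform_def mult.commute)

text \<open>Either leg of the quadratic moves up by two slots: the leg in slot 0 with coefficient 2
  * 1 * 2^2 = 8, the leg in slot \<open>L\<close> with the general one.\<close>

lemma quad_2_quadratic:
  "nprod V (quad V \<alpha> 2) 1 (quadratic 0 L) =
    scl V 8 (quadratic 2 L) + scl V (2 * (of_nat L + 1) * (of_nat L + 2)\<^sup>2) (quadratic 0 (L + 2))"
proof (rule fock_inject)
  have "pol (UNIV \<times> {..<Suc L}) 2 (fock (quadratic 0 L))"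
    unfolding fock_quadratic by (rule pol_qform) auto
  from quad_2_action[OF this]
  have "fock (nprod V (quad V \<alpha> 2) 1 (quadratic 0 L)) =
    (\<lambda>y. \<Sum>l<Suc L. (if l = 0 then 8 * qform 2 L y else 0)
      + (if l = L then 2 * (of_nat L + 1) * (of_nat L + 2)\<^sup>2 * qform 0 (L + 2) y else 0))"
    unfolding fock_quadratic
  proof (rule trans, intro ext sum.cong refl)
    fix y l
    show "2 * (of_nat l + 1) * (of_nat l + 2)\<^sup>2 * eul (l + 2) l (qform 0 L) y = (if l = 0 then 8 * qform 2 L y else 0)
      + (if l = L then 2 * (of_nat L + 1) * (of_nat L + 2)\<^sup>2 * qform 0 (L + 2) y else 0)"
      by (cases "l = 0"; cases "l = L") (auto simp: eul_qform distrib_left simp flip: numeral_2_eq_2)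
  qed
  also have "\<dots> = (\<lambda>y. 8 * qform 2 L y + 2 * (of_nat L + 1) * (of_nat L + 2)\<^sup>2 * qform 0 (L + 2) y)"
    unfolding sum.distrib by (subst sum.delta, simp, subst sum.delta) simp_all
  finally show "fock (nprod V (quad V \<alpha> 2) 1 (quadratic 0 L)) = fock (scl V 8 (quadratic 2 L) +
      scl V (2 * (of_nat L + 1) * (of_nat L + 2)\<^sup>2) (quadratic 0 (L + 2)))"
    by (simp only: fock_simps fock_quadratic)
qed

abbreviation W :: "'v set" where
  "W \<equiv> va_generated V {quad V \<alpha> 0, quad V \<alpha> 2}"

lemmas W_add = subspace_add[OF subspace_va_generated]
  and W_diff = subspace_diff[OF subspace_va_generated]
  and W_scale = subspace_scale[OF subspace_va_generated]
  and W_zero = subspace_0[OF subspace_va_generated]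
  and W_sum = subspace_sum[OF subspace_va_generated]

lemma W_unscale: "scl V c v \<in> va_generated V S \<Longrightarrow> c \<noteq> 0 \<Longrightarrow> v \<in> va_generated V S"
  using W_scale[of "scl V c v" S "1 / c"] by simp

text \<open>On level \<open>a + b = n + 1\<close>, deriving the quadratics of level \<open>n\<close>
  relates neighbours, so modulo \<open>W\<close> everything is a multiple of
  \<open>quadratic 0 (Suc n)\<close>. One further relation puts that vector into \<open>W\<close>:
  on level 1 it is symmetry, above that the product with \<open>quad V \<alpha> 2\<close> applied
  two levels below.\<close>

lemma quadratic_in_W: "quadratic a b \<in> W"
proof (induction "a + b" arbitrary: a b rule: less_induct)
  case less
  show ?case
  proof (cases "a + b")
    case 0
    have "quad V \<alpha> 0 \<in> W" by (rule va_generated_base) simp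
    with 0 show ?thesis by (simp add: quad_eq_quadratic)
  next
    case (Suc n)
    have rel: "scl V (of_nat (Suc a')) (quadratic (Suc a') b') + scl V (of_nat (Suc b')) (quadratic a' (Suc b')) \<in> W"
      if "a' + b' = n" for a' b'
    proof -
      have "quadratic a' b' \<in> W" by (rule less.hyps) (use that Suc in simp)
      then show ?thesis unfolding va_deriv_quadratic[symmetric] by (rule va_generated_deriv)
    qed
    \<comment> \<open>Four times one derivation relation removes \<open>quadratic 2 L\<close>, and a
      multiple of another removes \<open>quadratic 1 (Suc L)\<close>. The surviving coefficient is 2
      (L+1) (L+2) (L+4), which is not zero.\<close>
    have cancel: "scl V 8 x + scl V A u - scl V 4 (scl V 2 x + scl V B z) + scl V (4 * B) (z + scl V D u)
        = scl V (A + 4 * B * D) u" for x z u A B D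
      by (simp add: scale_right_distrib scale_left_distrib)
    have start: "quadratic 0 (Suc n) \<in> W"
    proof (cases n)
      case 0
      have "quadratic (Suc 0) 0 = quadratic 0 (Suc 0)"
        by (rule fock_inject) (simp add: fock_quadratic qform_def mult.commute fun_eq_iff)
      with rel[of 0 0] 0 have "scl V (1 + 1) (quadratic 0 (Suc 0)) \<in> W"
        by (simp only: scale_left_distrib) simp
      with 0 show ?thesis by (auto dest!: W_unscale)
    next
      case (Suc L)
      let ?u = "quadratic 0 (Suc n)" and ?c = "of_nat :: nat \<Rightarrow> complex"
      have "quadratic 0 L \<in> W" by (rule less.hyps) (use \<open>a + b = Suc n\<close> Suc in simp)
      then have "nprod V (quad V \<alpha> 2) 1 (quadratic 0 L) \<in> W"
        by (intro va_generated_nprod[OF va_generated_base]) simp_all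
      then have 1: "scl V 8 (quadratic 2 L) + scl V (2 * (?c L + 1) * (?c L + 2)\<^sup>2) ?u \<in> W"
        unfolding quad_2_quadratic by (simp add: Suc)
      have 2: "quadratic 1 (Suc L) + scl V (?c L + 2) ?u \<in> W"
        using rel[of 0 n] by (simp add: Suc add.commute)
      have 3: "scl V 2 (quadratic 2 L) + scl V (?c L + 1) (quadratic 1 (Suc L)) \<in> W"
        using rel[of 1 L] by (simp add: Suc add.commute numeral_2_eq_2)
      have "(scl V 8 (quadratic 2 L) + scl V (2 * (?c L + 1) * (?c L + 2)\<^sup>2) ?u)
         - scl V 4 (scl V 2 (quadratic 2 L) + scl V (?c L + 1) (quadratic 1 (Suc L)))
         + scl V (4 * (?c L + 1)) (quadratic 1 (Suc L) + scl V (?c L + 2) ?u) \<in> W"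
        by (intro W_add W_diff W_scale 1 2 3)
      also have "(scl V 8 (quadratic 2 L) + scl V (2 * (?c L + 1) * (?c L + 2)\<^sup>2) ?u)
         - scl V 4 (scl V 2 (quadratic 2 L) + scl V (?c L + 1) (quadratic 1 (Suc L)))
         + scl V (4 * (?c L + 1)) (quadratic 1 (Suc L) + scl V (?c L + 2) ?u) =
        scl V (2 * (?c L + 1) * (?c L + 2)\<^sup>2 + 4 * (?c L + 1) * (?c L + 2)) ?u"
        by (rule cancel)
      also have "2 * (?c L + 1) * (?c L + 2)\<^sup>2 + 4 * (?c L + 1) * (?c L + 2)
          = of_nat (2 * (L + 1) * (L + 2) * (L + 4))"
        by (simp add: power2_eq_square algebra_simps)
      finally show ?thesis by (rule W_unscale) (simp only: of_nat_eq_0_iff, simp)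
    qed
    have "a' + b' = Suc n \<Longrightarrow> quadratic a' b' \<in> W" for a' b'
    proof (induction a' arbitrary: b')
      case 0
      with start show ?case by simp
    next
      case (Suc a')
      have "quadratic a' (Suc b') \<in> W" using Suc by simp
      then have "scl V (of_nat (Suc a')) (quadratic (Suc a') b') + scl V (of_nat (Suc b')) (quadratic a' (Suc b'))
         - scl V (of_nat (Suc b')) (quadratic a' (Suc b')) \<in> W"
        using Suc.prems by (intro W_diff W_scale rel) auto
      then have "scl V (of_nat (Suc a')) (quadratic (Suc a') b') \<in> W" by simp
      then show ?case by (rule W_unscale) (rule of_nat_neq_0)
    qed
    with Suc show ?thesis by blast
  qed
qed

lemma pol_creation_annihilation:
  assumes "pol UNIV d (fock c)" "k < 0" "n \<ge> 0"
  shows "pol UNIV d (fock (mode i k (mode j n c)))"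
proof -
  define l where "l = nat (- k - 1)"
  have k: "k = - int l - 1" using assms(2) by (simp add: l_def)
  show ?thesis
  proof (cases "n = 0")
    case True
    then show ?thesis by (simp add: mode_zero nprod_simps fock_zero)
  next
    case False
    define m where "m = nat (n - 1)"
    have n: "n = int m + 1" using assms(3) False by (simp add: m_def)
    have "pol UNIV d (\<lambda>y. (of_nat m + 1) * (y (i, l) * pd (j, m) (fock c) y))"
      by (intro pol_cmult pol_coord_pd assms(1)) simp
    then show ?thesis unfolding k n by (simp add: fock_simps mult_ac)
  qed
qed

text \<open>The correction terms contain an annihilator, hence do not raise the degree.\<close>

lemma quadratic_nprod:
  assumes c: "pol UNIV d (fock c)"
  shows "pol UNIV d (\<lambda>y. fock (nprod V (quadratic a b) (-1) c) y - qform a b y * fock c y)"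
proof -
  have int_comm: "- 1 - int b = - int b - 1" by simp
  let ?B = "\<lambda>i. mode i (- int b - 1) (vac V)"
  let ?t = "\<lambda>i. assoc_term (\<alpha> i) (- int a - 1) (?B i) (-1) c"
  let ?r = "\<lambda>i j y. fock (?t i j) y - (if j = 0 then y (i, a) * y (i, b) * fock c y else 0)"
  have "pol UNIV d (?r i j)" for i j
  proof -
    define e :: complex where "e = (-1) ^ j * (of_int (- int a - 1) gchoose j)"
    define s :: complex where "s = (-1) powi (- int a - 1)"
    let ?k = "- int a - 1 + - 1 - int j"
    let ?P = "fock (mode i (- int a - 1 - int j) (nprod V (?B i) (-1 + int j) c))"
    let ?Q = "fock (nprod V (?B i) ?k (mode i (int j) c))"
    have Q: "pol UNIV d ?Q"
      unfolding nprod_creation fock_scale by (intro pol_cmult pol_creation_annihilation c) auto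
    have t: "fock (?t i j) = (\<lambda>y. e * (?P y - s * ?Q y))"
      by (simp add: assoc_term_def e_def s_def fock_simps)
    show ?thesis
    proof (cases "j = 0")
      case True
      have "(of_int (deriv_coeff b (-1)) :: complex) \<noteq> 0"
        using deriv_coeff_pos[of "-1" b] by simp
      then have "nprod V (?B i) (-1) c = mode i (- int b - 1) c"
        unfolding nprod_creation by (simp add: int_comm)
      then have "?P = (\<lambda>y. y (i, a) * (y (i, b) * fock c y))"
        using True by (simp add: fock_creation)
      moreover have "e = 1" using True by (simp add: e_def)
      ultimately have "?r i j = (\<lambda>y. - s * ?Q y)" using True unfolding t by (simp add: fun_eq_iff mult.assoc)
      then show ?thesis using pol_cmult[OF Q, of "- s"] by simp
    next
      case False
      have "pol UNIV d ?P"
      \<comment> \<open>\<open>?B i\<close> is a multiple of the \<open>b\<close>th derivative of a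
        generator. Its mode of index \<open>j - 1\<close> has coefficient zero for
        \<open>j - 1 < b\<close>; otherwise it is a generator mode of index
        \<open>j - 1 - b \<ge> 0\<close>. So no second creation occurs for
        \<open>j > 0\<close>.\<close>
      proof (cases "j - 1 < b")
        case True
        then have "deriv_coeff b (-1 + int j) = 0" using False by (intro deriv_coeff_eq_0) auto
        then show ?thesis by (simp add: nprod_creation nprod_simps fock_zero)
      next
        case False
        with \<open>j \<noteq> 0\<close> show ?thesis
          unfolding nprod_creation nprod_simps fock_scale
          by (intro pol_cmult pol_creation_annihilation c) auto
      qed
      then have "pol UNIV d (\<lambda>y. e * (?P y - s * ?Q y))"
        by (intro pol_cmult pol_diff Q)
      then show ?thesis using False unfolding t by simp
    qed
  qed
  note r = this
  have "\<forall>i. \<exists>N. \<forall>j\<ge>N. ?t i j = 0" using assoc_term_bound by blast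
  from choice[OF this] obtain N where N: "\<And>i j. j \<ge> N i \<Longrightarrow> ?t i j = 0" by auto
  define N0 where "N0 = Max (range N)"
  have N: "?t i j = 0" if "j \<ge> Suc N0" for i j
  proof (rule N)
    have "N i \<le> N0" unfolding N0_def by (rule Max_ge) auto
    with that show "N i \<le> j" by simp
  qed
  have "nprod V (quadratic a b) (-1) c = (\<Sum>i\<in>UNIV. \<Sum>j<Suc N0. ?t i j)"
    by (simp only: quadratic_def nprod_simps nprod_assoc_sum[OF N])
  then have 1: "fock (nprod V (quadratic a b) (-1) c) y - qform a b y * fock c y =
      (\<Sum>i\<in>UNIV. (\<Sum>j<Suc N0. fock (?t i j) y) - y (i, a) * y (i, b) * fock c y)" for y
    by (simp only: fock_sum qform_def sum_distrib_right sum_subtractf)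
  have 2: "(\<Sum>i\<in>UNIV. (\<Sum>j<Suc N0. fock (?t i j) y) - y (i, a) * y (i, b) * fock c y) =
      (\<Sum>i\<in>UNIV. \<Sum>j<Suc N0. ?r i j y)" for y
  proof -
    have "(\<Sum>j<Suc N0. if j = 0 then x else 0) = x" for x :: complex
      by (subst sum.delta) auto
    then show ?thesis by (simp only: sum_subtractf)
  qed
  show ?thesis unfolding 1 2 by (intro pol_sum) (rule r)
qed

section \<open>Invariants and the generated subalgebra\<close>

lemma orthogonal_refl:
  fixes w :: "'n \<Rightarrow> real"
  assumes "(\<Sum>i\<in>UNIV. (w i)\<^sup>2) = 1"
  shows "orthogonal (\<lambda>i j. (if i = j then 1 else 0) - 2 * of_real (w i) * of_real (w j))" (is "orthogonal ?M")
proof -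
  have "(\<Sum>j\<in>UNIV. ?M j i * ?M j k) = (\<Sum>j\<in>UNIV. ?M i j * ?M k j)" for i k
    by (intro sum.cong) auto
  with refl_orthogonal[OF assms] show ?thesis by (simp only: orthogonal_def) blast
qed

lemma refl_inv_fock_nprod:
  assumes "refl_inv UNIV (fock a)" "refl_inv UNIV (fock b)"
  shows "refl_inv UNIV (fock (nprod V a k b))"
  unfolding refl_inv_def
proof (intro allI impI)
  fix w :: "'n \<Rightarrow> real" and y
  assume w: "(\<Sum>i\<in>UNIV. (w i)\<^sup>2) = 1"
  let ?M = "\<lambda>i j. (if i = j then 1 else 0) - 2 * complex_of_real (w i) * of_real (w j)"
  have inv: "lin_act ?M a = a" if "refl_inv UNIV (fock a)" for a
    using that w by (intro fock_inject) (simp add: fock_lin_act refl_inv_def refl_at_eq_lin fun_eq_iff)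
  have "lin_act ?M (nprod V a k b) = nprod V a k b"
    unfolding lin_act_nprod[OF orthogonal_refl[OF w]] inv[OF assms(1)] inv[OF assms(2)] ..
  then show "fock (nprod V a k b) (refl_at w y) = fock (nprod V a k b) y"
    using fock_lin_act[of ?M "nprod V a k b"] by (simp add: refl_at_eq_lin fun_eq_iff)
qed

text \<open>Each term of the decomposition is replaced by a product of index -1 with an error of
  degree at most \<open>d - 2\<close>. The error is invariant but need not be homogeneous, so it is
  split into homogeneous components before the induction hypothesis applies.\<close>

lemma refl_invariant_in_W:
  "homog d (fock v) \<Longrightarrow> refl_inv UNIV (fock v) \<Longrightarrow> v \<in> W"
proof (induction d arbitrary: v rule: less_induct)
  case (less d)
  obtain e where e: "pol UNIV e (fock v)" using fock_pol by metis
  show ?case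
  proof (cases "d = 0")
    case True
    have "v = scl V (fock v (\<lambda>_. 0)) (vac V)"
      using homog_0_const less.prems True by (intro fock_inject) (auto simp: fock_simps)
    then show ?thesis using W_scale[OF va_generated_vac] by metis
  next
    case False
    then have "d \<ge> 1" by simp
    obtain m where "pol (UNIV \<inter> UNIV \<times> {..<m}) e (fock v)" using pol_nat_bound[OF e] by auto
    then have "pol (UNIV \<times> {..<m}) e (fock v)" by simp
    from pol_homog_degree[OF this less.prems(1)] less.prems have "inv_poly m d (fock v)" by (simp add: inv_poly_def)
    then obtain u where u: "\<And>a b. inv_poly m (d - 2) (u a b)"
      "fock v = (\<lambda>y. \<Sum>a<m. \<Sum>b<m. qform a b y * u a b y)" "d < 2 \<Longrightarrow> fock v = (\<lambda>_. 0)"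
      by (rule inv_poly_decompose[OF _ \<open>d \<ge> 1\<close>]) (rule that)
    show ?thesis
    proof (cases "d < 2")
      case True
      with u(3) have "v = 0" by (intro fock_inject) (simp add: fock_zero)
      then show ?thesis by (simp add: W_zero)
    next
      case False
      then have lt: "d - 2 < d" by simp
      have "\<exists>x\<in>W. fock x = (\<lambda>y. qform a b y * u a b y)" for a b
      proof -
        have u_pol: "pol UNIV (d - 2) (u a b)" and u_hom: "homog (d - 2) (u a b)" and u_inv: "refl_inv UNIV (u a b)"
          using u(1)[of a b] by (auto simp: inv_poly_def intro: pol_mono)
        obtain c where c: "fock c = u a b" using fock_surj[OF u_pol] by blast
        have "c \<in> W" by (rule less.IH[OF lt]) (simp_all add: c u_hom u_inv)
        define x where "x = nprod V (quadratic a b) (-1) c"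
        have "x \<in> W" unfolding x_def by (intro va_generated_nprod quadratic_in_W \<open>c \<in> W\<close>)
        define \<rho> where "\<rho> = (\<lambda>y. fock x y - qform a b y * u a b y)"
        have \<rho>_pol: "pol UNIV (d - 2) \<rho>"
          using quadratic_nprod[of "d - 2" c a b] u_pol by (simp add: \<rho>_def x_def c)
        have \<rho>_inv: "refl_inv UNIV \<rho>"
          unfolding refl_inv_def
        proof (intro allI impI)
          fix w :: "'n \<Rightarrow> real" and y
          assume w: "(\<Sum>i\<in>UNIV. (w i)\<^sup>2) = 1"
          have "fock x (refl_at w y) = fock x y"
            using refl_inv_fock_nprod[of "quadratic a b" c "-1"] w u_inv
            by (simp add: x_def c fock_quadratic refl_inv_def qform_refl_at)
          then show "\<rho> (refl_at w y) = \<rho> y"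
            using u_inv w by (simp add: \<rho>_def refl_inv_def qform_refl_at)
        qed
        obtain q where q: "\<forall>r t y. q r (scale_on UNIV t y) = t ^ r * q r y"
          "\<rho> = (\<lambda>y. \<Sum>r\<le>d - 2. q r y)" "\<forall>r. pol UNIV (d - 2) (q r)"
          using pol_homogeneous_components[OF \<rho>_pol, of UNIV] by auto
        have "\<exists>z\<in>W. fock z = q r" if "r \<le> d - 2" for r
        proof -
          obtain z where z: "fock z = q r" using fock_surj q(3) by blast
          have "refl_inv UNIV (q r)" using q(1) that by (intro refl_inv_components[OF \<rho>_inv q(2)]) auto
          moreover have "homog r (q r)" using q(1) by (simp add: homog_def scale_on_def)
          ultimately have "z \<in> W" using that lt by (intro less.IH[of r]) (auto simp: z)
          with z show ?thesis by blast
        qed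
        then obtain z where z: "\<And>r. r \<le> d - 2 \<Longrightarrow> z r \<in> W \<and> fock (z r) = q r" by metis
        have "fock (\<Sum>r\<le>d - 2. z r) = \<rho>" using z by (simp add: fock_sum q(2))
        then have "fock (x - (\<Sum>r\<le>d - 2. z r)) = (\<lambda>y. qform a b y * u a b y)"
          by (simp add: fock_diff \<rho>_def)
        moreover have "x - (\<Sum>r\<le>d - 2. z r) \<in> W" using z by (intro W_diff W_sum \<open>x \<in> W\<close>) auto
        ultimately show ?thesis by blast
      qed
      then obtain x where x: "\<And>a b. x a b \<in> W \<and> fock (x a b) = (\<lambda>y. qform a b y * u a b y)" by metis
      have "v = (\<Sum>a<m. \<Sum>b<m. x a b)"
        by (rule fock_inject) (simp add: fock_sum x u(2))
      also have "\<dots> \<in> W" using x by (intro W_sum) auto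
      finally show ?thesis .
    qed
  qed
qed

lemma lin_act_quadratic: "orthogonal M \<Longrightarrow> lin_act M (quadratic a b) = quadratic a b"
  by (rule fock_inject) (simp add: fock_lin_act fock_quadratic qform_lin orthogonal_def)

lemma generated_subset_invariants: "W \<subseteq> orth_invariants V \<alpha>"
proof -
  have "lin_act M v = v" if "orthogonal M" "v \<in> W" for M v
  proof -
    have "W \<subseteq> {v. lin_act M v = v}"
    proof (rule va_generated_subset)
      show "subspace {v. lin_act M v = v}" by (rule subspaceI) (auto simp: lin_act_simps)
    qed (use \<open>orthogonal M\<close> in \<open>auto simp: lin_act_simps lin_act_nprod quad_eq_quadratic lin_act_quadratic\<close>)
    with that(2) show ?thesis by auto
  qed
  then show ?thesis
    by (auto simp: orth_invariants_def orth_act_eq_lin_act orthogonal_of_matrix)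
qed

text \<open>From invariance under the complex group only the reflections in real unit vectors are
  extracted, which is the form of invariance asked for by
  \<open>refl_invariant_in_W\<close>.\<close>

lemma invariants_subset_generated: "orth_invariants V \<alpha> \<subseteq> W"
proof
  fix v assume v: "v \<in> orth_invariants V \<alpha>"
  have inv: "refl_inv UNIV (fock v)"
    unfolding refl_inv_def
  proof (intro allI impI)
    fix w :: "'n \<Rightarrow> real" and y
    assume w: "(\<Sum>i\<in>UNIV. (w i)\<^sup>2) = 1"
    define M :: "'n \<Rightarrow> 'n \<Rightarrow> complex" where
      "M = (\<lambda>i j. (if i = j then 1 else 0) - 2 * of_real (w i) * of_real (w j))"
    define g :: "complex ^ 'n ^ 'n" where "g = (\<chi> j i. M i j)"
    have "orthogonal M" unfolding M_def by (rule orthogonal_refl[OF w])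
    then have "orthogonal_matrix g"
      by (auto simp: orthogonal_matrix_def g_def orthogonal_def matrix_matrix_mult_def transpose_def
          mat_def vec_eq_iff)
    then have "lin_act (\<lambda>i j. g $ j $ i) v = v"
      using v orth_act_eq_lin_act by (auto simp: orth_invariants_def)
    then have "lin_act M v = v" by (simp add: g_def)
    then show "fock v (refl_at w y) = fock v y"
      using fock_lin_act[of M v] by (simp add: refl_at_eq_lin M_def fun_eq_iff)
  qed
  obtain e where e: "pol UNIV e (fock v)" using fock_pol by metis
  obtain q where q: "\<forall>r t y. q r (scale_on UNIV t y) = t ^ r * q r y"
    "fock v = (\<lambda>y. \<Sum>r\<le>e. q r y)" "\<forall>r. pol UNIV e (q r)"
    using pol_homogeneous_components[OF e, of UNIV] by auto
  have "\<exists>z\<in>W. fock z = q r" if "r \<le> e" for r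
  proof -
    obtain z where z: "fock z = q r" using fock_surj q(3) by blast
    have "refl_inv UNIV (q r)" using q(1) that by (intro refl_inv_components[OF inv q(2)]) auto
    moreover have "homog r (q r)" using q(1) by (simp add: homog_def scale_on_def)
    ultimately have "z \<in> W" by (intro refl_invariant_in_W[of r]) (auto simp: z)
    with z show ?thesis by blast
  qed
  then obtain z where z: "\<And>r. r \<le> e \<Longrightarrow> z r \<in> W \<and> fock (z r) = q r" by metis
  have "v = (\<Sum>r\<le>e. z r)" by (rule fock_inject) (simp add: fock_sum q(2) z)
  also have "\<dots> \<in> W" using z by (intro W_sum) auto
  finally show "v \<in> W" .
qed

end

theorem lemma4p2:
  fixes V :: "'v::ab_group_add va_data" and \<alpha> :: "'n::finite \<Rightarrow> 'v"
  assumes "heisenberg V \<alpha>"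
  shows "va_generated V {quad V \<alpha> 0, quad V \<alpha> 2} = orth_invariants V \<alpha>"
proof -
  interpret heisenberg V \<alpha> by fact
  show ?thesis using generated_subset_invariants invariants_subset_generated by blast
qed

end
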